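(* For all integers $k\ge 6$, \[ \frac{1}{k+1}\le \mathrm{pf}(A^+_{k+1})\le \frac{1}{(k-1)^{1/3}}. \]
   Context: For a compact group $G$ with normalized Haar measure $\mu$ ($\mu(G)=1$), the product-free measure is $\mathrm{pf}(G)=\sup\{\mu(A): A\subseteq G \text{ measurable},\ A\cap A^2=\emptyset\}$, where $A^2=\{ab:a,b\in A\}$. Let $T=T_{k+1}$ be the (infinite) regular tree of degree $k+1$, with one vertex $O$ fixed as root. An automorphism of $T$ is a permutation of the vertices preserving incidence; the automorphism group carries the topology of pointwise convergence. Let $A_{k+1}$ be the stabilizer of $O$ in the automorphism group of $T$; it is a profinite group. For each $j\ge 1$, every $x\in A_{k+1}$ permutes the $(k+1)k^{j-1}$ vertices at distance $j$ from $O$, and $\sigma_j(x)$ denotes this permutation, giving a homomorphism $\sigma_j:A_{k+1}\to\Sigma_{(k+1)k^{j-1}}$ to the symmetric group. The element $x$ is called positive if $\sigma_j(x)$ is an even permutation for all $j\ge 1$. $A^+_{k+1}$ is the group of all positive elements of $A_{k+1}$, a closed subgroup of $A_{k+1}$ and hence a profinite group. *)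

theory Defs
  imports "HOL-Analysis.Analysis" "HOL-Algebra.Coset" "HOL-Combinatorics.Orbits"
begin

section \<open>Regular trees\<close>

text \<open>A graph is given by its adjacency relation; its vertices are all elements of the type.\<close>

definition is_cycle :: "('v \<Rightarrow> 'v \<Rightarrow> bool) \<Rightarrow> 'v list \<Rightarrow> bool" where
  "is_cycle E vs \<longleftrightarrow> 3 \<le> length vs \<and> distinct vs \<and> successively E vs \<and> E (last vs) (hd vs)"

definition tree :: "('v \<Rightarrow> 'v \<Rightarrow> bool) \<Rightarrow> bool" where
  "tree E \<longleftrightarrow> symp E \<and> irreflp E \<and> (\<forall>u v. E\<^sup>*\<^sup>* u v) \<and> (\<nexists>vs. is_cycle E vs)"

text \<open>For \<open>d \<ge> 2\<close> such a tree is automatically infinite.\<close>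

definition regular_tree :: "nat \<Rightarrow> ('v \<Rightarrow> 'v \<Rightarrow> bool) \<Rightarrow> bool" where
  "regular_tree d E \<longleftrightarrow> tree E \<and> (\<forall>v. finite {w. E v w} \<and> card {w. E v w} = d)"

definition graph_dist :: "('v \<Rightarrow> 'v \<Rightarrow> bool) \<Rightarrow> 'v \<Rightarrow> 'v \<Rightarrow> nat" where
  "graph_dist E u v = (LEAST n. (E ^^ n) u v)"

definition level :: "('v \<Rightarrow> 'v \<Rightarrow> bool) \<Rightarrow> 'v \<Rightarrow> nat \<Rightarrow> 'v set" where
  "level E r j = {v. graph_dist E r v = j}"

section \<open>Positive root-fixing automorphisms\<close>

definition graph_aut :: "('v \<Rightarrow> 'v \<Rightarrow> bool) \<Rightarrow> ('v \<Rightarrow> 'v) set" where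
  "graph_aut E = {x. bij x \<and> (\<forall>u v. E (x u) (x v) \<longleftrightarrow> E u v)}"

definition root_stabilizer :: "('v \<Rightarrow> 'v \<Rightarrow> bool) \<Rightarrow> 'v \<Rightarrow> ('v \<Rightarrow> 'v) set" where
  "root_stabilizer E r = {x \<in> graph_aut E. x r = r}"

text \<open>The permutation induced on level \<open>j\<close> is extended by the identity outside that level,
  which does not change its parity.\<close>

definition level_perm :: "('v \<Rightarrow> 'v \<Rightarrow> bool) \<Rightarrow> 'v \<Rightarrow> nat \<Rightarrow> ('v \<Rightarrow> 'v) \<Rightarrow> 'v \<Rightarrow> 'v" where
  "level_perm E r j x = perm_restrict x (level E r j)"

definition positive_aut :: "('v \<Rightarrow> 'v \<Rightarrow> bool) \<Rightarrow> 'v \<Rightarrow> ('v \<Rightarrow> 'v) \<Rightarrow> bool" where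
  "positive_aut E r x \<longleftrightarrow> (\<forall>j\<ge>1. evenperm (level_perm E r j x))"

definition positive_group :: "('v \<Rightarrow> 'v \<Rightarrow> bool) \<Rightarrow> 'v \<Rightarrow> ('v \<Rightarrow> 'v) monoid" where
  "positive_group E r =
     \<lparr>carrier = {x \<in> root_stabilizer E r. positive_aut E r x}, mult = (\<circ>), one = id\<rparr>"

text \<open>Topology of pointwise convergence, for the discrete topology on the vertices.\<close>

definition pointwise_topology :: "('v \<Rightarrow> 'v) set \<Rightarrow> ('v \<Rightarrow> 'v) topology" where
  "pointwise_topology S =
     subtopology (product_topology (\<lambda>_. discrete_topology UNIV) UNIV) S"

section \<open>Haar measure and product-free measure\<close>

text \<open>Intended for a compact Hausdorff topological group \<open>G\<close> with topology \<open>T\<close> on its carrier: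
  a left-invariant regular Borel probability measure. Inner regularity by compact sets follows
  from outer regularity by taking complements.\<close>

definition normalized_haar_measure ::
    "('a, 'b) monoid_scheme \<Rightarrow> 'a topology \<Rightarrow> 'a measure \<Rightarrow> bool" where
  "normalized_haar_measure G T \<mu> \<longleftrightarrow>
     space \<mu> = carrier G \<and>
     sets \<mu> = sigma_sets (carrier G) {U. openin T U} \<and>
     emeasure \<mu> (space \<mu>) = 1 \<and>
     (\<forall>g\<in>carrier G. \<forall>A\<in>sets \<mu>. emeasure \<mu> (g <#\<^bsub>G\<^esub> A) = emeasure \<mu> A) \<and>
     (\<forall>A\<in>sets \<mu>. emeasure \<mu> A = (INF U\<in>{U. openin T U \<and> A \<subseteq> U}. emeasure \<mu> U))"

text \<open>The measure \<open>\<mu>\<close> is meant to be the normalized Haar measure of \<open>G\<close>.\<close>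

definition pf :: "('a, 'b) monoid_scheme \<Rightarrow> 'a measure \<Rightarrow> real" where
  "pf G \<mu> = Sup {measure \<mu> A | A. A \<in> sets \<mu> \<and> A \<inter> (A <#>\<^bsub>G\<^esub> A) = {}}"

end

(* Upper bound. By outer regularity a product-free set is approximated by a union of cosets of the
   subgroup fixing a ball around the root, and Gowers' argument on the finite quotient bounds its
   measure by m^(-1/3), where m bounds from below the dimension of every real representation of the
   quotient without invariant vectors.

   Let R be the group of even permutations of the k+1 main subtrees, acting rigidly. Its normal
   closure is everything modulo the stabilizer of a ball: a commutator of an element of R with a
   product of two swaps of sibling subtrees identifies a swap with its translates in other main
   subtrees; conjugating by elements moving only one of these main subtrees, all swaps at the same
   level become equal, and the permutation of a level induced by a positive element is an even
   product of such swaps. So R acts non-trivially, and it suffices that a non-trivial real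
   representation of Alt(n), n >= 7, has dimension at least n-2. For this, split off the three
   non-trivial eigenspaces of a Klein four-group on a 4-set. If Alt(n-4) acts non-trivially on them,
   induct. If not, the translates of an eigenvector under some Alt(n-3) have the Gram matrix of a
   regular simplex, whose edges supply n-5 further dimensions.

   Lower bound. For distinct neighbours u, v of the root, the elements mapping u to v form a
   product-free set. *)

theory Submission
  imports Defs
begin

section \<open>Alternating groups\<close>

text \<open>Positivity is what makes an upper bound possible: for a non-trivial sign homomorphism
  the odd elements form a product-free set of measure 1/2, and the sign itself is a one-dimensional
  representation without invariant vectors. A single swap is never positive, so inside the group one
  can only speak of products of two swaps; this is why swaps are compared through a relation instead
  of being shown to lie in a subgroup.

  A dimension bound takes the form of so many pairwise orthogonal nonzero vectors: these add up over
  orthogonal eigenspaces, and they are what Bessel's inequality consumes. With n = k + 1 letters the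
  bound n - 2 is m = k - 1, and n >= 7 is k >= 6; the n - 4 letters that remain beside the Klein
  four-group must be at least 3 in number to carry a 3-cycle.

  The exponent 1/3 comes from comparing the expected density a^3 of solutions of xy = z with the
  error a sqrt(a/m). The approximating union of cosets is only nearly product-free, hence a further
  error 3e that is sent to 0.\<close>

abbreviation transposition :: "'p \<Rightarrow> 'p \<Rightarrow> 'p \<Rightarrow> 'p" where
  "transposition \<equiv> Transposition.transpose"

definition alternating :: "'p set \<Rightarrow> ('p \<Rightarrow> 'p) set" where
  "alternating P = {\<pi>. \<pi> permutes P \<and> evenperm \<pi>}"

definition cyc3 :: "'p \<Rightarrow> 'p \<Rightarrow> 'p \<Rightarrow> 'p \<Rightarrow> 'p" where
  "cyc3 a b c = transposition a b \<circ> transposition b c"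

lemma cyc3_apply:
  assumes "distinct [a, b, c]"
  shows "cyc3 a b c x = (if x = a then b else if x = b then c else if x = c then a else x)"
  using assms by (auto simp: cyc3_def Transposition.transpose_def)

text \<open>The right-hand side is the commutator of \<open>cyc3 x p q\<close> and
  \<open>cyc3 y p q\<close>. Each of these fixes one of \<open>x\<close> and \<open>y\<close>, so a
  double transposition is obtained from groups that move only one of the two letters.\<close>

lemma double_transposition_as_cyc3:
  assumes "distinct [x, y, p, q]"
  shows "transposition x y \<circ> transposition p q = (cyc3 x p q \<circ> cyc3 y p q) \<circ> (cyc3 x q p \<circ> cyc3 y q p)"
proof
  fix z
  have "x \<noteq> y" "x \<noteq> p" "x \<noteq> q" "y \<noteq> p" "y \<noteq> q" "p \<noteq> q" using assms by auto
  then show "(transposition x y \<circ> transposition p q) z = ((cyc3 x p q \<circ> cyc3 y p q) \<circ> (cyc3 x q p \<circ> cyc3 y q p)) z"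
    by (cases "z = x"; cases "z = y"; cases "z = p"; cases "z = q")
      (simp_all add: cyc3_apply Transposition.transpose_def)
qed

lemma alternating_permutes: "\<pi> \<in> alternating P \<Longrightarrow> \<pi> permutes P"
  by (simp add: alternating_def)

lemma alternating_id [simp]: "id \<in> alternating P"
  by (simp add: alternating_def permutes_id)

lemma alternating_comp:
  assumes "finite P" "\<pi> \<in> alternating P" "\<tau> \<in> alternating P"
  shows "\<pi> \<circ> \<tau> \<in> alternating P"
  using assms by (auto simp: alternating_def evenperm_comp permutes_compose permutes_imp_permutation)

lemma alternating_inv:
  assumes "finite P" "\<pi> \<in> alternating P"
  shows "inv_into UNIV \<pi> \<in> alternating P"
  using assms by (auto simp: alternating_def evenperm_inv permutes_inv permutes_imp_permutation)

lemma alternating_mono: "P \<subseteq> Q \<Longrightarrow> alternating P \<subseteq> alternating Q"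
  by (auto simp: alternating_def intro: permutes_subset)

lemma transpose_comp_alternating:
  assumes "a \<in> P" "b \<in> P" "c \<in> P" "d \<in> P" "a \<noteq> b" "c \<noteq> d"
  shows "transposition a b \<circ> transposition c d \<in> alternating P"
  using assms
  by (auto simp: alternating_def evenperm_comp evenperm_swap permutation_swap_id
      intro!: permutes_compose permutes_swap_id)

lemma cyc3_alternating:
  assumes "a \<in> P" "b \<in> P" "c \<in> P" "distinct [a, b, c]"
  shows "cyc3 a b c \<in> alternating P"
  unfolding cyc3_def using assms by (intro transpose_comp_alternating) auto

text \<open>An induction principle for even permutations: closure under composition replaces a
  subgroup, so applications need not treat inverses.\<close>

lemma alternating_subset_cyc3_closed:
  assumes fin: "finite P" and id: "id \<in> C"
    and comp: "\<And>f g. f \<in> C \<Longrightarrow> g \<in> C \<Longrightarrow> f \<circ> g \<in> C"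
    and cyc: "\<And>a b c. a \<in> P \<Longrightarrow> b \<in> P \<Longrightarrow> c \<in> P \<Longrightarrow> distinct [a, b, c] \<Longrightarrow> cyc3 a b c \<in> C"
  shows "alternating P \<subseteq> C"
proof (cases "\<exists>a0\<in>P. \<exists>b0\<in>P. a0 \<noteq> b0")
  case False
  have "\<pi> = id" if "\<pi> permutes P" for \<pi>
    using that False by (metis permutes_in_image permutes_not_in eq_id_iff)
  then show ?thesis using id by (auto simp: alternating_def)
next
  case True
  then obtain a0 b0 where 0: "a0 \<in> P" "b0 \<in> P" "a0 \<noteq> b0" by blast
  have two: "transposition a b \<circ> transposition c d \<in> C"
    if m: "a \<in> P" "b \<in> P" "c \<in> P" "d \<in> P" and ne: "a \<noteq> b" "c \<noteq> d" for a b c d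
  proof -
    have sh: "transposition x y \<circ> transposition y z \<in> C"
      if "x \<in> P" "y \<in> P" "z \<in> P" "x \<noteq> y" "y \<noteq> z" for x y z
    proof (cases "x = z")
      case True
      then show ?thesis using id by (simp add: transpose_commute[of y z])
    next
      case False
      then show ?thesis using cyc[of x y z] that by (simp add: cyc3_def)
    qed
    consider "b = c" | "b = d" | "a = c" | "a = d" | "distinct [a, b, c, d]"
      using ne by auto
    then show ?thesis
    proof cases
      case 1 then show ?thesis using sh[of a b d] m ne by simp
    next
      case 2 then show ?thesis using sh[of a b c] m ne by (simp add: transpose_commute[of c d])
    next
      case 3 then show ?thesis using sh[of b a d] m ne by (subst transpose_commute) simp
    next
      case 4 then show ?thesis using sh[of b a c] m ne
        by (metis transpose_commute)
    next
      case 5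
      have "transposition a b \<circ> transposition c d
        = (transposition a b \<circ> transposition b c) \<circ> (transposition b c \<circ> transposition c d)"
        by (simp add: fun_eq_iff)
      also have "\<dots> \<in> C"
        using 5 m by (intro comp sh) auto
      finally show ?thesis .
    qed
  qed
  \<comment> \<open>Odd permutations are carried along, corrected by a fixed transposition, because
    the induction adds one transposition at a time and alternates the parity.\<close>
  have "(evenperm \<pi> \<longrightarrow> \<pi> \<in> C) \<and> (\<not> evenperm \<pi> \<longrightarrow> transposition a0 b0 \<circ> \<pi> \<in> C)"
    if "\<pi> permutes P" for \<pi>
    using that fin
  proof (induction rule: permutes_induct)
    case id
    then show ?case using assms(2) by (simp add: id_def)
  next
    case (swap a b p)
    have p: "permutation p" using swap fin permutes_imp_permutation by blast
    have ev: "evenperm (transposition a b \<circ> p) \<longleftrightarrow> \<not> evenperm p"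
      using swap p by (simp add: evenperm_comp evenperm_swap permutation_swap_id)
    show ?case
    proof (cases "evenperm p")
      case True
      then have "(transposition a0 b0 \<circ> transposition a b) \<circ> p \<in> C"
        using swap 0 by (intro comp two) auto
      then show ?thesis using ev True by (simp add: comp_def)
    next
      case F: False
      then have "(transposition a b \<circ> transposition a0 b0) \<circ> (transposition a0 b0 \<circ> p) \<in> C"
        using swap 0 F by (intro comp[OF two]) (auto simp: comp_def)
      moreover have "(transposition a b \<circ> transposition a0 b0) \<circ> (transposition a0 b0 \<circ> p) = transposition a b \<circ> p"
        by (simp add: fun_eq_iff)
      ultimately show ?thesis using ev F by (simp add: comp_def)
    qed
  qed
  then show ?thesis by (auto simp: alternating_def)
qed

lemma obtain_two:
  assumes "card A \<ge> 2"
  obtains x y where "x \<in> A" "y \<in> A" "x \<noteq> y"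
proof -
  have "finite A" using assms card.infinite by fastforce
  then have "\<not> (\<forall>x\<in>A. \<forall>y\<in>A. x = y)"
    using assms card_le_Suc0_iff_eq[of A] by linarith
  then show ?thesis using that by blast
qed

text \<open>Two transpositions achieve the required images; if their product is odd, one more
  transposition of two letters outside \<open>{i', j'}\<close> repairs the parity. Four letters
  leave room for it.\<close>

lemma alternating_2_transitive:
  assumes fin: "finite P" and card: "card P \<ge> 4"
    and P: "i \<in> P" "j \<in> P" "i' \<in> P" "j' \<in> P" and ne: "i \<noteq> j" "i' \<noteq> j'"
  obtains g where "g \<in> alternating P" "g i = i'" "g j = j'"
proof -
  define h where "h = transposition (transposition i i' j) j' \<circ> transposition i i'"
  have x: "transposition i i' j \<in> P" "transposition i i' j \<noteq> i'"
    using P ne by (auto simp: Transposition.transpose_def)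
  have h: "h permutes P" "h i = i'" "h j = j'"
    using P ne x by (simp_all add: h_def permutes_compose permutes_swap_id)
  have "card (P - {i', j'}) \<ge> 2"
    using card card_Diff_subset[of "{i', j'}" P] P ne by simp
  then obtain x y where xy: "x \<in> P - {i', j'}" "y \<in> P - {i', j'}" "x \<noteq> y"
    by (rule obtain_two)
  show ?thesis
  proof (cases "evenperm h")
    case True
    then show ?thesis using that[of h] h by (simp add: alternating_def)
  next
    case False
    have "evenperm (transposition x y \<circ> h)"
      using False xy h fin permutes_imp_permutation[OF fin h(1)]
      by (simp add: evenperm_comp evenperm_swap permutation_swap_id)
    moreover have "transposition x y \<circ> h permutes P"
      using xy h by (auto intro!: permutes_compose permutes_swap_id)
    moreover have "(transposition x y \<circ> h) i = i'" "(transposition x y \<circ> h) j = j'"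
      using xy h by (auto simp: Transposition.transpose_def)
    ultimately show ?thesis using that[of "transposition x y \<circ> h"] by (simp add: alternating_def)
  qed
qed

section \<open>Orthogonal families\<close>

text \<open>Says that the dimension is at least \<open>m\<close>, in a form that makes sense in any
  inner product space and needs no basis.\<close>

definition has_orthogonal :: "nat \<Rightarrow> 'a::real_inner set \<Rightarrow> bool" where
  "has_orthogonal m V \<longleftrightarrow> (\<exists>B\<subseteq>V. finite B \<and> card B = m \<and> pairwise orthogonal B \<and> 0 \<notin> B)"

lemma has_orthogonal_mono:
  assumes "has_orthogonal m V" "n \<le> m" "V \<subseteq> W"
  shows "has_orthogonal n W"
proof -
  obtain B where B: "B \<subseteq> V" "finite B" "card B = m" "pairwise orthogonal B" "0 \<notin> B"
    using assms by (auto simp: has_orthogonal_def)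
  obtain C where "C \<subseteq> B" "card C = n"
    using B assms(2) obtain_subset_with_card_n by metis
  then show ?thesis
    unfolding has_orthogonal_def using B assms(3)
    by (intro exI[of _ C]) (auto intro: finite_subset pairwise_mono)
qed

lemma has_orthogonal_Un:
  assumes "has_orthogonal m V" "has_orthogonal n W"
    and "\<And>v w. v \<in> V \<Longrightarrow> w \<in> W \<Longrightarrow> inner v w = 0"
  shows "has_orthogonal (m + n) (V \<union> W)"
proof -
  obtain B where B: "B \<subseteq> V" "finite B" "card B = m" "pairwise orthogonal B" "0 \<notin> B"
    using assms by (auto simp: has_orthogonal_def)
  obtain C where C: "C \<subseteq> W" "finite C" "card C = n" "pairwise orthogonal C" "0 \<notin> C"
    using assms by (auto simp: has_orthogonal_def)
  have "B \<inter> C = {}"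
  proof (rule ccontr)
    assume "B \<inter> C \<noteq> {}"
    then obtain x where "x \<in> B" "x \<in> C" by blast
    then have "inner x x = 0" "x \<noteq> 0" using assms(3)[of x x] B C by blast+
    then show False by simp
  qed
  then have "card (B \<union> C) = m + n" using B C by (simp add: card_Un_disjoint)
  moreover have "pairwise orthogonal (B \<union> C)"
    using B C assms(3) unfolding pairwise_def orthogonal_def
    by (metis UnE inner_commute subset_iff)
  ultimately show ?thesis
    unfolding has_orthogonal_def using B C by (intro exI[of _ "B \<union> C"]) auto
qed

lemma has_orthogonal_image:
  assumes "has_orthogonal m V" "orthogonal_transformation f"
  shows "has_orthogonal m (f ` V)"
proof -
  obtain B where B: "B \<subseteq> V" "finite B" "card B = m" "pairwise orthogonal B" "0 \<notin> B"
    using assms by (auto simp: has_orthogonal_def)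
  have inner: "inner (f v) (f w) = inner v w" for v w
    using assms(2) by (simp add: orthogonal_transformation_def)
  have inj: "f v = f w \<Longrightarrow> v = w" for v w
    using assms(2) orthogonal_transformation_inj by (auto simp: inj_def)
  have "card (f ` B) = m" using B inj by (metis card_image inj_on_def)
  moreover have "pairwise orthogonal (f ` B)"
    using B by (auto simp: pairwise_def orthogonal_def inner)
  moreover have "0 \<notin> f ` B"
    using B inner by (metis imageE inner_eq_zero_iff)
  ultimately show ?thesis
    unfolding has_orthogonal_def using B by (intro exI[of _ "f ` B"]) auto
qed

lemma has_orthogonal_singleton: "v \<noteq> 0 \<Longrightarrow> has_orthogonal 1 {v}"
  unfolding has_orthogonal_def by (intro exI[of _ "{v}"]) (auto simp: pairwise_def)

text \<open>Gram--Schmidt applied to the edges of a regular simplex gives these vectors explicitly: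
  vertex \<open>q\<close> contributes the sum of its differences with the earlier vertices.\<close>

lemma has_orthogonal_simplex:
  fixes s :: "'i \<Rightarrow> 'a::real_inner"
  assumes "finite Q" "Q \<noteq> {}" "c \<noteq> d"
    and "\<And>i. i \<in> Q \<Longrightarrow> inner (s i) (s i) = d"
    and "\<And>i j. i \<in> Q \<Longrightarrow> j \<in> Q \<Longrightarrow> i \<noteq> j \<Longrightarrow> inner (s i) (s j) = c"
  shows "has_orthogonal (card Q - 1) (span {s i - s j |i j. i \<in> Q \<and> j \<in> Q})"
  using assms
proof (induction rule: finite_ne_induct)
  case (singleton x)
  show ?case by (auto simp: has_orthogonal_def)
next
  case (insert q Q)
  let ?D = "\<lambda>Q. {s i - s j |i j. i \<in> Q \<and> j \<in> Q}"
  define u where "u = (\<Sum>j\<in>Q. s j - s q)"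
  have IH: "has_orthogonal (card Q - 1) (span (?D Q))"
    using insert by simp
  have row: "(\<Sum>j\<in>Q. inner (s j) (s i)) = d + (real (card Q) - 1) * c" if "i \<in> Q" for i
  proof -
    have "(\<Sum>j\<in>Q. inner (s j) (s i)) = inner (s i) (s i) + (\<Sum>j\<in>Q - {i}. inner (s j) (s i))"
      using that insert.hyps by (simp add: sum.remove)
    also have "(\<Sum>j\<in>Q - {i}. inner (s j) (s i)) = (\<Sum>j\<in>Q - {i}. c)"
      using insert.prems that by (intro sum.cong) auto
    also have "inner (s i) (s i) = d" using that insert.prems by simp
    also have "(\<Sum>j\<in>Q - {i}. c) = (real (card Q) - 1) * c"
      using that insert.hyps card_gt_0_iff[of Q] by (simp add: of_nat_diff Suc_leI)
    finally show ?thesis .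
  qed
  have rowq: "(\<Sum>j\<in>Q. inner (s j) (s q)) = real (card Q) * c"
  proof -
    have "(\<Sum>j\<in>Q. inner (s j) (s q)) = (\<Sum>j\<in>Q. c)"
      using insert by (intro sum.cong) auto
    then show ?thesis by simp
  qed
  have qi: "inner (s q) (s i) = c" if "i \<in> Q" for i
    using insert that by (metis insertI1 insertI2)
  have qq: "inner (s q) (s q) = d" using insert by simp
  have orth: "inner u v = 0" if "v \<in> ?D Q" for v
  proof -
    obtain i l where v: "v = s i - s l" "i \<in> Q" "l \<in> Q" using \<open>v \<in> ?D Q\<close> by blast
    have "inner u v = (\<Sum>j\<in>Q. inner (s j) (s i)) - (\<Sum>j\<in>Q. inner (s j) (s l))"
      using v by (simp add: u_def inner_sum_left inner_diff qi sum_subtractf)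
    then show ?thesis using row v by simp
  qed
  have orth': "inner v u = 0" if "v \<in> span (?D Q)" for v
  proof -
    have "orthogonal u v"
      by (rule orthogonal_to_span[OF that]) (use orth in \<open>auto simp: orthogonal_def\<close>)
    then show ?thesis by (simp add: orthogonal_def inner_commute)
  qed
  \<comment> \<open>It suffices that \<open>u\<close> has a nonzero inner product with one edge at
    \<open>q\<close>; the product is a positive multiple of \<open>d - c\<close>.\<close>
  have "u \<noteq> 0"
  proof
    assume "u = 0"
    obtain i where i: "i \<in> Q" using insert.hyps by blast
    have "inner u (s i - s q) = (real (card Q) + 1) * (d - c)"
      using i by (simp add: u_def inner_sum_left inner_diff qi sum_subtractf sum.distrib row rowq qq algebra_simps)
    then show False using \<open>u = 0\<close> insert.prems(1) by (simp add: add_eq_0_iff_both_eq_0 del: of_nat_add)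
  qed
  have h: "has_orthogonal (card Q - 1 + 1) (span (?D Q) \<union> {u})"
    by (intro has_orthogonal_Un IH has_orthogonal_singleton) (use \<open>u \<noteq> 0\<close> orth' in auto)
  have "u \<in> span (?D (insert q Q))"
    unfolding u_def by (intro span_sum span_base) auto
  moreover have "span (?D Q) \<subseteq> span (?D (insert q Q))"
    by (intro span_mono) auto
  ultimately have sub: "span (?D Q) \<union> {u} \<subseteq> span (?D (insert q Q))"
    by simp
  have "card (insert q Q) - 1 \<le> card Q - 1 + 1"
    using insert.hyps by simp
  then show ?case
    by (rule has_orthogonal_mono[OF h _ sub])
qed

section \<open>Orthogonal representations of alternating groups\<close>

text \<open>\<open>\<rho>\<close> acts on the whole type and \<open>V\<close> is a separate
  parameter, so that passing to fewer letters and to a smaller invariant subspace leaves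
  \<open>\<rho>\<close> unchanged, as the induction on the number of letters requires.\<close>

locale alternating_action =
  fixes P :: "'p set" and \<rho> :: "('p \<Rightarrow> 'p) \<Rightarrow> 'a::real_inner \<Rightarrow> 'a" and V :: "'a set"
  assumes fin: "finite P"
    and subsp: "subspace V"
    and rho_id: "\<rho> id = id"
    and orth: "\<And>\<pi>. \<pi> \<in> alternating P \<Longrightarrow> orthogonal_transformation (\<rho> \<pi>)"
    and rho_comp: "\<And>\<pi> \<tau>. \<pi> \<in> alternating P \<Longrightarrow> \<tau> \<in> alternating P \<Longrightarrow> \<rho> (\<pi> \<circ> \<tau>) = \<rho> \<pi> \<circ> \<rho> \<tau>"
    and invariant: "\<And>\<pi> v. \<pi> \<in> alternating P \<Longrightarrow> v \<in> V \<Longrightarrow> \<rho> \<pi> v \<in> V"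
begin

definition nontrivial :: bool where
  "nontrivial \<longleftrightarrow> (\<exists>\<pi>\<in>alternating P. \<exists>v\<in>V. \<rho> \<pi> v \<noteq> v)"

lemma restrict:
  assumes "Q \<subseteq> P" "subspace U" "\<And>\<pi> v. \<pi> \<in> alternating Q \<Longrightarrow> v \<in> U \<Longrightarrow> \<rho> \<pi> v \<in> U"
  shows "alternating_action Q \<rho> U"
  using assms alternating_mono[OF assms(1)] fin rho_id orth
  by unfold_locales (auto intro: finite_subset intro!: rho_comp)

lemma rho_comp_apply:
  "\<pi> \<in> alternating P \<Longrightarrow> \<tau> \<in> alternating P \<Longrightarrow> \<rho> \<pi> (\<rho> \<tau> v) = \<rho> (\<pi> \<circ> \<tau>) v"
  by (simp add: rho_comp)

lemma inner_rho: "\<pi> \<in> alternating P \<Longrightarrow> inner (\<rho> \<pi> u) (\<rho> \<pi> v) = inner u v"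
  using orth by (simp add: orthogonal_transformation_def)

lemma linear_rho: "\<pi> \<in> alternating P \<Longrightarrow> linear (\<rho> \<pi>)"
  using orth by (simp add: orthogonal_transformation_def)

lemma fixed_subset_cyc3:
  assumes "\<And>a b c. a \<in> P \<Longrightarrow> b \<in> P \<Longrightarrow> c \<in> P \<Longrightarrow> distinct [a, b, c] \<Longrightarrow> \<rho> (cyc3 a b c) v = v"
    and "\<pi> \<in> alternating P"
  shows "\<rho> \<pi> v = v"
proof -
  have "alternating P \<subseteq> {\<pi> \<in> alternating P. \<rho> \<pi> v = v}"
    by (rule alternating_subset_cyc3_closed)
      (use assms fin rho_id in \<open>auto simp: alternating_comp rho_comp cyc3_alternating\<close>)
  then show ?thesis using assms(2) by blast
qed

lemma sign_orthogonal:
  assumes "\<pi> \<in> alternating P" "\<rho> \<pi> u = u" "\<rho> \<pi> v = - v"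
  shows "inner u v = 0"
  using inner_rho[OF assms(1), of u v] assms(2,3) by simp

text \<open>Some 3-cycle \<open>g\<close> moves some \<open>v\<close>, and u = v - gv satisfies u +
  gu + ggu = 0: on the plane of u and gu, \<open>g\<close> is a rotation by 120 degrees.\<close>

lemma has_orthogonal_2:
  assumes nontrivial
  shows "has_orthogonal 2 V"
proof -
  obtain \<pi> v where "\<pi> \<in> alternating P" "v \<in> V" "\<rho> \<pi> v \<noteq> v"
    using assms by (auto simp: nontrivial_def)
  then obtain a b c where abc: "a \<in> P" "b \<in> P" "c \<in> P" "distinct [a, b, c]" "\<rho> (cyc3 a b c) v \<noteq> v"
    using fixed_subset_cyc3 by meson
  define g where "g = cyc3 a b c"
  have g: "g \<in> alternating P" using abc cyc3_alternating by (simp add: g_def)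
  have g3: "g \<circ> (g \<circ> g) = id"
    using abc by (auto simp: g_def cyc3_apply fun_eq_iff)
  define u where "u = v - \<rho> g v"
  have "u \<in> V" using \<open>v \<in> V\<close> g invariant subsp by (simp add: u_def subspace_diff)
  have "u \<noteq> 0" using abc by (simp add: u_def g_def)
  have "\<rho> g (\<rho> g (\<rho> g v)) = v"
    using g g3 by (simp add: rho_comp_apply alternating_comp fin rho_id)
  then have uuu: "\<rho> g (\<rho> g u) = - u - \<rho> g u"
    by (simp add: u_def linear_diff[OF linear_rho[OF g]])
  have 1: "inner (\<rho> g u) (\<rho> g u) = inner u u" using inner_rho[OF g] by simp
  have "inner (\<rho> g (\<rho> g u)) (\<rho> g (\<rho> g u)) = inner u u" using inner_rho[OF g] by simp
  then have 2: "2 * inner u (\<rho> g u) = - inner u u"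
    unfolding uuu using 1 by (simp add: inner_diff inner_commute)
  \<comment> \<open>The inner product of u and gu is minus half that of u with itself, so the
    coefficient 2 makes \<open>w\<close> orthogonal to \<open>u\<close>.\<close>
  define w where "w = u + 2 *\<^sub>R \<rho> g u"
  have "inner u w = 0" using 2 by (simp add: w_def inner_add)
  moreover have "inner w w = 3 * inner u u"
    using 1 2 by (simp add: w_def inner_add inner_commute)
  then have "w \<noteq> 0" using \<open>u \<noteq> 0\<close> by (metis inner_eq_zero_iff mult_eq_0_iff zero_neq_numeral)
  moreover have "w \<in> V"
    using \<open>u \<in> V\<close> g invariant subsp by (simp add: w_def subspace_add subspace_mul)
  ultimately have "has_orthogonal (1 + 1) ({u} \<union> {w})"
    using \<open>u \<noteq> 0\<close> by (intro has_orthogonal_Un has_orthogonal_singleton) auto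
  then show ?thesis
    by (rule has_orthogonal_mono) (use \<open>u \<in> V\<close> \<open>w \<in> V\<close> in auto)
qed

text \<open>Double transpositions generate the alternating group on five or more letters, so one of
  them moves some vector; the rest is splitting that vector into eigenvectors of a Klein
  four-group.\<close>

lemma obtain_klein_vector:
  assumes nontrivial "card P \<ge> 5"
  obtains a b c d w where "{a, b, c, d} \<subseteq> P" "distinct [a, b, c, d]" "w \<in> V" "w \<noteq> 0"
    "\<rho> (transposition a b \<circ> transposition c d) w = w" "\<rho> (transposition a c \<circ> transposition b d) w = - w"
proof -
  obtain \<pi> v where v: "\<pi> \<in> alternating P" "v \<in> V" "\<rho> \<pi> v \<noteq> v"
    using assms by (auto simp: nontrivial_def)
  have "\<exists>a b c d. {a, b, c, d} \<subseteq> P \<and> distinct [a, b, c, d] \<and> \<rho> (transposition a b \<circ> transposition c d) v \<noteq> v"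
  proof (rule ccontr)
    assume neg: "\<not> ?thesis"
    then have neg': "\<rho> (transposition a b \<circ> transposition c d) v = v"
      if "{a, b, c, d} \<subseteq> P" "distinct [a, b, c, d]" for a b c d
      using that by blast
    have "\<rho> (cyc3 a b c) v = v" if abc: "a \<in> P" "b \<in> P" "c \<in> P" "distinct [a, b, c]" for a b c
    proof -
      have "card (P - {a, b, c}) \<ge> 2"
        using assms(2) abc card_Diff_subset[of "{a, b, c}" P] by simp
      then obtain d e where de: "d \<in> P - {a, b, c}" "e \<in> P - {a, b, c}" "d \<noteq> e"
        by (rule obtain_two)
      \<comment> \<open>A spare pair \<open>d\<close>, \<open>e\<close> outside the 3-cycle turns
        each of its two transpositions into a double transposition.\<close>
      have "cyc3 a b c = (transposition a b \<circ> transposition d e) \<circ> (transposition d e \<circ> transposition b c)"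
        by (simp add: cyc3_def fun_eq_iff)
      moreover have "transposition a b \<circ> transposition d e \<in> alternating P" "transposition d e \<circ> transposition b c \<in> alternating P"
        using abc de by (auto intro!: transpose_comp_alternating)
      moreover have "\<rho> (transposition a b \<circ> transposition d e) v = v" "\<rho> (transposition d e \<circ> transposition b c) v = v"
        by (intro neg'; use abc de in auto)+
      ultimately show ?thesis by (simp add: rho_comp)
    qed
    then show False using fixed_subset_cyc3 v by blast
  qed
  then obtain a b c d where abcd: "{a, b, c, d} \<subseteq> P" "distinct [a, b, c, d]"
    and ne: "\<rho> (transposition a b \<circ> transposition c d) v \<noteq> v" by blast
  define e f where "e = transposition a b \<circ> transposition c d" and "f = transposition a c \<circ> transposition b d"
  have ef: "e \<in> alternating P" "f \<in> alternating P"
    unfolding e_def f_def using abcd by (auto intro!: transpose_comp_alternating)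
  have ee: "e \<circ> e = id" and ff: "f \<circ> f = id" and com: "e \<circ> f = f \<circ> e"
    and prod: "e \<circ> f = transposition a d \<circ> transposition b c"
    using abcd by (auto simp: e_def f_def fun_eq_iff Transposition.transpose_def)
  define u where "u = v - \<rho> e v"
  have uV: "u \<in> V" using v ef invariant subsp by (simp add: u_def subspace_diff)
  have u0: "u \<noteq> 0" using ne by (simp add: u_def e_def)
  have "\<rho> e (\<rho> e v) = v" using ef ee by (simp add: rho_comp_apply rho_id)
  then have eu: "\<rho> e u = - u" by (simp add: u_def linear_diff[OF linear_rho[OF ef(1)]])
  \<comment> \<open>\<open>e\<close> negates \<open>u\<close>. Either \<open>f\<close> negates
    \<open>u\<close> too, and then the third involution \<open>e \<circ> f\<close> fixes it, or u +
    fu is a nonzero vector fixed by \<open>f\<close> and still negated by \<open>e\<close>. Renaming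
    the four letters brings the fixing involution to the first place.\<close>
  show ?thesis
  proof (cases "\<rho> f u = - u")
    case True
    have "\<rho> (e \<circ> f) u = u"
      using True eu ef by (simp add: rho_comp linear_neg[OF linear_rho])
    then show ?thesis
      using that[of a d b c u] abcd uV u0 eu prod
      by (auto simp: e_def transpose_commute[of d c])
  next
    case False
    define w where "w = u + \<rho> f u"
    have w0: "w \<noteq> 0" using False by (simp add: w_def add_eq_0_iff)
    have wV: "w \<in> V" using uV ef invariant subsp by (simp add: w_def subspace_add)
    have "\<rho> f (\<rho> f u) = u" using ef ff by (simp add: rho_comp_apply rho_id)
    then have fw: "\<rho> f w = w" by (simp add: w_def linear_add[OF linear_rho[OF ef(2)]])
    have "\<rho> e (\<rho> f u) = - \<rho> f u"
      using ef com eu by (metis linear_neg linear_rho rho_comp_apply)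
    then have "\<rho> e w = - w" using eu by (simp add: w_def linear_add[OF linear_rho[OF ef(1)]])
    then show ?thesis
      using that[of a c b d w] abcd wV w0 fw unfolding e_def f_def by auto
  qed
qed

end

section \<open>The three non-trivial eigenspaces of a Klein four-group\<close>

locale klein_action = alternating_action P \<rho> V
  for P :: "'p set" and \<rho> :: "('p \<Rightarrow> 'p) \<Rightarrow> 'a::real_inner \<Rightarrow> 'a" and V +
  fixes a b c d :: 'p
  assumes abcd: "{a, b, c, d} \<subseteq> P" "distinct [a, b, c, d]"
begin

definition e1 where "e1 = transposition a b \<circ> transposition c d"
definition e2 where "e2 = transposition a c \<circ> transposition b d"
definition e3 where "e3 = transposition a d \<circ> transposition b c"
definition t where "t = cyc3 b c d"

definition U where "U = {v \<in> V. \<rho> e1 v = v \<and> \<rho> e2 v = - v}"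

lemma klein_alternating: "e1 \<in> alternating P" "e2 \<in> alternating P" "e3 \<in> alternating P" "t \<in> alternating P"
  unfolding e1_def e2_def e3_def t_def using abcd
  by (auto intro!: transpose_comp_alternating cyc3_alternating)

lemma klein_relations: "t \<circ> e1 = e2 \<circ> t" "t \<circ> e2 = e3 \<circ> t" "t \<circ> e3 = e1 \<circ> t" "e1 = e2 \<circ> e3"
proof -
  note defs = e1_def e2_def e3_def t_def cyc3_apply fun_eq_iff Transposition.transpose_def
  show "t \<circ> e1 = e2 \<circ> t" using abcd by (auto simp: defs)
  show "t \<circ> e2 = e3 \<circ> t" using abcd by (auto simp: defs)
  show "t \<circ> e3 = e1 \<circ> t" using abcd by (auto simp: defs)
  show "e1 = e2 \<circ> e3" using abcd by (auto simp: defs)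
qed

lemma subspace_U: "subspace U"
  using subsp unfolding U_def subspace_def
  by (auto simp: linear_0[OF linear_rho] linear_add[OF linear_rho] linear_scale[OF linear_rho] klein_alternating)

text \<open>Conjugation by the 3-cycle \<open>t\<close> permutes \<open>e1\<close>,
  \<open>e2\<close>, \<open>e3\<close> cyclically, so \<open>\<rho> t\<close> and its square carry
  \<open>U\<close> to the other two eigenspaces. The signs of (\<open>e1\<close>, \<open>e2\<close>)
  on the three are (+, -), (-, +), (-, -); as they differ, the eigenspaces are orthogonal.\<close>

lemma U_signs:
  assumes "v \<in> U"
  shows "\<rho> e1 v = v" "\<rho> e2 v = - v" "\<rho> e2 (\<rho> t v) = \<rho> t v" "\<rho> e1 (\<rho> t v) = - \<rho> t v"
    "\<rho> e1 (\<rho> t (\<rho> t v)) = - \<rho> t (\<rho> t v)" "\<rho> e2 (\<rho> t (\<rho> t v)) = - \<rho> t (\<rho> t v)"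
proof -
  note k = klein_alternating
  have r: "\<rho> t (\<rho> e1 x) = \<rho> e2 (\<rho> t x)" "\<rho> t (\<rho> e2 x) = \<rho> e3 (\<rho> t x)" "\<rho> t (\<rho> e3 x) = \<rho> e1 (\<rho> t x)"
    "\<rho> e1 x = \<rho> e2 (\<rho> e3 x)" for x
    using klein_relations k by (simp_all add: rho_comp_apply)
  note neg = linear_neg[OF linear_rho]
  show 1: "\<rho> e1 v = v" "\<rho> e2 v = - v" using assms by (auto simp: U_def)
  show 2: "\<rho> e2 (\<rho> t v) = \<rho> t v" using r(1)[of v] 1 by simp
  have 3: "\<rho> e3 (\<rho> t v) = - \<rho> t v" using r(2)[of v] 1 k by (simp add: neg)
  show 4: "\<rho> e1 (\<rho> t v) = - \<rho> t v" using r(4)[of "\<rho> t v"] 2 3 k by (simp add: neg)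
  show "\<rho> e1 (\<rho> t (\<rho> t v)) = - \<rho> t (\<rho> t v)" using r(3)[of "\<rho> t v"] 3 k by (simp add: neg)
  show "\<rho> e2 (\<rho> t (\<rho> t v)) = - \<rho> t (\<rho> t v)" using r(1)[of "\<rho> t v"] 4 k by (simp add: neg)
qed

lemma has_orthogonal_triple:
  assumes "has_orthogonal m W" "W \<subseteq> U"
  shows "has_orthogonal (3 * m) (W \<union> \<rho> t ` W \<union> \<rho> t ` \<rho> t ` W)"
proof -
  have o: "orthogonal_transformation (\<rho> t)" using orth klein_alternating by blast
  have "has_orthogonal (m + m + m) (W \<union> \<rho> t ` W \<union> \<rho> t ` \<rho> t ` W)"
  proof (intro has_orthogonal_Un has_orthogonal_image o assms)
    fix v w assume "v \<in> W" "w \<in> \<rho> t ` W"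
    then show "inner v w = 0"
      using U_signs assms(2) by (intro sign_orthogonal[OF klein_alternating(1)]) auto
  next
    fix v w assume vw: "v \<in> W \<union> \<rho> t ` W" "w \<in> \<rho> t ` \<rho> t ` W"
    show "inner v w = 0"
    proof (cases "v \<in> W")
      case True
      then show ?thesis
        using U_signs assms(2) vw by (intro sign_orthogonal[OF klein_alternating(1)]) auto
    next
      case False
      then show ?thesis
        using U_signs assms(2) vw by (intro sign_orthogonal[OF klein_alternating(2)]) auto
    qed
  qed
  moreover have "m + m + m = 3 * m" by simp
  ultimately show ?thesis by metis
qed

lemma triple_subset: "W \<subseteq> U \<Longrightarrow> W \<union> \<rho> t ` W \<union> \<rho> t ` \<rho> t ` W \<subseteq> V"
  using invariant klein_alternating by (auto simp: U_def)

abbreviation Q where "Q \<equiv> P - {a, b, c, d}"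

text \<open>Permutations of disjoint sets of letters commute; hence \<open>alternating Q\<close>
  acts on the eigenspace \<open>U\<close>, to which the induction is applied.\<close>

lemma klein_commute:
  assumes "\<pi> \<in> alternating Q"
  shows "\<rho> \<pi> (\<rho> e1 v) = \<rho> e1 (\<rho> \<pi> v)" "\<rho> \<pi> (\<rho> e2 v) = \<rho> e2 (\<rho> \<pi> v)" "\<rho> \<pi> (\<rho> t v) = \<rho> t (\<rho> \<pi> v)"
proof -
  have \<pi>: "\<pi> \<in> alternating P" using assms alternating_mono[of Q P] by blast
  have fxd: "\<pi> a = a" "\<pi> b = b" "\<pi> c = c" "\<pi> d = d"
    using assms by (auto simp: alternating_def permutes_def)
  have inj: "\<pi> x = \<pi> y \<longleftrightarrow> x = y" for x y
    using alternating_permutes[OF \<pi>] by (metis permutes_inj injD)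
  have iff: "\<pi> x = a \<longleftrightarrow> x = a" "\<pi> x = b \<longleftrightarrow> x = b" "\<pi> x = c \<longleftrightarrow> x = c" "\<pi> x = d \<longleftrightarrow> x = d" for x
    using inj fxd by metis+
  have "\<pi> \<circ> e1 = e1 \<circ> \<pi>" "\<pi> \<circ> e2 = e2 \<circ> \<pi>" "\<pi> \<circ> t = t \<circ> \<pi>"
    using abcd
    by (auto simp: e1_def e2_def t_def cyc3_apply fun_eq_iff Transposition.transpose_def fxd iff)
  then show "\<rho> \<pi> (\<rho> e1 v) = \<rho> e1 (\<rho> \<pi> v)" "\<rho> \<pi> (\<rho> e2 v) = \<rho> e2 (\<rho> \<pi> v)" "\<rho> \<pi> (\<rho> t v) = \<rho> t (\<rho> \<pi> v)"
    using \<pi> klein_alternating by (simp_all add: rho_comp_apply)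
qed

lemma U_invariant:
  assumes "\<pi> \<in> alternating Q" "v \<in> U"
  shows "\<rho> \<pi> v \<in> U"
proof -
  have \<pi>: "\<pi> \<in> alternating P" using assms alternating_mono[of Q P] by blast
  show ?thesis
    using assms klein_commute[OF assms(1), of v] invariant[OF \<pi>] linear_neg[OF linear_rho[OF \<pi>]]
    by (simp add: U_def)
qed

text \<open>\<open>w\<close> and its images under \<open>\<rho> t\<close> and its square are fixed
  by \<open>alternating Q\<close> and account for 3. Vectors so fixed are orthogonal to the
  differences of any translates that \<open>alternating Q\<close> permutes transitively, and such
  differences supply \<open>card Q - 1\<close> more, where
  \<open>card Q = card P - 4\<close>.\<close>

lemma has_orthogonal_thin:
  assumes w: "w \<in> U" "w \<noteq> 0" and Q3: "card Q \<ge> 3"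
    and thin: "\<And>\<pi> v. \<pi> \<in> alternating Q \<Longrightarrow> v \<in> U \<Longrightarrow> \<rho> \<pi> v = v"
  shows "has_orthogonal (card P - 2) V"
proof -
  have finQ: "finite Q" using fin by simp
  define X where "X = {v \<in> V. \<forall>\<pi>\<in>alternating Q. \<rho> \<pi> v = v}"
  have "has_orthogonal (3 * 1) ({w} \<union> \<rho> t ` {w} \<union> \<rho> t ` \<rho> t ` {w})"
    using w by (intro has_orthogonal_triple has_orthogonal_singleton) auto
  moreover have "{w} \<union> \<rho> t ` {w} \<union> \<rho> t ` \<rho> t ` {w} \<subseteq> X"
    using triple_subset[of "{w}"] w thin klein_commute(3) by (auto simp: X_def)
  ultimately have X3: "has_orthogonal 3 X" by (metis has_orthogonal_mono mult.right_neutral order_refl)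
  have w': "w \<in> V" "\<rho> e2 w = - w" using w by (auto simp: U_def)
  \<comment> \<open>Otherwise all 3-cycles on one of the four letters and \<open>q\<close>,
    \<open>q'\<close> would fix \<open>w\<close>. Their commutators are double transpositions whose
    second factor swaps \<open>q\<close> and \<open>q'\<close>, and two of these multiply to
    \<open>e2\<close>, which negates \<open>w\<close>.\<close>
  have "\<exists>p\<in>{a, b, c, d}. \<exists>g\<in>alternating (insert p Q). \<rho> g w \<noteq> w"
  proof (rule ccontr)
    assume "\<not> ?thesis"
    then have fxd: "\<rho> g w = w" if "p \<in> {a, b, c, d}" "g \<in> alternating (insert p Q)" for p g
      using that by blast
    obtain q q' where q: "q \<in> Q" "q' \<in> Q" "q \<noteq> q'"
      using obtain_two[of Q] Q3 by auto
    define C where "C = {\<pi> \<in> alternating P. \<rho> \<pi> w = w}"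
    have comp: "f \<circ> g \<in> C" if "f \<in> C" "g \<in> C" for f g
      using that fin by (simp add: C_def alternating_comp rho_comp)
    have cyc: "cyc3 p x y \<in> C" if "p \<in> {a, b, c, d}" "x \<in> {q, q'}" "y \<in> {q, q'}" "x \<noteq> y" for p x y
    proof -
      have "cyc3 p x y \<in> alternating (insert p Q)"
        using that q by (intro cyc3_alternating) auto
      moreover have "insert p Q \<subseteq> P" using that abcd by auto
      ultimately show ?thesis
        using fxd[OF that(1)] alternating_mono[of "insert p Q" P] unfolding C_def by blast
    qed
    have dbl: "transposition x y \<circ> transposition q q' \<in> C" if "x \<in> {a, b, c, d}" "y \<in> {a, b, c, d}" "x \<noteq> y" for x y
    proof -
      have "transposition x y \<circ> transposition q q' = (cyc3 x q q' \<circ> cyc3 y q q') \<circ> (cyc3 x q' q \<circ> cyc3 y q' q)"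
        using that q by (intro double_transposition_as_cyc3) auto
      then show ?thesis using that q by (auto intro!: comp cyc)
    qed
    have "(transposition a c \<circ> transposition q q') \<circ> (transposition b d \<circ> transposition q q') \<in> C"
      using abcd by (intro comp dbl) auto
    moreover have "(transposition a c \<circ> transposition q q') \<circ> (transposition b d \<circ> transposition q q') = e2"
    proof -
      have "transposition q q' \<circ> transposition b d = transposition b d \<circ> transposition q q'"
        using abcd q by (auto simp: fun_eq_iff Transposition.transpose_def)
      then have "transposition a c \<circ> (transposition q q' \<circ> transposition b d) \<circ> transposition q q' = e2"
        by (simp add: e2_def comp_assoc)
      then show ?thesis by (simp add: comp_assoc)
    qed
    ultimately have "\<rho> e2 w = w" by (simp add: C_def)
    then have "inner w w = inner (- w) w" using w' by simp
    then show False using w by simp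
  qed
  then obtain p g where p: "p \<in> {a, b, c, d}" and g: "g \<in> alternating (insert p Q)" "\<rho> g w \<noteq> w" by blast
  define P' where "P' = insert p Q"
  have P': "P' \<subseteq> P" "finite P'" using p abcd fin by (auto simp: P'_def)
  have pQ: "p \<notin> Q" using p by blast
  have card4: "card P' \<ge> 4" using Q3 pQ finQ by (simp add: P'_def)
  have altP: "\<pi> \<in> alternating P" if "\<pi> \<in> alternating P'" for \<pi>
    using that alternating_mono[OF P'(1)] by blast
  have altQ: "\<pi> \<in> alternating P'" if "\<pi> \<in> alternating Q" for \<pi>
    using that alternating_mono[of Q P'] by (auto simp: P'_def)
  \<comment> \<open>The translate of \<open>w\<close> by any element sending \<open>p\<close> to
    \<open>j\<close>. The choice does not matter: two such elements differ by one fixing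
    \<open>p\<close>, which belongs to \<open>alternating Q\<close> and so fixes
    \<open>w\<close>.\<close>
  define s where "s j = \<rho> (SOME g. g \<in> alternating P' \<and> g p = j) w" for j
  have s_eq: "\<rho> h w = s (h p)" if h: "h \<in> alternating P'" for h
  proof -
    define h' where "h' = (SOME g. g \<in> alternating P' \<and> g p = h p)"
    have h': "h' \<in> alternating P'" "h' p = h p"
      using someI[of "\<lambda>g. g \<in> alternating P' \<and> g p = h p" h] h by (auto simp: h'_def)
    define i where "i = inv_into UNIV h'"
    have i: "i \<in> alternating P'" using h' alternating_inv P' by (auto simp: i_def)
    have ih: "i \<circ> h \<in> alternating P'" using i h P' alternating_comp by blast
    have bij: "bij h'" using h' alternating_permutes permutes_bij by blast
    have "(i \<circ> h) p = p" using bij h' by (metis bij_inv_eq_iff comp_apply i_def)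
    then have "i \<circ> h permutes Q"
      using alternating_permutes[OF ih] pQ unfolding P'_def permutes_def by (metis insertE)
    then have "i \<circ> h \<in> alternating Q" using ih by (simp add: alternating_def)
    then have "\<rho> (i \<circ> h) w = w" using thin w by blast
    then have "\<rho> h' (\<rho> (i \<circ> h) w) = \<rho> h' w" by simp
    moreover have "h' \<circ> (i \<circ> h) = h"
      using bij by (simp add: i_def fun_eq_iff bij_is_surj surj_f_inv_f)
    ultimately have "\<rho> h w = \<rho> h' w"
      using h' ih altP by (simp add: rho_comp_apply)
    then show ?thesis by (simp add: s_def h'_def)
  qed
  have s_move: "\<rho> h (s j) = s (h j)" if "h \<in> alternating P'" "j \<in> P'" for h j
  proof -
    obtain h' where h': "h' \<in> alternating P'" "h' p = j"
    proof (cases "j = p")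
      case True
      then show ?thesis using that[of id] by simp
    next
      case False
      show ?thesis
      proof (rule alternating_2_transitive[OF P'(2) card4, of p j j p])
        show "p \<in> P'" "p \<in> P'" by (auto simp: P'_def)
      qed (use False \<open>j \<in> P'\<close> that in auto)
    qed
    have "\<rho> h (s j) = \<rho> h (\<rho> h' w)" using s_eq[OF h'(1)] h' by simp
    also have "\<dots> = \<rho> (h \<circ> h') w" using that h' altP by (simp add: rho_comp_apply)
    also have "\<dots> = s (h j)" using s_eq[of "h \<circ> h'"] that h' P' alternating_comp by auto
    finally show ?thesis .
  qed
  have sp: "s p = w" using s_eq[of id] rho_id by simp
  have gP': "g \<in> alternating P'" using g by (simp add: P'_def)
  define x where "x = g p"
  have xp: "s x \<noteq> s p" using s_eq[OF gP'] sp g by (simp add: x_def)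
  then have "x \<noteq> p" by blast
  have "p \<in> P'" by (simp add: P'_def)
  then have xP: "x \<in> P'"
    using permutes_in_image[OF alternating_permutes[OF gP'], of p] by (simp only: x_def)
  \<comment> \<open>By 2-transitivity every off-diagonal Gram entry equals the one at
    \<open>p\<close> and \<open>x\<close>, where \<open>x\<close> was chosen with \<open>s x\<close>
    different from \<open>s p\<close>.\<close>
  have gram: "inner (s i) (s j) = inner (s p) (s x)" if "i \<in> P'" "j \<in> P'" "i \<noteq> j" for i j
  proof (rule alternating_2_transitive[OF P'(2) card4, of p x i j])
    fix h assume h: "h \<in> alternating P'" "h p = i" "h x = j"
    then have "inner (s i) (s j) = inner (\<rho> h (s p)) (\<rho> h (s x))"
      using s_move[OF h(1)] xP by (simp add: P'_def)
    then show ?thesis using inner_rho[OF altP[OF h(1)]] by simp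
  qed (use that \<open>x \<noteq> p\<close> xP in \<open>auto simp: P'_def\<close>)
  have diag: "inner (s i) (s i) = inner w w" if "i \<in> P'" for i
  proof (cases "i = p")
    case True
    then show ?thesis using sp by simp
  next
    case False
    show ?thesis
    proof (rule alternating_2_transitive[OF P'(2) card4, of p i i p])
      fix h assume h: "h \<in> alternating P'" "h p = i" "h i = p"
      then have "s i = \<rho> h w" using s_eq by simp
      then show ?thesis using inner_rho[OF altP[OF h(1)]] by simp
    qed (use that False in \<open>auto simp: P'_def\<close>)
  qed
  have cd: "inner (s p) (s x) \<noteq> inner w w"
  proof
    assume "inner (s p) (s x) = inner w w"
    then have "inner (s p - s x) (s p - s x) = 0"
      using diag[OF xP] sp by (simp add: inner_diff inner_commute)
    then show False using xp by simp
  qed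
  \<comment> \<open>The vertex \<open>s p\<close> of the simplex is left out:
    \<open>alternating Q\<close> is transitive only on the vertices indexed by \<open>Q\<close>, and
    this is what makes their differences orthogonal to \<open>X\<close>.\<close>
  let ?D = "{s i - s j |i j. i \<in> Q \<and> j \<in> Q}"
  have "Q \<noteq> {}" using Q3 by (metis card.empty not_numeral_le_zero)
  then have D: "has_orthogonal (card Q - 1) (span ?D)"
    by (rule has_orthogonal_simplex[OF finQ _ cd]) (use gram diag in \<open>auto simp: P'_def\<close>)
  have XD: "inner v u = 0" if "v \<in> X" "u \<in> span ?D" for v u
  proof -
    have eq: "inner v (s i) = inner v (s j)" if ij: "i \<in> Q" "j \<in> Q" for i j
    proof (cases "i = j")
      case False
      have "card (Q - {i, j}) \<ge> 1"
        using Q3 card_Diff_subset[of "{i, j}" Q] ij False by simp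
      then obtain l where l: "l \<in> Q - {i, j}" by (metis card.empty ex_in_conv not_one_le_zero)
      \<comment> \<open>This 3-cycle moves \<open>s i\<close> to \<open>s j\<close> and fixes
        \<open>v\<close>, so \<open>v\<close> has the same inner product with both. The third letter
        \<open>l\<close> is where \<open>card Q \<ge> 3\<close> enters.\<close>
      have c: "cyc3 i j l \<in> alternating Q" using ij l False by (intro cyc3_alternating) auto
      have "inner v (s i) = inner (\<rho> (cyc3 i j l) v) (\<rho> (cyc3 i j l) (s i))"
        using inner_rho[OF altP[OF altQ[OF c]]] by simp
      also have "\<rho> (cyc3 i j l) v = v" using \<open>v \<in> X\<close> c by (simp add: X_def)
      also have "\<rho> (cyc3 i j l) (s i) = s j"
        using s_move[OF altQ[OF c], of i] ij l False by (auto simp: P'_def cyc3_apply)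
      finally show ?thesis .
    qed simp
    have "orthogonal v u"
    proof (rule orthogonal_to_span[OF \<open>u \<in> span ?D\<close>])
      fix y assume "y \<in> ?D"
      then obtain i j where y: "y = s i - s j" and ij: "i \<in> Q" "j \<in> Q" by blast
      show "orthogonal v y" using eq[OF ij] by (simp add: y orthogonal_def inner_diff)
    qed
    then show ?thesis by (simp add: orthogonal_def)
  qed
  have sV: "s i \<in> V" if "i \<in> P'" for i
  proof -
    obtain h where "h \<in> alternating P'" "h p = i"
    proof (cases "i = p")
      case True
      then show ?thesis using that[of id] by simp
    next
      case False
      show ?thesis
        by (rule alternating_2_transitive[OF P'(2) card4, of p i i p])
          (use False \<open>i \<in> P'\<close> that in \<open>auto simp: P'_def\<close>)
    qed
    then show ?thesis using s_eq invariant altP w' by metis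
  qed
  have "has_orthogonal (3 + (card Q - 1)) (X \<union> span ?D)"
    by (intro has_orthogonal_Un X3 D XD)
  moreover have "span ?D \<subseteq> V"
    by (rule span_minimal) (use sV subsp in \<open>auto simp: P'_def intro!: subspace_diff\<close>)
  then have "X \<union> span ?D \<subseteq> V" by (auto simp: X_def)
  moreover have "card P - 2 \<le> 3 + (card Q - 1)"
    using Q3 card_Diff_subset[of "{a, b, c, d}" P] abcd by simp
  ultimately show ?thesis using has_orthogonal_mono by blast
qed

end

section \<open>The dimension bound by induction on the number of letters\<close>

context alternating_action
begin

lemma has_orthogonal_3:
  assumes nontrivial "card P \<ge> 5"
  shows "has_orthogonal 3 V"
proof (rule obtain_klein_vector[OF assms])
  fix a b c d w
  assume abcd: "{a, b, c, d} \<subseteq> P" "distinct [a, b, c, d]" and w: "w \<in> V" "w \<noteq> 0"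
    "\<rho> (transposition a b \<circ> transposition c d) w = w" "\<rho> (transposition a c \<circ> transposition b d) w = - w"
  interpret klein_action P \<rho> V a b c d using abcd by unfold_locales auto
  have "w \<in> U" using w by (simp add: U_def e1_def e2_def)
  then have "has_orthogonal (3 * 1) ({w} \<union> \<rho> t ` {w} \<union> \<rho> t ` \<rho> t ` {w})"
    using w by (intro has_orthogonal_triple has_orthogonal_singleton) auto
  then show ?thesis
    by (rule has_orthogonal_mono) (use triple_subset[of "{w}"] \<open>w \<in> U\<close> in auto)
qed

end

text \<open>With n letters, a bound for the n - 4 letters of \<open>Q\<close> on \<open>U\<close> is
  tripled by the three eigenspaces: 3(n - 6) >= n - 2 when n - 4 >= 7, the bound 3 suffices for n -
  4 = 5 or 6, and the bound 2 for n - 4 = 3 or 4. Thus the weaker lemmas for few letters start the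
  induction.\<close>

theorem alternating_action_has_orthogonal:
  assumes "alternating_action P \<rho> V" "alternating_action.nontrivial P \<rho> V" "card P \<ge> 7"
  shows "has_orthogonal (card P - 2) V"
  using assms
proof (induction "card P" arbitrary: P V rule: less_induct)
  case less
  interpret alternating_action P \<rho> V by fact
  have "card P \<ge> 5" using less by simp
  then show ?case
  proof (rule obtain_klein_vector[OF less.prems(2)])
    fix a b c d w
    assume abcd: "{a, b, c, d} \<subseteq> P" "distinct [a, b, c, d]" and w: "w \<in> V" "w \<noteq> 0"
      "\<rho> (transposition a b \<circ> transposition c d) w = w" "\<rho> (transposition a c \<circ> transposition b d) w = - w"
    interpret klein_action P \<rho> V a b c d using abcd by unfold_locales auto
    have wU: "w \<in> U" using w by (simp add: U_def e1_def e2_def)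
    have cardQ: "card Q = card P - 4" using card_Diff_subset[of "{a, b, c, d}" P] abcd by simp
    interpret R: alternating_action Q \<rho> U
      using U_invariant subspace_U by (intro restrict) auto
    show ?case
    proof (cases R.nontrivial)
      case False
      then show ?thesis
        using wU w cardQ less.prems(3) by (intro has_orthogonal_thin[of w]) (auto simp: R.nontrivial_def)
    next
      case True
      have "\<exists>m. has_orthogonal m U \<and> card P - 2 \<le> 3 * m"
      proof -
        consider "card Q \<ge> 7" | "card Q \<ge> 5" "card Q < 7" | "card Q < 5" by linarith
        then show ?thesis
        proof cases
          case 1
          have "has_orthogonal (card Q - 2) U"
            using less.hyps[of Q U] 1 True R.alternating_action_axioms cardQ by simp
          then show ?thesis using 1 cardQ by (intro exI[of _ "card Q - 2"]) auto
        next
          case 2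
          then show ?thesis using R.has_orthogonal_3[OF True] cardQ by (intro exI[of _ 3]) auto
        next
          case 3
          then show ?thesis using R.has_orthogonal_2[OF True] cardQ by (intro exI[of _ 2]) auto
        qed
      qed
      then obtain m where m: "has_orthogonal m U" "card P - 2 \<le> 3 * m" by blast
      show ?thesis
        using has_orthogonal_triple[OF m(1) order_refl] m(2) triple_subset[of U]
        by (meson has_orthogonal_mono order_refl)
    qed
  qed
qed

section \<open>Finitely supported functions\<close>

text \<open>The regular representation has to live on a type of class \<open>real_inner\<close>,
  while a finite group may sit inside an infinite type. Finite support turns the inner product into
  a finite sum.\<close>

typedef 'a finsupp = "{f :: 'a \<Rightarrow> real. finite {x. f x \<noteq> 0}}"
  morphisms coef Abs_finsupp
  by (rule exI[of _ "\<lambda>_. 0"]) simp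

setup_lifting type_definition_finsupp

abbreviation supp :: "'a finsupp \<Rightarrow> 'a set" where
  "supp f \<equiv> {x. coef f x \<noteq> 0}"

lemma finite_supp: "finite (supp f)"
  using coef[of f] by simp

instantiation finsupp :: (type) real_vector
begin

lift_definition zero_finsupp :: "'a finsupp" is "\<lambda>_. 0" by simp

lift_definition plus_finsupp :: "'a finsupp \<Rightarrow> 'a finsupp \<Rightarrow> 'a finsupp" is "\<lambda>f g x. f x + g x"
  subgoal for f g by (rule finite_subset[of _ "{x. f x \<noteq> 0} \<union> {x. g x \<noteq> 0}"]) auto
  done

lift_definition minus_finsupp :: "'a finsupp \<Rightarrow> 'a finsupp \<Rightarrow> 'a finsupp" is "\<lambda>f g x. f x - g x"
  subgoal for f g by (rule finite_subset[of _ "{x. f x \<noteq> 0} \<union> {x. g x \<noteq> 0}"]) auto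
  done

lift_definition uminus_finsupp :: "'a finsupp \<Rightarrow> 'a finsupp" is "\<lambda>f x. - f x" by simp

lift_definition scaleR_finsupp :: "real \<Rightarrow> 'a finsupp \<Rightarrow> 'a finsupp" is "\<lambda>c f x. c * f x"
  by (rule finite_subset[rotated]) auto

instance
proof
  fix f g h :: "'a finsupp" and c e :: real
  show "f + g + h = f + (g + h)" "f + g = g + f" "0 + f = f" "- f + f = 0" "f - g = f + - g"
    "c *\<^sub>R (f + g) = c *\<^sub>R f + c *\<^sub>R g" "(c + e) *\<^sub>R f = c *\<^sub>R f + e *\<^sub>R f"
    "c *\<^sub>R e *\<^sub>R f = (c * e) *\<^sub>R f" "1 *\<^sub>R f = f"
    by (transfer; auto simp: algebra_simps)+
qed

end

instantiation finsupp :: (type) real_inner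
begin

definition inner_finsupp :: "'a finsupp \<Rightarrow> 'a finsupp \<Rightarrow> real" where
  "inner_finsupp f g = (\<Sum>x\<in>supp f. coef f x * coef g x)"

definition norm_finsupp :: "'a finsupp \<Rightarrow> real" where
  "norm_finsupp f = sqrt (inner f f)"

definition dist_finsupp :: "'a finsupp \<Rightarrow> 'a finsupp \<Rightarrow> real" where
  "dist_finsupp f g = norm (f - g)"

definition sgn_finsupp :: "'a finsupp \<Rightarrow> 'a finsupp" where
  "sgn_finsupp f = f /\<^sub>R norm f"

definition uniformity_finsupp :: "('a finsupp \<times> 'a finsupp) filter" where
  "uniformity_finsupp = (INF e\<in>{0<..}. principal {(x, y). dist x y < e})"

definition open_finsupp :: "'a finsupp set \<Rightarrow> bool" where
  "open_finsupp U \<longleftrightarrow> (\<forall>x\<in>U. \<forall>\<^sub>F (x', y) in uniformity. x' = x \<longrightarrow> y \<in> U)"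

lemma inner_finsupp_superset:
  assumes "finite S" "supp f \<subseteq> S"
  shows "inner f g = (\<Sum>x\<in>S. coef f x * coef g x)"
  unfolding inner_finsupp_def using assms by (intro sum.mono_neutral_left) auto

instance
proof
  fix f g h :: "'a finsupp" and c :: real
  show "dist f g = norm (f - g)" by (rule dist_finsupp_def)
  show "sgn f = f /\<^sub>R norm f" by (rule sgn_finsupp_def)
  show "uniformity = (INF e\<in>{0<..}. principal {(x, y :: 'a finsupp). dist x y < e})"
    by (rule uniformity_finsupp_def)
  show "open U = (\<forall>x\<in>U. \<forall>\<^sub>F (x', y) in uniformity. x' = x \<longrightarrow> y \<in> U)" for U :: "'a finsupp set"
    by (rule open_finsupp_def)
  show "norm f = sqrt (inner f f)" by (rule norm_finsupp_def)
  have fin: "finite (supp f \<union> supp g \<union> supp h)" by (simp add: finite_supp)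
  have sub: "supp (f + g) \<subseteq> supp f \<union> supp g \<union> supp h" "supp (c *\<^sub>R f) \<subseteq> supp f \<union> supp g \<union> supp h"
    by (auto simp: plus_finsupp.rep_eq scaleR_finsupp.rep_eq)
  have sub': "supp x \<subseteq> supp f \<union> supp g \<union> supp h" if "x \<in> {f, g, h}" for x using that by auto
  show "inner f g = inner g f"
    using inner_finsupp_superset[OF fin sub'] by (simp add: mult.commute)
  show "inner (f + g) h = inner f h + inner g h"
    using inner_finsupp_superset[OF fin sub'] inner_finsupp_superset[OF fin sub(1)]
    by (simp add: plus_finsupp.rep_eq algebra_simps sum.distrib)
  show "inner (c *\<^sub>R f) g = c * inner f g"
    using inner_finsupp_superset[OF fin sub'] inner_finsupp_superset[OF fin sub(2)]
    by (simp add: scaleR_finsupp.rep_eq sum_distrib_left mult.assoc)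
  show "0 \<le> inner f f"
    unfolding inner_finsupp_def by (intro sum_nonneg) simp
  show "inner f f = 0 \<longleftrightarrow> f = 0"
  proof
    assume "inner f f = 0"
    then have "\<forall>x\<in>supp f. coef f x * coef f x = 0"
      unfolding inner_finsupp_def by (subst (asm) sum_nonneg_eq_0_iff) (auto simp: finite_supp)
    then have "coef f x = 0" for x by auto
    then show "f = 0" by (simp add: coef_inject[symmetric] zero_finsupp.rep_eq fun_eq_iff)
  qed (simp add: inner_finsupp_def zero_finsupp.rep_eq)
qed

end

lemmas coef_simps = zero_finsupp.rep_eq plus_finsupp.rep_eq minus_finsupp.rep_eq
  uminus_finsupp.rep_eq scaleR_finsupp.rep_eq

lemma finsupp_eqI: "(\<And>x. coef f x = coef g x) \<Longrightarrow> f = g"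
  by (simp add: coef_inject[symmetric] fun_eq_iff)

lift_definition restrict_finsupp :: "'a set \<Rightarrow> ('a \<Rightarrow> real) \<Rightarrow> 'a finsupp"
  is "\<lambda>S f x. if finite S \<and> x \<in> S then f x else 0"
  by (auto intro: finite_subset rev_finite_subset)

text \<open>Composition with a map that is not injective can destroy finite support; the default
  value \<open>f\<close> avoids this.\<close>

lift_definition precomp :: "('a \<Rightarrow> 'a) \<Rightarrow> 'a finsupp \<Rightarrow> 'a finsupp"
  is "\<lambda>\<phi> f. if bij \<phi> then f \<circ> \<phi> else f"
proof -
  fix \<phi> :: "'a \<Rightarrow> 'a" and f :: "'a \<Rightarrow> real"
  assume f: "finite {x. f x \<noteq> 0}"
  have "finite {x. f (\<phi> x) \<noteq> 0}" if "bij \<phi>"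
    using finite_vimageI[OF f bij_is_inj[OF that]] by (simp add: vimage_def)
  then show "finite {x. (if bij \<phi> then f \<circ> \<phi> else f) x \<noteq> 0}" using f by auto
qed

lemma orthogonal_transformation_precomp:
  assumes "bij \<phi>"
  shows "orthogonal_transformation (precomp \<phi>)"
  unfolding orthogonal_transformation_def
proof (intro conjI allI)
  show "linear (precomp \<phi>)"
    by (rule linearI; rule finsupp_eqI) (simp_all add: coef_simps precomp.rep_eq assms)
  fix f g
  have "inner (precomp \<phi> f) (precomp \<phi> g) = (\<Sum>x | coef f (\<phi> x) \<noteq> 0. coef f (\<phi> x) * coef g (\<phi> x))"
    by (simp add: inner_finsupp_def precomp.rep_eq assms)
  also have "\<dots> = inner f g"
    unfolding inner_finsupp_def
    by (rule sum.reindex_bij_witness[of _ "inv_into UNIV \<phi>" \<phi>])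
      (use assms in \<open>auto simp: bij_is_surj surj_f_inv_f bij_is_inj\<close>)
  finally show "inner (precomp \<phi> f) (precomp \<phi> g) = inner f g" .
qed

section \<open>Quasirandomness\<close>

lemma bessel_inequality:
  fixes x :: "'a::real_inner"
  assumes "finite B" "pairwise orthogonal B" "0 \<notin> B"
  shows "(\<Sum>e\<in>B. (inner x e)\<^sup>2 / inner e e) \<le> inner x x"
proof -
  define p where "p = (\<Sum>e\<in>B. (inner x e / inner e e) *\<^sub>R e)"
  have xp: "inner x p = (\<Sum>e\<in>B. (inner x e)\<^sup>2 / inner e e)"
    by (simp add: p_def inner_sum_right power2_eq_square)
  have pe: "inner p e = inner x e" if "e \<in> B" for e
  proof -
    have "inner p e = (\<Sum>e'\<in>B. if e' = e then inner x e else 0)"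
      unfolding p_def inner_sum_left
    proof (intro sum.cong refl)
      fix e' assume "e' \<in> B"
      then show "inner ((inner x e' / inner e' e') *\<^sub>R e') e = (if e' = e then inner x e else 0)"
        using assms that by (auto simp: pairwise_def orthogonal_def)
    qed
    then show ?thesis using assms that by simp
  qed
  have "inner p p = (\<Sum>e\<in>B. (inner x e / inner e e) * inner p e)"
    by (subst (2) p_def) (simp add: inner_sum_right)
  also have "\<dots> = inner x p"
    unfolding xp by (intro sum.cong) (auto simp: pe power2_eq_square)
  finally have "inner (x - p) (x - p) = inner x x - inner x p"
    by (simp add: inner_diff inner_commute)
  then show ?thesis using xp inner_ge_zero[of "x - p"] by linarith
qed

text \<open>Takes the place of the spectral theorem: the top eigenvector of a form appears as a
  maximiser on the unit sphere of mean-zero functions. That sphere is compact, being closed in a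
  product of intervals [-1, 1] over \<open>C\<close> and points 0 elsewhere.\<close>

lemma quadratic_form_attains_max:
  fixes a :: "'a \<Rightarrow> 'a \<Rightarrow> real"
  assumes "finite C"
  defines "S \<equiv> {h. (\<forall>x. x \<notin> C \<longrightarrow> h x = 0) \<and> (\<Sum>x\<in>C. h x) = 0 \<and> (\<Sum>x\<in>C. (h x)\<^sup>2) = 1}"
  assumes "S \<noteq> {}"
  shows "\<exists>h\<in>S. \<forall>h'\<in>S. (\<Sum>x\<in>C. (\<Sum>z\<in>C. a x z * h' z)\<^sup>2) \<le> (\<Sum>x\<in>C. (\<Sum>z\<in>C. a x z * h z)\<^sup>2)"
proof -
  define K :: "('a \<Rightarrow> real) set" where "K = PiE UNIV (\<lambda>x. if x \<in> C then {-1..1} else {0})"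
  have "compactin (product_topology (\<lambda>_. euclidean) UNIV) K"
    unfolding K_def by (subst compactin_PiE) auto
  then have "compact K" by (simp add: euclidean_product_topology)
  define R where "R = {h :: 'a \<Rightarrow> real. (\<Sum>x\<in>C. h x) = 0} \<inter> {h. (\<Sum>x\<in>C. (h x)\<^sup>2) = 1}"
  have "closed R"
    unfolding R_def by (intro closed_Int closed_Collect_eq continuous_intros) auto
  have "S = K \<inter> R"
  proof (intro equalityI subsetI)
    fix h assume h: "h \<in> S"
    have "\<bar>h x\<bar> \<le> 1" if "x \<in> C" for x
    proof -
      have "(h x)\<^sup>2 \<le> (\<Sum>x\<in>C. (h x)\<^sup>2)"
        using that assms(1) by (intro member_le_sum) auto
      then show ?thesis using h by (simp add: S_def abs_square_le_1)
    qed
    then have "h x \<in> (if x \<in> C then {-1..1} else {0})" for x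
      using h by (auto simp: S_def abs_le_iff)
    then show "h \<in> K \<inter> R" using h by (auto simp: K_def R_def S_def)
  next
    fix h assume h: "h \<in> K \<inter> R"
    then have "h x \<in> (if x \<in> C then {-1..1} else {0})" for x
      by (auto simp: K_def PiE_iff)
    then have "h x = 0" if "x \<notin> C" for x using that by (metis singletonD)
    then show "h \<in> S" using h by (auto simp: S_def R_def)
  qed
  then have "compact S" using \<open>compact K\<close> \<open>closed R\<close> compact_Int_closed by blast
  moreover have "continuous_on S (\<lambda>h. \<Sum>x\<in>C. (\<Sum>z\<in>C. a x z * h z)\<^sup>2)"
    by (intro continuous_intros continuous_on_subset[OF continuous_on_product_coordinates]) auto
  ultimately show ?thesis
    using continuous_attains_sup[OF _ \<open>S \<noteq> {}\<close>] by blast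
qed

section \<open>The regular representation and Gowers' count of products\<close>

definition right_translate :: "('g, 'b) monoid_scheme \<Rightarrow> 'g \<Rightarrow> 'g finsupp \<Rightarrow> 'g finsupp" where
  "right_translate G g = precomp (\<lambda>x. if x \<in> carrier G then x \<otimes>\<^bsub>G\<^esub> g else x)"

context group
begin

text \<open>Being the identity off the carrier makes the translation a bijection of the whole type,
  as \<open>precomp\<close> demands.\<close>

lemma bij_right_mult:
  assumes "g \<in> carrier G"
  shows "bij (\<lambda>x. if x \<in> carrier G then x \<otimes> g else x)"
proof (rule bij_betw_byWitness[where f' = "\<lambda>x. if x \<in> carrier G then x \<otimes> inv g else x"])
qed (use assms in \<open>auto simp: m_assoc\<close>)

lemma coef_right_translate:
  assumes "g \<in> carrier G"
  shows "coef (right_translate G g f) x = coef f (if x \<in> carrier G then x \<otimes> g else x)"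
  unfolding right_translate_def precomp.rep_eq by (simp add: bij_right_mult[OF assms])

lemma orthogonal_right_translate:
  "g \<in> carrier G \<Longrightarrow> orthogonal_transformation (right_translate G g)"
  unfolding right_translate_def by (intro orthogonal_transformation_precomp bij_right_mult)

lemma right_translate_mult:
  assumes "g \<in> carrier G" "h \<in> carrier G"
  shows "right_translate G (g \<otimes> h) f = right_translate G g (right_translate G h f)"
  by (rule finsupp_eqI) (use assms in \<open>simp add: coef_right_translate m_assoc\<close>)

lemma right_translate_one: "right_translate G \<one> f = f"
  by (rule finsupp_eqI) (simp add: coef_right_translate)

lemma inv_cancel:
  assumes "x \<in> carrier G" "y \<in> carrier G"
  shows "x \<otimes> (inv x \<otimes> y) = y" "inv x \<otimes> (x \<otimes> y) = y"
  using assms by (simp_all flip: m_assoc)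

text \<open>For a finite group, the orthogonal complement of the constants in the regular
  representation; it has no nonzero invariant vectors.\<close>

definition mean_zero :: "'a finsupp set" where
  "mean_zero = {f. supp f \<subseteq> carrier G \<and> (\<Sum>x\<in>carrier G. coef f x) = 0}"

lemma subspace_mean_zero: "subspace mean_zero"
proof -
  have 1: "supp (f + g) \<subseteq> supp f \<union> supp g" "supp (c *\<^sub>R f) \<subseteq> supp f" for f g :: "'a finsupp" and c
    by (auto simp: coef_simps)
  have "f + g \<in> mean_zero" if "f \<in> mean_zero" "g \<in> mean_zero" for f g
    using that 1(1)[of f g] by (simp add: mean_zero_def coef_simps(2) sum.distrib) blast
  moreover have "c *\<^sub>R f \<in> mean_zero" if "f \<in> mean_zero" for f c
    using that 1(2)[of c f] by (simp add: mean_zero_def coef_simps(5) sum_distrib_left[symmetric]) blast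
  moreover have "0 \<in> mean_zero" by (simp add: mean_zero_def coef_simps(1))
  ultimately show ?thesis by (simp add: subspace_def)
qed

lemma right_translate_mean_zero:
  assumes "g \<in> carrier G" "f \<in> mean_zero"
  shows "right_translate G g f \<in> mean_zero"
proof -
  have "supp (right_translate G g f) \<subseteq> carrier G"
    using assms by (auto simp: mean_zero_def coef_right_translate split: if_splits)
  moreover have "(\<Sum>x\<in>carrier G. coef (right_translate G g f) x) = (\<Sum>x\<in>carrier G. coef f (x \<otimes> g))"
    using assms by (intro sum.cong) (auto simp: coef_right_translate)
  moreover have "\<dots> = (\<Sum>x\<in>carrier G. coef f x)"
    by (rule sum.reindex_bij_witness[of _ "\<lambda>x. x \<otimes> inv g" "\<lambda>x. x \<otimes> g"])
      (use assms in \<open>auto simp: m_assoc\<close>)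
  ultimately show ?thesis using assms by (simp add: mean_zero_def)
qed

text \<open>Only subrepresentations of the regular representation are tested, since the eigenspace
  to which the property is applied is one of them.\<close>

definition quasirandom :: "nat \<Rightarrow> bool" where
  "quasirandom m \<longleftrightarrow> (\<forall>V. subspace V \<and> V \<subseteq> mean_zero \<and> V \<noteq> {0}
     \<and> (\<forall>g\<in>carrier G. \<forall>v\<in>V. right_translate G g v \<in> V) \<longrightarrow> has_orthogonal m V)"

text \<open>The indicator of the set of z with x in Bz. Its inner product with \<open>f\<close> is
  the value at \<open>x\<close> of the convolution of the indicator of \<open>B\<close> with
  \<open>f\<close>. Because \<open>B\<close> multiplies from the left, convolution commutes with
  right translation.\<close>

definition shifted :: "'a set \<Rightarrow> 'a \<Rightarrow> 'a finsupp" where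
  "shifted B x = restrict_finsupp (carrier G) (\<lambda>z. of_bool (x \<otimes> inv z \<in> B))"

context
  fixes B m
  assumes fin: "finite (carrier G)" and B: "B \<subseteq> carrier G"
    and m: "m > 0" and quasi: "quasirandom m"
begin

lemma coef_shifted: "coef (shifted B x) z = of_bool (z \<in> carrier G \<and> x \<otimes> inv z \<in> B)"
  using fin by (simp add: shifted_def restrict_finsupp.rep_eq)

lemma inner_shifted: "inner (shifted B x) f = (\<Sum>z\<in>carrier G. of_bool (x \<otimes> inv z \<in> B) * coef f z)"
proof -
  have "supp (shifted B x) \<subseteq> carrier G" by (auto simp: coef_shifted)
  then show ?thesis by (simp add: inner_finsupp_superset[OF fin] coef_shifted cong: sum.cong)
qed

lemma sum_shifted:
  assumes "x \<in> carrier G"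
  shows "(\<Sum>z\<in>carrier G. of_bool (x \<otimes> inv z \<in> B) :: real) = real (card B)"
proof -
  have "(\<Sum>z\<in>carrier G. of_bool (x \<otimes> inv z \<in> B) :: real) = (\<Sum>y\<in>carrier G. of_bool (y \<in> B))"
    by (rule sum.reindex_bij_witness[of _ "\<lambda>y. inv y \<otimes> x" "\<lambda>z. x \<otimes> inv z"])
      (use assms in \<open>auto simp: m_assoc inv_mult_group inv_cancel\<close>)
  also have "\<dots> = real (card B)" using B fin by (simp add: sum_of_bool_eq Int_absorb1)
  finally show ?thesis .
qed

lemma inner_shifted_self:
  assumes "x \<in> carrier G"
  shows "inner (shifted B x) (shifted B x) = real (card B)"
proof -
  have "inner (shifted B x) (shifted B x) = (\<Sum>z\<in>carrier G. of_bool (x \<otimes> inv z \<in> B) :: real)"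
    unfolding inner_shifted by (intro sum.cong) (auto simp: coef_shifted)
  then show ?thesis using sum_shifted assms by simp
qed

text \<open>The squared norm of that convolution.\<close>

definition energy :: "'a finsupp \<Rightarrow> real" where
  "energy f = (\<Sum>x\<in>carrier G. (inner (shifted B x) f)\<^sup>2)"

lemma energy_right_translate:
  assumes "g \<in> carrier G"
  shows "energy (right_translate G g f) = energy f"
proof -
  have "inner (shifted B x) (right_translate G g f) = inner (shifted B (x \<otimes> g)) f"
    if "x \<in> carrier G" for x
    unfolding inner_shifted
    by (rule sum.reindex_bij_witness[of _ "\<lambda>z. z \<otimes> inv g" "\<lambda>z. z \<otimes> g"])
      (use assms that in \<open>auto simp: coef_right_translate m_assoc inv_mult_group inv_cancel\<close>)
  then have "energy (right_translate G g f) = (\<Sum>x\<in>carrier G. (inner (shifted B (x \<otimes> g)) f)\<^sup>2)"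
    unfolding energy_def by (intro sum.cong) auto
  also have "\<dots> = energy f"
    unfolding energy_def
    by (rule sum.reindex_bij_witness[of _ "\<lambda>z. z \<otimes> inv g" "\<lambda>z. z \<otimes> g"])
      (use assms in \<open>auto simp: m_assoc\<close>)
  finally show ?thesis .
qed

lemma energy_scaleR: "energy (c *\<^sub>R f) = c\<^sup>2 * energy f"
  by (simp add: energy_def power_mult_distrib sum_distrib_left)

lemma energy_parallelogram: "energy (f + g) + energy (f - g) = 2 * energy f + 2 * energy g"
  by (simp add: energy_def inner_add inner_diff power2_eq_square sum.distrib[symmetric]
      sum_distrib_left algebra_simps)

text \<open>The vectors attaining the maximum \<open>l\<close> of the energy on the unit sphere form an invariant
  subspace (by the parallelogram law), so \<open>l\<close> has multiplicity at least \<open>m\<close>, while the trace of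
  the energy form is \<open>card B * order G\<close>.\<close>

lemma energy_le:
  assumes "f \<in> mean_zero"
  shows "real m * energy f \<le> real (card B) * real (card (carrier G)) * inner f f"
proof (cases "f = 0")
  case True
  then show ?thesis by (simp add: energy_def)
next
  case False
  let ?C = "carrier G"
  define S where "S = {h. (\<forall>x. x \<notin> ?C \<longrightarrow> h x = 0) \<and> (\<Sum>x\<in>?C. h x) = 0 \<and> (\<Sum>x\<in>?C. (h x)\<^sup>2) = (1::real)}"
  have coef_S: "coef g \<in> S \<longleftrightarrow> g \<in> mean_zero \<and> inner g g = 1" for g
  proof -
    have "inner g g = (\<Sum>x\<in>?C. (coef g x)\<^sup>2)" if "supp g \<subseteq> ?C"
      using that by (simp add: inner_finsupp_superset[OF fin] power2_eq_square)
    moreover have "supp g \<subseteq> ?C \<longleftrightarrow> (\<forall>x. x \<notin> ?C \<longrightarrow> coef g x = 0)" by auto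
    ultimately show ?thesis unfolding S_def mean_zero_def mem_Collect_eq by metis
  qed
  have energy_coef: "energy g = (\<Sum>x\<in>?C. (\<Sum>z\<in>?C. of_bool (x \<otimes> inv z \<in> B) * coef g z)\<^sup>2)" for g
    by (simp add: energy_def inner_shifted)
  have normalize: "(1 / norm g) *\<^sub>R g \<in> mean_zero \<and> inner ((1 / norm g) *\<^sub>R g) ((1 / norm g) *\<^sub>R g) = 1"
    if "g \<in> mean_zero" "g \<noteq> 0" for g
    using that subspace_mul[OF subspace_mean_zero]
    by (auto simp: divide_simps power2_norm_eq_inner[symmetric] power2_eq_square)
  have "S \<noteq> {}" using normalize[OF assms False] coef_S by blast
  then obtain h where h: "h \<in> S"
    and max: "\<And>h'. h' \<in> S \<Longrightarrow> (\<Sum>x\<in>?C. (\<Sum>z\<in>?C. of_bool (x \<otimes> inv z \<in> B) * h' z)\<^sup>2)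
      \<le> (\<Sum>x\<in>?C. (\<Sum>z\<in>?C. of_bool (x \<otimes> inv z \<in> B) * h z)\<^sup>2)"
    using quadratic_form_attains_max[OF fin, of "\<lambda>x z. of_bool (x \<otimes> inv z \<in> B)"]
    unfolding S_def[symmetric] by blast
  define v0 where "v0 = restrict_finsupp ?C h"
  have v0: "coef v0 = h" using h fin by (auto simp: v0_def restrict_finsupp.rep_eq S_def)
  then have v0S: "v0 \<in> mean_zero" "inner v0 v0 = 1" using h coef_S by auto
  define l where "l = energy v0"
  have bound: "energy g \<le> l * inner g g" if "g \<in> mean_zero" for g
  proof (cases "g = 0")
    case True
    then show ?thesis by (simp add: energy_def)
  next
    case False
    have "energy ((1 / norm g) *\<^sub>R g) \<le> l"
      using normalize[OF that False] coef_S max v0 unfolding l_def energy_coef by auto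
    then show ?thesis
      using False by (simp add: energy_scaleR power_divide divide_simps power2_norm_eq_inner split: if_splits)
  qed
  define V where "V = {g \<in> mean_zero. energy g = l * inner g g}"
  have "subspace V"
    unfolding subspace_def
  proof (intro conjI ballI allI)
    show "0 \<in> V" using subspace_0[OF subspace_mean_zero] by (simp add: V_def energy_def)
    show "c *\<^sub>R x \<in> V" if "x \<in> V" for c x
      using that subspace_mul[OF subspace_mean_zero] by (simp add: V_def energy_scaleR power2_eq_square)
    show "x + y \<in> V" if xy: "x \<in> V" "y \<in> V" for x y
    proof -
      have mz: "x + y \<in> mean_zero" "x - y \<in> mean_zero"
        using xy subspace_add[OF subspace_mean_zero] subspace_diff[OF subspace_mean_zero]
        by (auto simp: V_def)
      have "inner (x + y) (x + y) + inner (x - y) (x - y) = 2 * inner x x + 2 * inner y y"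
        by (simp add: inner_add inner_diff)
      then have "l * (inner (x + y) (x + y) + inner (x - y) (x - y)) = l * (2 * inner x x + 2 * inner y y)"
        by simp
      then have "l * inner (x + y) (x + y) + l * inner (x - y) (x - y) = 2 * (l * inner x x) + 2 * (l * inner y y)"
        by (simp only: distrib_left mult.left_commute)
      then have "energy (x + y) = l * inner (x + y) (x + y)"
        using energy_parallelogram[of x y] bound[OF mz(1)] bound[OF mz(2)] xy
        by (simp add: V_def)
      then show ?thesis using mz by (simp add: V_def)
    qed
  qed
  moreover have "right_translate G g v \<in> V" if "g \<in> ?C" "v \<in> V" for g v
  proof -
    have "inner (right_translate G g v) (right_translate G g v) = inner v v"
      using orthogonal_right_translate[OF that(1)] by (simp add: orthogonal_transformation_def)
    then show ?thesis
      using that right_translate_mean_zero energy_right_translate by (simp add: V_def)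
  qed
  moreover have "v0 \<in> V" using v0S by (simp add: V_def l_def)
  then have "V \<noteq> {0}" using v0S by auto
  moreover have "V \<subseteq> mean_zero" by (auto simp: V_def)
  ultimately have "has_orthogonal m V" using quasi by (simp add: quasirandom_def)
  then obtain E where E: "E \<subseteq> V" "finite E" "card E = m" "pairwise orthogonal E" "0 \<notin> E"
    by (auto simp: has_orthogonal_def)
  have "real m * l = (\<Sum>e\<in>E. energy e / inner e e)"
  proof -
    have "(\<Sum>e\<in>E. energy e / inner e e) = (\<Sum>e\<in>E. l)"
      using E by (intro sum.cong) (auto simp: V_def)
    then show ?thesis using E by simp
  qed
  also have "\<dots> = (\<Sum>x\<in>?C. \<Sum>e\<in>E. (inner (shifted B x) e)\<^sup>2 / inner e e)"
    unfolding energy_def sum_divide_distrib by (rule sum.swap)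
  \<comment> \<open>Bessel's inequality for each vector \<open>shifted B x\<close> bounds the part
    of the trace carried by \<open>E\<close>.\<close>
  also have "\<dots> \<le> (\<Sum>x\<in>?C. inner (shifted B x) (shifted B x))"
    using E by (intro sum_mono bessel_inequality) auto
  also have "\<dots> = (\<Sum>x\<in>?C. real (card B))"
    by (intro sum.cong) (auto simp: inner_shifted_self)
  also have "\<dots> = real (card B) * real (card ?C)" by simp
  finally have ml: "real m * l \<le> real (card B) * real (card ?C)" .
  have "real m * energy f \<le> real m * (l * inner f f)"
    using bound[OF assms] by (intro mult_left_mono) auto
  also have "\<dots> = (real m * l) * inner f f" by simp
  also have "\<dots> \<le> (real (card B) * real (card ?C)) * inner f f"
    using ml by (intro mult_right_mono) auto
  finally show ?thesis .
qed

text \<open>Let b be the size of \<open>B\<close> and n the order of the group. The indicator of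
  \<open>B\<close> is the constant b/n plus a mean-zero \<open>h\<close>. The constant gives the
  expected count b^3/n. By Cauchy-Schwarz the rest is at most sqrt b times the norm of the
  convolution with \<open>h\<close>, and \<open>energy_le\<close> bounds this norm by b sqrt(n/m),
  as the squared norm of \<open>h\<close> is at most b.\<close>

lemma count_products_ge:
  "real (card B) ^ 3 / card (carrier G) - card B * sqrt (card (carrier G) * card B / m)
    \<le> (\<Sum>x\<in>B. real (card {y \<in> B. x \<otimes> y \<in> B}))"
proof -
  let ?C = "carrier G"
  define n where "n = real (card ?C)"
  define b where "b = real (card B)"
  have npos: "n > 0" using fin one_closed card_gt_0_iff[of ?C] by (auto simp: n_def)
  have finB: "finite B" using B fin finite_subset by blast
  define h where "h = restrict_finsupp ?C (\<lambda>z. of_bool (z \<in> B) - b / n)"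
  have coef_h: "coef h z = (if z \<in> ?C then of_bool (z \<in> B) - b / n else 0)" for z
    using fin by (simp add: h_def restrict_finsupp.rep_eq)
  have cardB: "(\<Sum>z\<in>?C. of_bool (z \<in> B)) = b"
    using B fin by (simp add: sum_of_bool_eq Int_absorb1 b_def)
  have mz: "h \<in> mean_zero"
  proof -
    have "supp h \<subseteq> ?C" by (auto simp: coef_h split: if_splits)
    moreover have "(\<Sum>z\<in>?C. coef h z) = (\<Sum>z\<in>?C. of_bool (z \<in> B) - b / n)"
      by (intro sum.cong) (auto simp: coef_h)
    then have "(\<Sum>z\<in>?C. coef h z) = 0"
      using npos cardB by (simp add: sum_subtractf n_def[symmetric])
    ultimately show ?thesis by (simp add: mean_zero_def)
  qed
  have hh: "inner h h \<le> b"
  proof -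
    have "inner h h = (\<Sum>z\<in>?C. (of_bool (z \<in> B) - b / n)\<^sup>2)"
      using mz by (simp add: inner_finsupp_superset[OF fin] mean_zero_def coef_h power2_eq_square)
    also have "\<dots> = (\<Sum>z\<in>?C. of_bool (z \<in> B) - 2 * (b / n) * of_bool (z \<in> B) + (b / n)\<^sup>2)"
      by (intro sum.cong) (auto simp: power2_diff)
    also have "\<dots> = b - 2 * (b / n) * b + n * (b / n)\<^sup>2"
    proof -
      have "(\<Sum>z\<in>?C. 2 * (b / n) * of_bool (z \<in> B)) = 2 * (b / n) * b"
        by (simp only: sum_distrib_left[symmetric] cardB)
      then show ?thesis by (simp only: sum.distrib sum_subtractf cardB sum_constant n_def)
    qed
    also have "\<dots> = b - b\<^sup>2 / n" using npos by (simp add: power2_eq_square field_simps)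
    also have "\<dots> \<le> b" using npos by simp
    finally show ?thesis .
  qed
  have "(\<Sum>x\<in>B. real (card {y \<in> B. x \<otimes> y \<in> B})) = (\<Sum>x\<in>?C. \<Sum>y\<in>?C. of_bool (x \<in> B \<and> y \<in> B \<and> x \<otimes> y \<in> B))"
  proof -
    have "(\<Sum>y\<in>?C. of_bool (x \<in> B \<and> y \<in> B \<and> x \<otimes> y \<in> B)) = of_bool (x \<in> B) * real (card {y \<in> B. x \<otimes> y \<in> B})" for x
    proof -
      have "?C \<inter> {y. x \<in> B \<and> y \<in> B \<and> x \<otimes> y \<in> B} = (if x \<in> B then {y \<in> B. x \<otimes> y \<in> B} else {})"
        using B by auto
      then show ?thesis using fin by (simp add: sum_of_bool_eq)
    qed
    then have "(\<Sum>x\<in>?C. \<Sum>y\<in>?C. of_bool (x \<in> B \<and> y \<in> B \<and> x \<otimes> y \<in> B))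
      = (\<Sum>x\<in>?C. of_bool (x \<in> B) * real (card {y \<in> B. x \<otimes> y \<in> B}))" by simp
    also have "\<dots> = (\<Sum>x\<in>B. real (card {y \<in> B. x \<otimes> y \<in> B}))"
      using B fin by (intro sum.mono_neutral_cong_right) auto
    finally show ?thesis by simp
  qed
  also have "\<dots> = (\<Sum>y\<in>?C. \<Sum>x\<in>?C. of_bool (x \<in> B \<and> y \<in> B \<and> x \<otimes> y \<in> B))"
    by (rule sum.swap)
  \<comment> \<open>Substituting z = xy turns the count into the convolution of the indicator of
    \<open>B\<close> with itself, summed over \<open>B\<close>.\<close>
  also have "\<dots> = (\<Sum>y\<in>?C. \<Sum>z\<in>?C. of_bool (z \<otimes> inv y \<in> B \<and> y \<in> B \<and> z \<in> B))"
  proof (rule sum.cong[OF refl])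
    fix y assume y: "y \<in> ?C"
    show "(\<Sum>x\<in>?C. of_bool (x \<in> B \<and> y \<in> B \<and> x \<otimes> y \<in> B)) = (\<Sum>z\<in>?C. of_bool (z \<otimes> inv y \<in> B \<and> y \<in> B \<and> z \<in> B) :: real)"
      by (rule sum.reindex_bij_witness[of _ "\<lambda>z. z \<otimes> inv y" "\<lambda>x. x \<otimes> y"])
        (use y in \<open>auto simp: m_assoc\<close>)
  qed
  also have "\<dots> = (\<Sum>z\<in>?C. \<Sum>y\<in>?C. of_bool (z \<otimes> inv y \<in> B \<and> y \<in> B \<and> z \<in> B))"
    by (rule sum.swap)
  also have "\<dots> = (\<Sum>z\<in>?C. of_bool (z \<in> B) * (inner (shifted B z) h + b * b / n))"
  proof (intro sum.cong refl)
    fix z assume z: "z \<in> ?C"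
    have "inner (shifted B z) h = (\<Sum>y\<in>?C. of_bool (z \<otimes> inv y \<in> B) * of_bool (y \<in> B) - of_bool (z \<otimes> inv y \<in> B) * (b / n))"
      unfolding inner_shifted by (intro sum.cong) (auto simp: coef_h algebra_simps)
    also have "\<dots> = (\<Sum>y\<in>?C. of_bool (z \<otimes> inv y \<in> B) * of_bool (y \<in> B)) - b * (b / n)"
      unfolding sum_subtractf sum_distrib_right[symmetric] sum_shifted[OF z] b_def ..
    finally have "(\<Sum>y\<in>?C. of_bool (z \<otimes> inv y \<in> B) * of_bool (y \<in> B)) = inner (shifted B z) h + b * b / n" by simp
    moreover have "(\<Sum>y\<in>?C. of_bool (z \<otimes> inv y \<in> B \<and> y \<in> B \<and> z \<in> B))
      = of_bool (z \<in> B) * (\<Sum>y\<in>?C. of_bool (z \<otimes> inv y \<in> B) * of_bool (y \<in> B) :: real)"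
      unfolding sum_distrib_left by (intro sum.cong) auto
    ultimately show "(\<Sum>y\<in>?C. of_bool (z \<otimes> inv y \<in> B \<and> y \<in> B \<and> z \<in> B)) = of_bool (z \<in> B) * (inner (shifted B z) h + b * b / n)"
      by simp
  qed
  also have "\<dots> = (\<Sum>z\<in>B. inner (shifted B z) h + b * b / n)"
    using B fin by (intro sum.mono_neutral_cong_right) auto
  also have "\<dots> = (\<Sum>z\<in>B. inner (shifted B z) h) + b ^ 3 / n"
    by (simp add: sum.distrib b_def power3_eq_cube)
  finally have count: "(\<Sum>x\<in>B. real (card {y \<in> B. x \<otimes> y \<in> B})) = (\<Sum>z\<in>B. inner (shifted B z) h) + b ^ 3 / n" .
  have "(\<Sum>z\<in>B. inner (shifted B z) h)\<^sup>2 \<le> (\<Sum>z\<in>B. (inner (shifted B z) h)\<^sup>2) * (\<Sum>z\<in>B. 1\<^sup>2)"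
    using Cauchy_Schwarz_ineq_sum[of "\<lambda>z. inner (shifted B z) h" "\<lambda>_. 1" B] by simp
  also have "\<dots> \<le> energy h * b"
  proof -
    have "(\<Sum>z\<in>B. (inner (shifted B z) h)\<^sup>2) \<le> energy h"
      unfolding energy_def using fin B by (intro sum_mono2) auto
    then show ?thesis by (simp add: b_def mult_right_mono)
  qed
  also have "\<dots> \<le> (b * n * b / m) * b"
  proof -
    have "real m * energy h \<le> b * n * inner h h" using energy_le[OF mz] by (simp add: b_def n_def)
    also have "\<dots> \<le> b * n * b" using hh npos by (intro mult_left_mono) (auto simp: b_def)
    finally have "energy h \<le> b * n * b / m" using m by (simp add: field_simps)
    then show ?thesis by (intro mult_right_mono) (auto simp: b_def)
  qed
  also have "\<dots> = (b * sqrt (n * b / m))\<^sup>2"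
  proof -
    have t: "0 \<le> n * b / m" using npos by (simp add: b_def)
    show ?thesis unfolding power_mult_distrib real_sqrt_pow2[OF t] by (simp add: power2_eq_square)
  qed
  finally have "\<bar>\<Sum>z\<in>B. inner (shifted B z) h\<bar> \<le> \<bar>b * sqrt (n * b / m)\<bar>"
    by (simp only: abs_le_square_iff)
  also have "\<dots> = b * sqrt (n * b / m)"
    using npos by (intro abs_of_nonneg mult_nonneg_nonneg) (auto simp: b_def)
  finally have "b ^ 3 / n - b * sqrt (n * b / m) \<le> (\<Sum>z\<in>B. inner (shifted B z) h) + b ^ 3 / n"
    by linarith
  then show ?thesis unfolding count unfolding b_def n_def of_nat_mult .
qed

end

end

section \<open>Words labelling the vertices of a regular tree\<close>

locale rooted_tree =
  fixes E :: "'v \<Rightarrow> 'v \<Rightarrow> bool" and r :: 'v and k :: nat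
  assumes k6: "k \<ge> 6" and reg: "regular_tree (k + 1) E"
begin

section \<open>Levels, parents and children\<close>

abbreviation d :: "'v \<Rightarrow> nat" where "d v \<equiv> graph_dist E r v"

lemma E_sym: "E u v \<Longrightarrow> E v u"
  using reg by (auto simp: regular_tree_def tree_def dest: sympD)

lemma E_irrefl: "\<not> E v v"
  using reg by (auto simp: regular_tree_def tree_def dest: irreflpD)

lemma no_cycle: "\<not> is_cycle E vs"
  using reg by (auto simp: regular_tree_def tree_def)

lemma neighbours: "finite {w. E v w}" "card {w. E v w} = k + 1"
  using reg by (auto simp: regular_tree_def)

lemma relpowp_dist: "(E ^^ d v) r v"
proof -
  have "E\<^sup>*\<^sup>* r v" using reg by (auto simp: regular_tree_def tree_def)
  then obtain n where "(E ^^ n) r v" by (auto simp: rtranclp_power)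
  then show ?thesis unfolding graph_dist_def by (rule LeastI)
qed

lemma dist_le: "(E ^^ n) r v \<Longrightarrow> d v \<le> n"
  unfolding graph_dist_def by (rule Least_le)

lemma dist_root [simp]: "d r = 0"
  using dist_le[of 0 r] by simp

lemma dist_eq_0: "d v = 0 \<longleftrightarrow> v = r"
  using relpowp_dist[of v] by auto

lemma dist_edge: "E u v \<Longrightarrow> d v \<le> Suc (d u)"
  by (rule dist_le) (meson relpowp_Suc_I relpowp_dist)

lemma ex_parent:
  assumes "d v = Suc j"
  shows "\<exists>u. E u v \<and> d u = j"
proof -
  have "(E ^^ Suc j) r v" using relpowp_dist[of v] assms by simp
  then obtain u where u: "(E ^^ j) r u" "E u v" by (rule relpowp_Suc_E)
  then have "d u \<le> j" "Suc j \<le> Suc (d u)" using dist_le dist_edge[OF u(2)] assms by auto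
  then show ?thesis using u by auto
qed

text \<open>Climbing from both vertices until the ancestors meet gives a path that stays at or above
  their level. An edge between its ends, or a common neighbour one level deeper, would close it to a
  cycle: this is how acyclicity excludes edges inside a level and gives unique parents.\<close>

lemma same_level_path:
  assumes "u \<noteq> u'" "d u = j" "d u' = j"
  shows "\<exists>vs. 3 \<le> length vs \<and> distinct vs \<and> successively E vs \<and> hd vs = u \<and> last vs = u'
    \<and> (\<forall>x\<in>set vs. d x \<le> j)"
  using assms
proof (induction j arbitrary: u u')
  case 0
  then show ?case by (simp add: dist_eq_0)
next
  case (Suc j)
  obtain p where p: "E p u" "d p = j" using ex_parent Suc by blast
  obtain p' where p': "E p' u'" "d p' = j" using ex_parent Suc by blast
  show ?case
  proof (cases "p = p'")
    case True
    have "u \<noteq> p" "p \<noteq> u'" using p(2) Suc.prems(2,3) n_not_Suc_n[of j] by metis+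
    then have "distinct [u, p, u']" using Suc.prems(1) by simp
    moreover have "successively E [u, p, u']" using p p' True E_sym by auto
    ultimately show ?thesis
      using p Suc.prems by (intro exI[of _ "[u, p, u']"]) auto
  next
    case False
    obtain vs where vs: "3 \<le> length vs" "distinct vs" "successively E vs" "hd vs = p" "last vs = p'"
      "\<forall>x\<in>set vs. d x \<le> j" using Suc.IH[OF False] p p' by blast
    have ne: "vs \<noteq> []" using vs by auto
    have "u \<notin> set vs" "u' \<notin> set vs" using vs Suc.prems by auto
    moreover have "successively E (u # vs @ [u'])"
      using vs p p' ne E_sym[OF p(1)] by (simp add: successively_append_iff successively_Cons)
    moreover have "\<forall>x\<in>set (u # vs @ [u']). d x \<le> Suc j"
      using vs(6) Suc.prems by auto
    ultimately show ?thesis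
      using vs(1,2) Suc.prems(1) by (intro exI[of _ "u # vs @ [u']"]) simp
  qed
qed

lemma no_level_edge: "E u u' \<Longrightarrow> d u \<noteq> d u'"
proof
  assume e: "E u u'" "d u = d u'"
  then have "u \<noteq> u'" using E_irrefl by auto
  then obtain vs where "3 \<le> length vs" "distinct vs" "successively E vs" "hd vs = u" "last vs = u'"
    using same_level_path e by metis
  then have "is_cycle E vs" using e E_sym by (simp add: is_cycle_def)
  then show False using no_cycle by blast
qed

lemma parent_unique:
  assumes "E u v" "E u' v" "d v = Suc (d u)" "d u' = d u"
  shows "u = u'"
proof (rule ccontr)
  assume "u \<noteq> u'"
  then obtain vs where vs: "3 \<le> length vs" "distinct vs" "successively E vs" "hd vs = u" "last vs = u'"
    "\<forall>x\<in>set vs. d x \<le> d u"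
    using same_level_path assms by metis
  then have "v \<notin> set vs" "vs \<noteq> []" using assms by auto
  then have "is_cycle E (v # vs)"
    using vs assms E_sym by (auto simp: is_cycle_def successively_Cons)
  then show False using no_cycle by blast
qed

lemma edge_cases:
  assumes "E u v"
  obtains "d v = Suc (d u)" | "d u = Suc (d v)"
  using dist_edge[OF assms] dist_edge[OF E_sym[OF assms]] no_level_edge[OF assms] by linarith

definition children :: "'v \<Rightarrow> 'v set" where
  "children v = {w. E v w \<and> d w = Suc (d v)}"

lemma finite_children: "finite (children v)"
  by (rule finite_subset[OF _ neighbours(1)[of v]]) (auto simp: children_def)

lemma card_children: "card (children v) = (if v = r then k + 1 else k)"
proof (cases "v = r")
  case True
  have "children v = {w. E v w}"
    unfolding children_def using True edge_cases[of r] by fastforce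
  then show ?thesis using True neighbours by simp
next
  case False
  then obtain j where "d v = Suc j" using dist_eq_0 not0_implies_Suc by blast
  then obtain u where u: "E u v" "d v = Suc (d u)" using ex_parent by metis
  have "{w. E v w} = insert u (children v)"
  proof (intro equalityI subsetI)
    fix w assume "w \<in> {w. E v w}"
    then have w: "E v w" by simp
    then show "w \<in> insert u (children v)"
    proof (cases rule: edge_cases)
      case 1
      then show ?thesis using w by (simp add: children_def)
    next
      case 2
      then have "d w = d u" using u(2) by simp
      then have "u = w" by (rule parent_unique[OF u(1) E_sym[OF w] u(2)])
      then show ?thesis by simp
    qed
  qed (use u E_sym in \<open>auto simp: children_def\<close>)
  moreover have "u \<notin> children v" using u by (simp add: children_def)
  ultimately show ?thesis using neighbours(2)[of v] False finite_children by simp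
qed

definition child :: "'v \<Rightarrow> nat \<Rightarrow> 'v" where
  "child v = (SOME f. bij_betw f {..<if v = r then k + 1 else k} (children v))"

lemma bij_betw_child: "bij_betw (child v) {..<if v = r then k + 1 else k} (children v)"
proof -
  have "\<exists>f. bij_betw f {..<if v = r then k + 1 else k} (children v)"
    using finite_children card_children by (intro finite_same_card_bij) auto
  then show ?thesis unfolding child_def by (rule someI_ex)
qed

text \<open>A vertex is labelled by the word of the choices made on the way from the root, last choice
  first, so that the parent is given by the tail of the word.\<close>

definition lim :: "nat list \<Rightarrow> nat" where
  "lim w = (if w = [] then k + 1 else k)"

primrec valid :: "nat list \<Rightarrow> bool" where
  "valid [] = True"
| "valid (a # w) = (valid w \<and> a < lim w)"

primrec vertex :: "nat list \<Rightarrow> 'v" where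
  "vertex [] = r"
| "vertex (a # w) = child (vertex w) a"

lemma lim_ge: "lim w \<ge> 6"
  using k6 by (simp add: lim_def)

lemma child_children:
  assumes "d (vertex w) = length w" "a < lim w"
  shows "child (vertex w) a \<in> children (vertex w)"
proof -
  have "vertex w = r \<longleftrightarrow> w = []" using assms(1) dist_eq_0[of "vertex w"] by simp
  then have "a \<in> {..<if vertex w = r then k + 1 else k}" using assms(2) by (simp add: lim_def)
  then show ?thesis by (rule bij_betw_apply[OF bij_betw_child])
qed

lemma dist_vertex: "valid w \<Longrightarrow> d (vertex w) = length w"
proof (induction w)
  case (Cons a w)
  then have "child (vertex w) a \<in> children (vertex w)" by (intro child_children) auto
  then show ?case using Cons by (simp add: children_def)
qed simp

lemma vertex_children: "valid (a # w) \<Longrightarrow> vertex (a # w) \<in> children (vertex w)"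
  using child_children dist_vertex by simp

lemma vertex_inj: "valid w \<Longrightarrow> valid w' \<Longrightarrow> vertex w = vertex w' \<Longrightarrow> w = w'"
proof (induction w arbitrary: w')
  case Nil
  then show ?case using dist_vertex[of w'] by simp
next
  case (Cons a w)
  then obtain b w'' where w': "w' = b # w''"
    using dist_vertex[of "a # w"] dist_vertex[of w'] by (cases w') auto
  have "E (vertex w) (vertex (a # w))" "E (vertex w'') (vertex (a # w))"
    using vertex_children[of a w] vertex_children[of b w''] Cons.prems w' by (auto simp: children_def)
  then have "vertex w = vertex w''"
    using Cons.prems w' dist_vertex[of "a # w"] dist_vertex[of "b # w''"] dist_vertex[of w] dist_vertex[of w'']
    by (intro parent_unique) auto
  then have "w = w''" using Cons w' by simp
  moreover have "a = b"
  proof -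
    have "vertex w = r \<longleftrightarrow> w = []"
      using dist_vertex[of w] Cons.prems dist_eq_0[of "vertex w"] by auto
    then show ?thesis
      using bij_betw_child[of "vertex w"] Cons.prems w' \<open>w = w''\<close>
      by (auto simp: bij_betw_def inj_on_def lim_def split: if_splits)
  qed
  ultimately show ?case using w' by simp
qed

lemma vertex_surj: "\<exists>w. valid w \<and> vertex w = v"
proof (induction "d v" arbitrary: v)
  case 0
  then show ?case by (intro exI[of _ "[]"]) (simp add: dist_eq_0)
next
  case (Suc j)
  then obtain u where u: "E u v" "d u = j" using ex_parent by metis
  then obtain w where w: "valid w" "vertex w = u" using Suc by metis
  have "v \<in> children u" using u Suc by (simp add: children_def)
  then obtain a where a: "a < (if u = r then k + 1 else k)" "child u a = v"
    using bij_betw_imp_surj_on[OF bij_betw_child[of u]] by (metis imageE lessThan_iff)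
  have "u = r \<longleftrightarrow> w = []" using dist_vertex[of w] w dist_eq_0[of u] by auto
  then show ?case using a w by (intro exI[of _ "a # w"]) (auto simp: lim_def)
qed

definition word :: "'v \<Rightarrow> nat list" where
  "word v = (THE w. valid w \<and> vertex w = v)"

lemma word: "valid (word v)" "vertex (word v) = v"
proof -
  have "\<exists>!w. valid w \<and> vertex w = v" using vertex_surj vertex_inj by blast
  then have "valid (word v) \<and> vertex (word v) = v" unfolding word_def by (rule theI')
  then show "valid (word v)" "vertex (word v) = v" by auto
qed

lemma word_vertex: "valid w \<Longrightarrow> word (vertex w) = w"
  using vertex_inj word by blast

lemma length_word: "length (word v) = d v"
  using dist_vertex[OF word(1)] word(2) by simp

lemma word_eq_iff: "word u = word v \<longleftrightarrow> u = v"
  using word(2) by metis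

text \<open>Adjacency is expressed by tails of words, so an injective map of words that respects
  length and tails yields an automorphism.\<close>

lemma edge_word:
  "E u v \<longleftrightarrow> (word v \<noteq> [] \<and> word u = tl (word v)) \<or> (word u \<noteq> [] \<and> word v = tl (word u))"
proof
  have *: "word v \<noteq> [] \<and> word u = tl (word v)" if "E u v" "d v = Suc (d u)" for u v
  proof -
    have "word v \<noteq> []" using length_word[of v] that(2) by auto
    then obtain a w where aw: "word v = a # w" by (meson neq_Nil_conv)
    then have "valid (a # w)" using word(1)[of v] by simp
    have "E (vertex w) v" "d (vertex w) = d u"
      using vertex_children[OF \<open>valid (a # w)\<close>] word(2)[of v] aw that(2)
      by (auto simp: children_def)
    then have "vertex w = u" using parent_unique[OF that(1)] that(2) by metis
    then show ?thesis using aw word_vertex[of w] \<open>valid (a # w)\<close> by auto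
  qed
  show "(word v \<noteq> [] \<and> word u = tl (word v)) \<or> (word u \<noteq> [] \<and> word v = tl (word u))" if e: "E u v"
    using e by (cases rule: edge_cases) (use *[OF e] *[OF E_sym[OF e]] in auto)
next
  have *: "E u v" if "word v \<noteq> []" "word u = tl (word v)" for u v
  proof -
    obtain a w where aw: "word v = a # w" using \<open>word v \<noteq> []\<close> by (meson neq_Nil_conv)
    then have "vertex (a # w) \<in> children (vertex w)" using word(1)[of v] by (intro vertex_children) simp
    then show ?thesis using aw that word(2)[of u] word(2)[of v] by (simp add: children_def)
  qed
  assume "(word v \<noteq> [] \<and> word u = tl (word v)) \<or> (word u \<noteq> [] \<and> word v = tl (word u))"
  then show "E u v" using * E_sym by blast
qed

lemma level_eq: "level E r j = {v. d v = j}"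
  by (simp add: level_def)

lemma finite_level: "finite (level E r j)"
proof (induction j)
  case 0
  then show ?case by (simp add: level_eq dist_eq_0)
next
  case (Suc j)
  have "level E r (Suc j) \<subseteq> (\<Union>u\<in>level E r j. children u)"
    using ex_parent by (force simp: level_eq children_def)
  then show ?case using Suc finite_children by (meson finite_UN finite_subset)
qed

section \<open>Automorphisms and their signs\<close>

abbreviation Aut :: "('v \<Rightarrow> 'v) set" where "Aut \<equiv> root_stabilizer E r"

lemma Aut_bij: "x \<in> Aut \<Longrightarrow> bij x"
  by (simp add: root_stabilizer_def graph_aut_def)

lemma Aut_edge: "x \<in> Aut \<Longrightarrow> E (x u) (x v) \<longleftrightarrow> E u v"
  by (simp add: root_stabilizer_def graph_aut_def)

lemma Aut_id: "id \<in> Aut"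
  by (simp add: root_stabilizer_def graph_aut_def)

lemma Aut_comp: "x \<in> Aut \<Longrightarrow> y \<in> Aut \<Longrightarrow> x \<circ> y \<in> Aut"
  by (auto simp: root_stabilizer_def graph_aut_def bij_comp)

lemma Aut_inv:
  assumes "x \<in> Aut"
  shows "inv_into UNIV x \<in> Aut"
proof -
  have b: "bij x" using assms Aut_bij by blast
  have *: "x (inv_into UNIV x v) = v" "inv_into UNIV x (x v) = v" for v
    using b by (auto simp: bij_def surj_f_inv_f)
  have "E (inv_into UNIV x u) (inv_into UNIV x v) \<longleftrightarrow> E u v" for u v
    using Aut_edge[OF assms, of "inv_into UNIV x u" "inv_into UNIV x v"] * by simp
  moreover have "inv_into UNIV x r = r" using *(2)[of r] assms by (simp add: root_stabilizer_def)
  ultimately show ?thesis using b by (simp add: root_stabilizer_def graph_aut_def bij_imp_bij_inv)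
qed

lemma Aut_dist_le: "x \<in> Aut \<Longrightarrow> d (x v) \<le> d v"
proof (induction "d v" arbitrary: v)
  case 0
  then have "v = r" by (simp add: dist_eq_0)
  then show ?case using 0 by (simp add: root_stabilizer_def)
next
  case (Suc j)
  then obtain u where u: "E u v" "d u = j" using ex_parent by metis
  then have "d (x v) \<le> Suc (d (x u))" using Aut_edge[OF Suc.prems] dist_edge by blast
  then show ?case using Suc.hyps(1)[of u] u Suc by fastforce
qed

lemma Aut_dist: "x \<in> Aut \<Longrightarrow> d (x v) = d v"
  using Aut_dist_le[of x v] Aut_dist_le[OF Aut_inv, of x "x v"] Aut_bij[of x]
  by (simp add: bij_is_inj)

lemma Aut_parent:
  assumes "x \<in> Aut" "E u v" "d v = Suc (d u)"
  shows "word (x u) = tl (word (x v))"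
proof -
  have "E (x u) (x v)" "d (x v) = Suc (d (x u))" using assms by (simp_all add: Aut_edge Aut_dist)
  then show ?thesis
    using edge_word[of "x u" "x v"] length_word[of "x u"] length_word[of "x v"] by auto
qed

lemma level_perm_permutes:
  assumes "x \<in> Aut"
  shows "level_perm E r j x permutes level E r j"
proof (rule bij_imp_permutes)
  have b: "bij x" using assms Aut_bij by blast
  have "x ` level E r j = level E r j"
  proof (intro equalityI subsetI)
    fix v assume "v \<in> level E r j"
    then have "x (inv_into UNIV x v) = v" "inv_into UNIV x v \<in> level E r j"
      using b Aut_dist[OF Aut_inv[OF assms]] by (auto simp: level_eq bij_def surj_f_inv_f)
    then show "v \<in> x ` level E r j" by (metis imageI)
  qed (use Aut_dist[OF assms] in \<open>auto simp: level_eq\<close>)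
  then have "bij_betw x (level E r j) (level E r j)"
    using b by (metis bij_betw_def bij_is_inj inj_on_subset subset_UNIV)
  then show "bij_betw (level_perm E r j x) (level E r j) (level E r j)"
    by (rule bij_betw_cong[THEN iffD1, rotated]) (simp add: level_perm_def perm_restrict_def)
qed (simp add: level_perm_def perm_restrict_def)

lemma level_perm_comp:
  assumes "y \<in> Aut"
  shows "level_perm E r j (x \<circ> y) = level_perm E r j x \<circ> level_perm E r j y"
  using Aut_dist[OF assms] by (auto simp: level_perm_def perm_restrict_def fun_eq_iff level_eq)

definition sg :: "nat \<Rightarrow> ('v \<Rightarrow> 'v) \<Rightarrow> int" where
  "sg j x = sign (level_perm E r j x)"

lemma sg_comp:
  assumes "x \<in> Aut" "y \<in> Aut"
  shows "sg j (x \<circ> y) = sg j x * sg j y"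
  using sign_compose[OF permutes_imp_permutation[OF finite_level level_perm_permutes]
      permutes_imp_permutation[OF finite_level level_perm_permutes], OF assms]
  by (simp add: sg_def level_perm_comp[OF assms(2)])

lemma sg_id: "sg j id = 1"
proof -
  have "level_perm E r j id = id" by (simp add: level_perm_def perm_restrict_def fun_eq_iff)
  then show ?thesis by (simp add: sg_def)
qed

lemma sg_cases: "sg j x = 1 \<or> sg j x = - 1"
  unfolding sg_def by (rule sign_cases[of "level_perm E r j x"]) auto

lemma sg_inv:
  assumes "x \<in> Aut"
  shows "sg j (inv_into UNIV x) = sg j x"
proof -
  have "x \<circ> inv_into UNIV x = id"
    using Aut_bij[OF assms] by (simp add: bij_is_surj surj_iff[symmetric])
  then have "sg j x * sg j (inv_into UNIV x) = 1"
    using sg_comp[OF assms Aut_inv[OF assms], of j] sg_id by simp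
  then show ?thesis using sg_cases[of j x] by auto
qed

definition Pos :: "('v \<Rightarrow> 'v) set" where
  "Pos = {x \<in> Aut. \<forall>j\<ge>1. sg j x = 1}"

lemma carrier_positive_group: "carrier (positive_group E r) = Pos"
  by (auto simp: positive_group_def positive_aut_def Pos_def sg_def sign_def)

lemma Pos_Aut: "x \<in> Pos \<Longrightarrow> x \<in> Aut"
  by (simp add: Pos_def)

lemma Pos_id: "id \<in> Pos"
  by (simp add: Pos_def Aut_id sg_id)

lemma Pos_comp: "x \<in> Pos \<Longrightarrow> y \<in> Pos \<Longrightarrow> x \<circ> y \<in> Pos"
  by (simp add: Pos_def Aut_comp sg_comp)

lemma Pos_inv: "x \<in> Pos \<Longrightarrow> inv_into UNIV x \<in> Pos"
  by (simp add: Pos_def Aut_inv sg_inv)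

section \<open>Rigid automorphisms\<close>

text \<open>The ancestors of a vertex are the suffixes of its word, so permuting the branches at
  \<open>p\<close> alters only the letter in front of the suffix \<open>p\<close>. Testing the old
  tail is harmless, because no word as short as \<open>p\<close> is moved.\<close>

primrec act :: "nat list \<Rightarrow> (nat \<Rightarrow> nat) \<Rightarrow> nat list \<Rightarrow> nat list" where
  "act p \<pi> [] = []"
| "act p \<pi> (a # w) = (if w = p then \<pi> a else a) # act p \<pi> w"

text \<open>The permutation \<open>\<pi>\<close> of the subtrees hanging off the vertex labelled \<open>p\<close>.\<close>

definition rig :: "nat list \<Rightarrow> (nat \<Rightarrow> nat) \<Rightarrow> 'v \<Rightarrow> 'v" where
  "rig p \<pi> v = vertex (act p \<pi> (word v))"

lemma length_act [simp]: "length (act p \<pi> w) = length w"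
  by (induction w) auto

lemma act_eq_Nil [simp]: "act p \<pi> w = [] \<longleftrightarrow> w = []"
  by (cases w) auto

lemma act_short: "length w \<le> length p \<Longrightarrow> act p \<pi> w = w"
  by (induction w) auto

lemma act_eq_self: "act p \<pi> w = p \<longleftrightarrow> w = p"
  by (metis act_short length_act order_refl)

lemma act_comp: "act p \<pi> (act p \<tau> w) = act p (\<pi> \<circ> \<tau>) w"
  by (induction w) (auto simp: act_eq_self)

lemma act_id: "act p id w = w"
  by (induction w) auto

lemma act_tl: "act p \<pi> (tl w) = tl (act p \<pi> w)"
  by (cases w) auto

lemma act_inv:
  assumes "bij \<pi>"
  shows "act p (inv_into UNIV \<pi>) (act p \<pi> w) = w" "act p \<pi> (act p (inv_into UNIV \<pi>) w) = w"
proof -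
  have "inv_into UNIV \<pi> \<circ> \<pi> = id" "\<pi> \<circ> inv_into UNIV \<pi> = id"
    using assms by (auto simp: bij_is_inj bij_is_surj fun_eq_iff surj_f_inv_f)
  then show "act p (inv_into UNIV \<pi>) (act p \<pi> w) = w" "act p \<pi> (act p (inv_into UNIV \<pi>) w) = w"
    by (simp_all add: act_comp act_id)
qed

lemma act_inject: "bij \<pi> \<Longrightarrow> act p \<pi> w = act p \<pi> w' \<longleftrightarrow> w = w'"
  using act_inv(1) by metis

lemma act_middle: "act q \<tau> (ys @ c # q) = ys @ \<tau> c # q"
  by (induction ys) (auto simp: act_short)

lemma act_other: "(\<And>ys c. w \<noteq> ys @ c # q) \<Longrightarrow> act q \<tau> w = w"
proof (induction w)
  case (Cons b w)
  have "w \<noteq> q" using Cons.prems[of "[]" b] by auto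
  moreover have "w \<noteq> ys @ c # q" for ys c using Cons.prems[of "b # ys" c] by auto
  ultimately show ?case using Cons.IH by simp
qed simp

text \<open>As \<open>q\<close> is no longer than \<open>p\<close>, a suffix equals \<open>q\<close>
  before applying \<open>act p \<pi>\<close> exactly if it does afterwards; and
  \<open>q \<noteq> p\<close> keeps the two maps from permuting the same letter.\<close>

lemma act_conj:
  assumes "bij \<tau>" "length q \<le> length p" "q \<noteq> p"
  shows "act q \<tau> (act p \<pi> w) = act (act q \<tau> p) \<pi> (act q \<tau> w)"
proof (induction w)
  case (Cons a w)
  have "act p \<pi> w = q \<longleftrightarrow> w = q"
    using act_short[OF assms(2)] by (metis act_short assms(2) length_act)
  moreover have "act q \<tau> w = act q \<tau> p \<longleftrightarrow> w = p" using act_inject assms by blast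
  ultimately show ?case using Cons assms(3) by auto
qed simp

lemma lim_act [simp]: "lim (act p \<pi> w) = lim w"
  by (simp add: lim_def)

lemma valid_act:
  assumes "\<pi> permutes {..<lim p}" "valid w"
  shows "valid (act p \<pi> w)"
  using assms(2)
proof (induction w)
  case (Cons a w)
  then show ?case using permutes_in_image[OF assms(1), of a] by auto
qed simp

lemma word_rig: "\<pi> permutes {..<lim p} \<Longrightarrow> word (rig p \<pi> v) = act p \<pi> (word v)"
  unfolding rig_def by (intro word_vertex valid_act word)

lemma rig_comp:
  "\<pi> permutes {..<lim p} \<Longrightarrow> \<tau> permutes {..<lim p} \<Longrightarrow> rig p (\<pi> \<circ> \<tau>) = rig p \<pi> \<circ> rig p \<tau>"
  by (simp add: fun_eq_iff word_eq_iff[symmetric] word_rig permutes_compose act_comp)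

lemma rig_id: "rig p id = id"
  by (simp add: rig_def fun_eq_iff act_id word)

lemma rig_inv:
  assumes "\<pi> permutes {..<lim p}"
  shows "rig p (inv_into UNIV \<pi>) \<circ> rig p \<pi> = id" "rig p \<pi> \<circ> rig p (inv_into UNIV \<pi>) = id"
  using rig_comp[OF permutes_inv[OF assms] assms] rig_comp[OF assms permutes_inv[OF assms]] assms
  by (simp_all add: permutes_inv_o rig_id)

lemma inv_rig: "\<pi> permutes {..<lim p} \<Longrightarrow> inv_into UNIV (rig p \<pi>) = rig p (inv_into UNIV \<pi>)"
  using rig_inv by (intro inv_unique_comp)

lemma rig_Aut:
  assumes "\<pi> permutes {..<lim p}"
  shows "rig p \<pi> \<in> Aut"
proof -
  have "bij (rig p \<pi>)" using rig_inv[OF assms] by (rule o_bij)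
  moreover have "E (rig p \<pi> u) (rig p \<pi> v) \<longleftrightarrow> E u v" for u v
  proof -
    have "act p \<pi> w' \<noteq> [] \<and> act p \<pi> w = tl (act p \<pi> w') \<longleftrightarrow> w' \<noteq> [] \<and> w = tl w'" for w w'
      using act_inject[OF permutes_bij[OF assms], of p w "tl w'"] by (simp add: act_tl)
    then show ?thesis
      using edge_word[of "rig p \<pi> u" "rig p \<pi> v"] edge_word[of u v]
      by (simp only: word_rig[OF assms])
  qed
  moreover have "rig p \<pi> r = r"
  proof -
    have "word r = []" using word_vertex[of "[]"] by simp
    then show ?thesis by (simp add: rig_def)
  qed
  ultimately show ?thesis by (simp add: root_stabilizer_def graph_aut_def)
qed

lemma rig_conj:
  assumes "\<tau> permutes {..<lim q}" "\<pi> permutes {..<lim p}" "length q \<le> length p" "q \<noteq> p"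
  shows "rig q \<tau> \<circ> rig p \<pi> \<circ> rig q (inv_into UNIV \<tau>) = rig (act q \<tau> p) \<pi>"
proof -
  have bij: "bij \<tau>" using assms permutes_bij by blast
  have "act q \<tau> (act p \<pi> (act q (inv_into UNIV \<tau>) w)) = act (act q \<tau> p) \<pi> w" for w
    using act_conj[OF bij assms(3,4), of \<pi> "act q (inv_into UNIV \<tau>) w"] act_inv(2)[OF bij] by simp
  then show ?thesis
    using assms
    by (simp add: fun_eq_iff word_eq_iff[symmetric] word_rig permutes_inv)
qed

text \<open>No sign has to be computed: a 3-cycle has order 3 and is therefore the square of its own
  square, squares have sign 1 at every level, and 3-cycles generate.\<close>

lemma rig_positive:
  assumes "\<pi> \<in> alternating {..<lim p}"
  shows "rig p \<pi> \<in> Pos"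
proof -
  define C where "C = {\<pi>. \<pi> permutes {..<lim p} \<and> (\<forall>j. sg j (rig p \<pi>) = 1)}"
  have sq: "f \<circ> f \<in> C" if "f permutes {..<lim p}" for f
  proof -
    have "sg j (rig p f) * sg j (rig p f) = 1" for j using sg_cases[of j "rig p f"] by auto
    then show ?thesis using that by (simp add: C_def permutes_compose rig_comp sg_comp rig_Aut)
  qed
  have "alternating {..<lim p} \<subseteq> C"
  proof (rule alternating_subset_cyc3_closed)
    show "id \<in> C" by (simp add: C_def permutes_id rig_id sg_id)
    show "f \<circ> g \<in> C" if "f \<in> C" "g \<in> C" for f g
      using that by (simp add: C_def permutes_compose rig_comp sg_comp rig_Aut)
    show "cyc3 a b c \<in> C" if "a \<in> {..<lim p}" "b \<in> {..<lim p}" "c \<in> {..<lim p}" "distinct [a, b, c]" for a b c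
    proof -
      let ?g = "cyc3 a b c"
      have "?g = (?g \<circ> ?g) \<circ> (?g \<circ> ?g)"
        using that by (auto simp: fun_eq_iff cyc3_apply)
      moreover have "?g permutes {..<lim p}" using cyc3_alternating[OF that] alternating_permutes by blast
      ultimately show ?thesis using sq permutes_compose by metis
    qed
  qed simp
  then have "\<pi> \<in> C" using assms by blast
  then show ?thesis by (simp add: C_def Pos_def rig_Aut)
qed

section \<open>Swaps of sibling subtrees and their signs\<close>

abbreviation sw :: "nat list \<Rightarrow> nat \<Rightarrow> nat \<Rightarrow> 'v \<Rightarrow> 'v" where
  "sw p a b \<equiv> rig p (transposition a b)"

lemma sw_conj_same:
  assumes "\<tau> permutes {..<lim p}" "a < lim p" "b < lim p"
  shows "rig p \<tau> \<circ> sw p a b \<circ> rig p (inv_into UNIV \<tau>) = sw p (\<tau> a) (\<tau> b)"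
proof -
  have ab: "transposition a b permutes {..<lim p}" using assms by (intro permutes_swap_id) auto
  have "\<tau> \<circ> transposition a b \<circ> inv_into UNIV \<tau> = transposition (\<tau> a) (\<tau> b)"
  proof
    fix z
    have "\<tau> (transposition a b (inv_into UNIV \<tau> z)) = transposition (\<tau> a) (\<tau> b) (\<tau> (inv_into UNIV \<tau> z))"
      using permutes_inj[OF assms(1)] by (simp add: Transposition.transpose_def inj_eq)
    also have "\<tau> (inv_into UNIV \<tau> z) = z" using assms(1) permutes_inverses(1) by metis
    finally show "(\<tau> \<circ> transposition a b \<circ> inv_into UNIV \<tau>) z = transposition (\<tau> a) (\<tau> b) z" by simp
  qed
  then show ?thesis
    using assms(1) ab permutes_inv[OF assms(1)] rig_comp[of "\<tau> \<circ> transposition a b" p "inv_into UNIV \<tau>"]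
    by (simp add: rig_comp[symmetric] permutes_compose)
qed

definition Swaps :: "nat \<Rightarrow> ('v \<Rightarrow> 'v) set" where
  "Swaps i = {sw p a b |p a b. valid p \<and> length p = i \<and> a < lim p \<and> b < lim p \<and> a \<noteq> b}"

lemma SwapsI: "valid p \<Longrightarrow> length p = i \<Longrightarrow> a < lim p \<Longrightarrow> b < lim p \<Longrightarrow> a \<noteq> b \<Longrightarrow> sw p a b \<in> Swaps i"
  by (auto simp: Swaps_def)

lemma swap_permutes: "a < lim p \<Longrightarrow> b < lim p \<Longrightarrow> transposition a b permutes {..<lim p}"
  by (intro permutes_swap_id) auto

lemma Swaps_Aut: "x \<in> Swaps i \<Longrightarrow> x \<in> Aut"
  by (auto simp: Swaps_def intro!: rig_Aut swap_permutes)

lemma Swaps_involution: "x \<in> Swaps i \<Longrightarrow> x \<circ> x = id"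
  by (auto simp: Swaps_def rig_comp[symmetric] swap_permutes rig_id)

text \<open>Any two swaps of sibling subtrees at the same level are connected through conjugations by
  rigid 3-cycles: first the letters of the branching vertex are changed one at a time, then the
  two swapped letters.\<close>

lemma Swaps_connected:
  assumes trans: "\<And>x y z. x \<in> Swaps i \<Longrightarrow> y \<in> Swaps i \<Longrightarrow> z \<in> Swaps i \<Longrightarrow> R x y \<Longrightarrow> R y z \<Longrightarrow> R x z"
    and sym: "\<And>x y. x \<in> Swaps i \<Longrightarrow> y \<in> Swaps i \<Longrightarrow> R x y \<Longrightarrow> R y x"
    and refl: "\<And>x. x \<in> Swaps i \<Longrightarrow> R x x"
    and conj: "\<And>p a b q \<tau>. valid p \<Longrightarrow> length p = i \<Longrightarrow> a < lim p \<Longrightarrow> b < lim p \<Longrightarrow> a \<noteq> b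
      \<Longrightarrow> valid q \<Longrightarrow> length q \<le> i \<Longrightarrow> (\<exists>c e f. c < lim q \<and> e < lim q \<and> f < lim q \<and> distinct [c, e, f] \<and> \<tau> = cyc3 c e f)
      \<Longrightarrow> R (sw p a b) (rig q \<tau> \<circ> sw p a b \<circ> rig q (inv_into UNIV \<tau>))"
    and xy: "x \<in> Swaps i" "y \<in> Swaps i"
  shows "R x y"
proof -
  \<comment> \<open>The letters of \<open>w\<close> are turned into 0, the deepest first: for
    \<open>ys @ c # w\<close> the conjugation takes place at the ancestor \<open>w\<close>, whose
    own letters are still unchanged.\<close>
  have change: "R (sw (ys @ w) a b) (sw (ys @ replicate (length w) 0) a b)"
    if "valid (ys @ w)" "length (ys @ w) = i" "a < lim (ys @ w)" "b < lim (ys @ w)" "a \<noteq> b" for ys w a b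
    using that
  proof (induction w arbitrary: ys)
    case Nil
    then show ?case by (auto intro!: refl SwapsI)
  next
    case (Cons c w)
    have app: "valid (ys @ c # w) \<longleftrightarrow> valid (c # w) \<and> (\<forall>a\<in>set ys. a < k)" for ys c w
      by (induction ys) (auto simp: lim_def)
    have val: "valid (c # w)" using Cons.prems app by blast
    then have v0: "valid (ys @ 0 # w)" using Cons.prems lim_ge[of w] app by auto
    have lim0: "lim (ys @ 0 # w) = lim (ys @ c # w)" by (simp add: lim_def)
    have "R (sw (ys @ c # w) a b) (sw (ys @ 0 # w) a b)"
    proof (cases "c = 0")
      case True
      then show ?thesis using Cons.prems by (auto intro!: refl SwapsI)
    next
      case False
      \<comment> \<open>Any third letter will do; it makes the exchange of \<open>c\<close> for 0
        part of an even permutation.\<close>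
      define e :: nat where "e = (if c = 1 then 2 else 1)"
      have e: "e < lim w" "distinct [c, 0, e]" using False lim_ge[of w] by (auto simp: e_def)
      let ?\<tau> = "cyc3 c 0 e"
      have \<tau>: "?\<tau> permutes {..<lim w}"
        using e val by (intro alternating_permutes cyc3_alternating) auto
      have "R (sw (ys @ c # w) a b) (rig w ?\<tau> \<circ> sw (ys @ c # w) a b \<circ> rig w (inv_into UNIV ?\<tau>))"
      proof (rule conj)
        show "\<exists>c' e' f'. c' < lim w \<and> e' < lim w \<and> f' < lim w \<and> distinct [c', e', f'] \<and> ?\<tau> = cyc3 c' e' f'"
          using val e by (intro exI[of _ c] exI[of _ 0] exI[of _ e]) auto
      qed (use Cons.prems val in auto)
      also have "rig w ?\<tau> \<circ> sw (ys @ c # w) a b \<circ> rig w (inv_into UNIV ?\<tau>) = sw (ys @ 0 # w) a b"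
        using rig_conj[OF \<tau> swap_permutes[OF Cons.prems(3,4)]] e by (simp add: act_middle cyc3_apply)
      finally show ?thesis .
    qed
    moreover have "R (sw (ys @ 0 # w) a b) (sw ((ys @ [0]) @ replicate (length w) 0) a b)"
      using Cons.IH[of "ys @ [0]"] Cons.prems v0 lim0 by simp
    moreover have "replicate (length (c # w)) 0 = 0 # replicate (length w) (0::nat)" by simp
    moreover have "valid (ys @ 0 # replicate (length w) 0)"
    proof -
      have "valid (0 # replicate n 0)" for n using k6 by (induction n) (auto simp: lim_def)
      then show ?thesis using Cons.prems app by blast
    qed
    moreover have "lim (ys @ 0 # replicate (length w) 0) = lim (ys @ c # w)" by (simp add: lim_def)
    ultimately show ?case
      using Cons.prems v0 lim0
      by (auto intro!: trans[of "sw (ys @ c # w) a b" "sw (ys @ 0 # w) a b"] SwapsI)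
  qed
  \<comment> \<open>Conjugation at \<open>p\<close> itself applies a 3-cycle to the swapped pair.
    The permutations compatible with \<open>R\<close> in this way are closed under composition, so
    they include all even ones, which are transitive on pairs.\<close>
  have letters: "R (sw p a b) (sw p a' b')"
    if p: "valid p" "length p = i" and ab: "a < lim p" "b < lim p" "a \<noteq> b" "a' < lim p" "b' < lim p" "a' \<noteq> b'"
    for p a b a' b'
  proof -
    define C where "C = {\<pi>. \<pi> permutes {..<lim p} \<and>
      (\<forall>a b. a < lim p \<longrightarrow> b < lim p \<longrightarrow> a \<noteq> b \<longrightarrow> R (sw p a b) (sw p (\<pi> a) (\<pi> b)))}"
    have "alternating {..<lim p} \<subseteq> C"
    proof (rule alternating_subset_cyc3_closed)
      show "id \<in> C" using p by (auto simp: C_def permutes_id intro!: refl SwapsI)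
      show "f \<circ> g \<in> C" if fg: "f \<in> C" "g \<in> C" for f g
      proof -
        have f: "f permutes {..<lim p}" and g: "g permutes {..<lim p}" using fg by (auto simp: C_def)
        have lt: "a < lim p \<Longrightarrow> g a < lim p" "a < lim p \<Longrightarrow> f a < lim p" for a
          using permutes_in_image[OF g] permutes_in_image[OF f] by auto
        have ne: "a \<noteq> b \<Longrightarrow> g a \<noteq> g b" "a \<noteq> b \<Longrightarrow> f a \<noteq> f b" for a b
          using permutes_inj[OF g] permutes_inj[OF f] by (auto simp: inj_eq)
        have "R (sw p a b) (sw p (f (g a)) (f (g b)))" if "a < lim p" "b < lim p" "a \<noteq> b" for a b
          by (rule trans[of _ "sw p (g a) (g b)"])
            (use that fg p lt ne in \<open>auto simp: C_def intro!: SwapsI\<close>)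
        then show ?thesis using f g by (simp add: C_def permutes_compose)
      qed
      show "cyc3 c e f \<in> C" if cef: "c \<in> {..<lim p}" "e \<in> {..<lim p}" "f \<in> {..<lim p}" "distinct [c, e, f]" for c e f
      proof -
        let ?\<tau> = "cyc3 c e f"
        have \<tau>: "?\<tau> permutes {..<lim p}" using cyc3_alternating[OF cef] alternating_permutes by blast
        have "R (sw p a b) (sw p (?\<tau> a) (?\<tau> b))" if "a < lim p" "b < lim p" "a \<noteq> b" for a b
        proof -
          have "R (sw p a b) (rig p ?\<tau> \<circ> sw p a b \<circ> rig p (inv_into UNIV ?\<tau>))"
            by (rule conj) (use that p cef in blast)+
          also have "rig p ?\<tau> \<circ> sw p a b \<circ> rig p (inv_into UNIV ?\<tau>) = sw p (?\<tau> a) (?\<tau> b)"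
            by (rule sw_conj_same[OF \<tau> that(1,2)])
          finally show ?thesis .
        qed
        then show ?thesis using \<tau> by (simp add: C_def)
      qed
    qed simp
    moreover obtain \<pi> where "\<pi> \<in> alternating {..<lim p}" "\<pi> a = a'" "\<pi> b = b'"
      by (rule alternating_2_transitive[of "{..<lim p}" a b a' b'])
        (use ab lim_ge[of p] in auto)
    ultimately show ?thesis using ab by (auto simp: C_def)
  qed
  obtain p a b where x: "x = sw p a b" "valid p" "length p = i" "a < lim p" "b < lim p" "a \<noteq> b"
    using xy by (auto simp: Swaps_def)
  obtain q a' b' where y: "y = sw q a' b'" "valid q" "length q = i" "a' < lim q" "b' < lim q" "a' \<noteq> b'"
    using xy by (auto simp: Swaps_def)
  define z where "z = replicate i (0::nat)"
  have lim: "lim p = lim z" "lim q = lim z" using x y by (auto simp: lim_def z_def)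
  have z: "valid z" "length z = i"
  proof -
    have "valid (replicate n 0)" for n using k6 by (induction n) (auto simp: lim_def)
    then show "valid z" "length z = i" by (auto simp: z_def)
  qed
  have S: "sw z a b \<in> Swaps i" "sw z a' b' \<in> Swaps i"
    using SwapsI[OF z] x(4-6) y(4-6) lim by simp_all
  have 1: "R x (sw z a b)" using change[of "[]" p a b] x by (simp add: z_def)
  have 2: "R (sw z a b) (sw z a' b')" using letters[OF z] x(4-6) y(4-6) lim by simp
  have "R y (sw z a' b')" using change[of "[]" q a' b'] y by (simp add: z_def)
  then have 3: "R (sw z a' b') y" by (rule sym[OF xy(2) S(2)])
  show ?thesis
    by (rule trans[OF xy(1) S(2) xy(2) trans[OF xy(1) S 1 2] 3])
qed

text \<open>Conjugation preserves signs, so having equal signs is a relation to which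
  \<open>Swaps_connected\<close> applies.\<close>

lemma sg_Swaps:
  assumes "x \<in> Swaps i" "y \<in> Swaps i"
  shows "sg j x = sg j y"
proof (rule Swaps_connected[of i "\<lambda>x y. sg j x = sg j y"])
  fix p q a b and \<tau> :: "nat \<Rightarrow> nat"
  assume ab: "a < lim p" "b < lim p"
    and "\<exists>c e f. c < lim q \<and> e < lim q \<and> f < lim q \<and> distinct [c, e, f] \<and> \<tau> = cyc3 c e f"
  then have \<tau>: "\<tau> permutes {..<lim q}" by (auto intro!: alternating_permutes cyc3_alternating)
  have A: "rig q \<tau> \<in> Aut" "rig q (inv_into UNIV \<tau>) \<in> Aut" "sw p a b \<in> Aut"
    using \<tau> ab by (auto intro!: rig_Aut swap_permutes permutes_inv)
  have "sg j (rig q \<tau>) * sg j (rig q (inv_into UNIV \<tau>)) = 1"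
    using sg_comp[OF A(1,2), of j] rig_inv[OF \<tau>] sg_id by simp
  then show "sg j (sw p a b) = sg j (rig q \<tau> \<circ> sw p a b \<circ> rig q (inv_into UNIV \<tau>))"
    using A by (simp add: sg_comp Aut_comp)
qed (use assms in auto)

lemma Swaps_comp_Pos:
  assumes "x \<in> Swaps i" "y \<in> Swaps i"
  shows "x \<circ> y \<in> Pos"
proof -
  have "sg j (x \<circ> y) = 1" for j
    using sg_Swaps[OF assms, of j] sg_cases[of j y] Swaps_Aut assms by (auto simp: sg_comp)
  then show ?thesis using Swaps_Aut assms by (simp add: Pos_def Aut_comp)
qed

text \<open>The two exchanged subtrees begin at level \<open>Suc i\<close>, so down to that level
  only their roots are seen to move.\<close>

lemma sw_level:
  assumes "valid p" "length p = i" "a < lim p" "b < lim p" "d v \<le> Suc i"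
  shows "sw p a b v = transposition (vertex (a # p)) (vertex (b # p)) v"
proof -
  have val: "valid (a # p)" "valid (b # p)" using assms by auto
  have "word (sw p a b v) = act p (transposition a b) (word v)"
    using swap_permutes[OF assms(3,4)] by (rule word_rig)
  also have "\<dots> = word (transposition (vertex (a # p)) (vertex (b # p)) v)"
  proof (cases "word v")
    case Nil
    then have "v \<noteq> vertex (a # p)" "v \<noteq> vertex (b # p)"
      using word_vertex[OF val(1)] word_vertex[OF val(2)] by auto
    then show ?thesis using Nil by simp
  next
    case (Cons c w)
    have "length w \<le> length p" using assms length_word[of v] Cons by simp
    then have act: "act p (transposition a b) (word v) = (if w = p then transposition a b c else c) # w"
      using Cons by (simp add: act_short)
    define va vb where "va = vertex (a # p)" and "vb = vertex (b # p)"
    have wab: "word va = a # p" "word vb = b # p"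
      unfolding va_def vb_def using word_vertex val by blast+
    have "act p (transposition a b) (word v) = word (transposition va vb v)"
    proof (cases "v = va \<or> v = vb")
      case True
      then show ?thesis
      proof
        assume "v = va"
        moreover from this have "c = a \<and> w = p" using Cons wab by simp
        ultimately show ?thesis unfolding act using wab by simp
      next
        assume "v = vb"
        moreover from this have "c = b \<and> w = p" using Cons wab by simp
        ultimately show ?thesis unfolding act using wab by simp
      qed
    next
      case False
      then have "word v \<noteq> a # p" "word v \<noteq> b # p" using wab word(2) by metis+
      then have "(if w = p then transposition a b c else c) = c" using Cons by auto
      moreover have "transposition va vb v = v" using False by simp
      ultimately show ?thesis unfolding act using Cons by simp
    qed
    then show ?thesis by (simp only: va_def vb_def)
  qed
  finally show ?thesis by (simp add: word_eq_iff)
qed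

lemma sg_Swaps_own_level: "x \<in> Swaps i \<Longrightarrow> sg (Suc i) x = - 1"
proof -
  assume "x \<in> Swaps i"
  then obtain p a b where x: "x = sw p a b" "valid p" "length p = i" "a < lim p" "b < lim p" "a \<noteq> b"
    by (auto simp: Swaps_def)
  have val: "valid (a # p)" "valid (b # p)" using x by auto
  have "level_perm E r (Suc i) x = transposition (vertex (a # p)) (vertex (b # p))"
  proof
    fix v
    show "level_perm E r (Suc i) x v = transposition (vertex (a # p)) (vertex (b # p)) v"
      using sw_level[OF x(2-5), of v] dist_vertex[OF val(1)] dist_vertex[OF val(2)] x
      by (auto simp: level_perm_def perm_restrict_def level_eq Transposition.transpose_def)
  qed
  moreover have "vertex (a # p) \<noteq> vertex (b # p)" using vertex_inj val x by blast
  ultimately show ?thesis by (simp add: sg_def sign_swap_id)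
qed

section \<open>Trivialising one more level by swaps\<close>

primrec compose_list :: "('v \<Rightarrow> 'v) list \<Rightarrow> 'v \<Rightarrow> 'v" where
  "compose_list [] = id"
| "compose_list (y # ys) = y \<circ> compose_list ys"

lemma compose_list_snoc: "compose_list (ys @ [s]) = compose_list ys \<circ> s"
  by (induction ys) (auto simp: comp_assoc)

definition Fix :: "nat \<Rightarrow> ('v \<Rightarrow> 'v) set" where
  "Fix i = {x \<in> Aut. \<forall>v. d v \<le> i \<longrightarrow> x v = v}"

text \<open>An automorphism trivial down to level \<open>i\<close> maps each vertex of the next
  level to a sibling. Swapping \<open>v\<close> with \<open>x v\<close> after \<open>x\<close>
  returns \<open>v\<close> to its place and disturbs no vertex of that level fixed by
  \<open>x\<close>, so fewer vertices are moved.\<close>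

lemma Fix_decompose:
  assumes "x \<in> Fix i"
  shows "\<exists>ys. set ys \<subseteq> Swaps i \<and> compose_list ys \<circ> x \<in> Fix (Suc i)"
  using assms
proof (induction "card {v \<in> level E r (Suc i). x v \<noteq> v}" arbitrary: x rule: less_induct)
  case less
  have xA: "x \<in> Aut" and xfix: "\<And>v. d v \<le> i \<Longrightarrow> x v = v" using less.prems by (auto simp: Fix_def)
  show ?case
  proof (cases "\<exists>v\<in>level E r (Suc i). x v \<noteq> v")
    case False
    then have "x \<in> Fix (Suc i)" using xA xfix by (auto simp: Fix_def level_eq le_Suc_eq)
    then show ?thesis by (intro exI[of _ "[]"]) simp
  next
    case True
    then obtain v where v: "d v = Suc i" "x v \<noteq> v" by (auto simp: level_eq)
    obtain u where u: "E u v" "d u = i" using ex_parent v by blast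
    have "word u = tl (word v)" using Aut_parent[OF Aut_id u(1)] v u by simp
    moreover have "word u = tl (word (x v))" using Aut_parent[OF xA u(1)] xfix[of u] v u by simp
    moreover have "word v \<noteq> []" "word (x v) \<noteq> []"
      using length_word[of v] length_word[of "x v"] Aut_dist[OF xA] v by auto
    ultimately obtain a b where ab: "word v = a # word u" "word (x v) = b # word u"
      by (metis list.collapse)
    define p where "p = word u"
    have val: "valid (a # p)" "valid (b # p)" using ab word(1)[of v] word(1)[of "x v"] by (auto simp: p_def)
    have p: "length p = i" using length_word u by (simp add: p_def)
    have vtx: "vertex (a # p) = v" "vertex (b # p) = x v"
      using ab word(2)[of v] word(2)[of "x v"] by (simp_all add: p_def)
    have "a \<noteq> b" using ab v(2) word_eq_iff by metis
    define s where "s = sw p a b"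
    have sS: "s \<in> Swaps i" using val p \<open>a \<noteq> b\<close> by (auto simp: s_def intro!: SwapsI)
    have s: "s w = transposition v (x v) w" if "d w \<le> Suc i" for w
      using sw_level[of p i a b w] val p vtx that by (simp add: s_def)
    have sx: "s \<circ> x \<in> Fix i"
    proof -
      have "s w = w" if "d w \<le> i" for w
        using s[of w] that v Aut_dist[OF xA, of v] by (auto simp: Transposition.transpose_def)
      then show ?thesis using xfix Swaps_Aut[OF sS] xA by (auto simp: Fix_def Aut_comp)
    qed
    have "{w \<in> level E r (Suc i). (s \<circ> x) w \<noteq> w} \<subset> {w \<in> level E r (Suc i). x w \<noteq> w}"
    proof
      show "{w \<in> level E r (Suc i). (s \<circ> x) w \<noteq> w} \<subseteq> {w \<in> level E r (Suc i). x w \<noteq> w}"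
      proof safe
        fix w assume w: "w \<in> level E r (Suc i)" "(s \<circ> x) w \<noteq> w" "x w = w"
        have "x w \<noteq> x v" "w \<noteq> v"
          using w v Aut_bij[OF xA] by (auto simp: bij_is_inj inj_eq)
        then have "s w = w" using s[of w] w by (simp add: level_eq)
        then show False using w by simp
      qed
      have "(s \<circ> x) v = v" using s[of "x v"] Aut_dist[OF xA, of v] v by simp
      then show "{w \<in> level E r (Suc i). (s \<circ> x) w \<noteq> w} \<noteq> {w \<in> level E r (Suc i). x w \<noteq> w}"
        using v by (auto simp: level_eq)
    qed
    then have "card {w \<in> level E r (Suc i). (s \<circ> x) w \<noteq> w} < card {w \<in> level E r (Suc i). x w \<noteq> w}"
      by (intro psubset_card_mono) (simp_all add: finite_level)
    then obtain ys where ys: "set ys \<subseteq> Swaps i" "compose_list ys \<circ> (s \<circ> x) \<in> Fix (Suc i)"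
      using less.hyps sx by blast
    show ?thesis
      using ys sS by (intro exI[of _ "ys @ [s]"]) (auto simp: comp_assoc compose_list_snoc)
  qed
qed

section \<open>Generation by the conjugates of rigid even permutations at the root\<close>

text \<open>\<open>N\<close> will be the kernel of the action of \<open>Pos\<close> on an invariant
  subspace; \<open>N_Fix\<close> expresses that this action factors through the ball of radius
  \<open>n\<close>.\<close>

context
  fixes N :: "('v \<Rightarrow> 'v) set" and n :: nat
  assumes N_sub: "N \<subseteq> Pos"
    and N_id: "id \<in> N"
    and N_comp: "\<And>x y. x \<in> N \<Longrightarrow> y \<in> N \<Longrightarrow> x \<circ> y \<in> N"
    and N_inv: "\<And>x. x \<in> N \<Longrightarrow> inv_into UNIV x \<in> N"
    and N_normal: "\<And>g x. g \<in> Pos \<Longrightarrow> x \<in> N \<Longrightarrow> g \<circ> x \<circ> inv_into UNIV g \<in> N"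
    and N_root: "\<And>\<pi>. \<pi> \<in> alternating {..<k + 1} \<Longrightarrow> rig [] \<pi> \<in> N"
    and N_Fix: "Pos \<inter> Fix n \<subseteq> N"
begin

lemma lim_Nil: "lim [] = k + 1"
  by (simp add: lim_def)

lemma inv_Swaps_comp: "x \<in> Swaps i \<Longrightarrow> y \<in> Swaps i \<Longrightarrow> inv_into UNIV (x \<circ> y) = y \<circ> x"
  using Swaps_involution[of x i] Swaps_involution[of y i]
  by (intro inv_unique_comp) (simp_all add: fun_eq_iff)

lemma valid_snoc: "valid (ys @ [v]) \<longleftrightarrow> v < k + 1 \<and> (\<forall>a\<in>set ys. a < k)"
  by (induction ys) (auto simp: lim_def)

text \<open>The swap \<open>x\<close> alone is not in \<open>Pos\<close>, so it is paired with a
  swap \<open>y\<close> inside a main subtree fixed by \<open>\<tau>\<close>. In the commutator of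
  \<open>x \<circ> y\<close> with \<open>\<sigma>\<close> the two copies of \<open>y\<close> cancel,
  and \<open>x\<close> times its conjugate by \<open>\<sigma>\<close> remains.\<close>

lemma Swaps_conj_root:
  assumes p: "valid (ys @ [v])" and ab: "a < k" "b < k" "a \<noteq> b"
    and \<tau>: "c < k + 1" "e < k + 1" "f < k + 1" "distinct [c, e, f]" "\<tau> = cyc3 c e f"
  shows "sw (ys @ [v]) a b \<circ> sw (ys @ [\<tau> v]) a b \<in> N"
proof -
  \<comment> \<open>\<open>\<tau>\<close> moves three of at least seven letters, so it fixes some
    main subtree.\<close>
  have "card ({..<k + 1} - {c, e, f}) \<ge> 1"
    using card_Diff_subset[of "{c, e, f}" "{..<k + 1}"] \<tau> k6 by simp
  then obtain u where u: "u < k + 1" "u \<notin> {c, e, f}"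
    by (metis DiffE card.empty ex_in_conv lessThan_iff not_one_le_zero)
  have \<tau>_alt: "\<tau> \<in> alternating {..<k + 1}" using \<tau> by (auto intro!: cyc3_alternating)
  have \<tau>_perm: "\<tau> permutes {..<lim []}" using alternating_permutes[OF \<tau>_alt] by (simp add: lim_Nil)
  have \<tau>u: "\<tau> u = u" using u \<tau> by (simp add: cyc3_apply)
  have lim: "lim (ys @ [z]) = k" for z by (simp add: lim_def)
  have val: "valid (ys @ [u])" using p u by (simp add: valid_snoc)
  define \<sigma> where "\<sigma> = rig [] \<tau>"
  define \<sigma>' where "\<sigma>' = rig [] (inv_into UNIV \<tau>)"
  define x where "x = sw (ys @ [v]) a b"
  define y where "y = sw (ys @ [u]) a b"
  have \<sigma>N: "\<sigma> \<in> N" "\<sigma>' \<in> N" unfolding \<sigma>_def \<sigma>'_def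
    using N_root \<tau>_alt alternating_inv by blast+
  have \<sigma>\<sigma>': "\<sigma>' \<circ> \<sigma> = id" using rig_inv[OF \<tau>_perm] by (simp add: \<sigma>_def \<sigma>'_def)
  have S: "x \<in> Swaps (Suc (length ys))" "y \<in> Swaps (Suc (length ys))"
    using p val ab by (auto simp: x_def y_def lim intro!: SwapsI)
  have cx: "\<sigma> \<circ> x \<circ> \<sigma>' = sw (ys @ [\<tau> v]) a b" and cy: "\<sigma> \<circ> y \<circ> \<sigma>' = y"
    unfolding \<sigma>_def \<sigma>'_def x_def y_def
    using rig_conj[OF \<tau>_perm swap_permutes, of a "ys @ [v]" b] rig_conj[OF \<tau>_perm swap_permutes, of a "ys @ [u]" b]
      ab act_middle[of "[]" \<tau> ys v] act_middle[of "[]" \<tau> ys u] \<tau>u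
    by (auto simp: lim)
  have "(x \<circ> y) \<circ> \<sigma> \<circ> (y \<circ> x) \<in> N"
    using N_normal[OF Swaps_comp_Pos[OF S] \<sigma>N(1)] inv_Swaps_comp[OF S] by simp
  then have "(x \<circ> y) \<circ> \<sigma> \<circ> (y \<circ> x) \<circ> \<sigma>' \<in> N" by (rule N_comp[OF _ \<sigma>N(2)])
  also have "(x \<circ> y) \<circ> \<sigma> \<circ> (y \<circ> x) \<circ> \<sigma>' = x \<circ> y \<circ> (\<sigma> \<circ> y \<circ> (\<sigma>' \<circ> \<sigma>) \<circ> x \<circ> \<sigma>')"
    by (simp add: \<sigma>\<sigma>' comp_assoc)
  also have "\<dots> = x \<circ> y \<circ> ((\<sigma> \<circ> y \<circ> \<sigma>') \<circ> (\<sigma> \<circ> x \<circ> \<sigma>'))" by (simp add: comp_assoc)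
  also have "\<dots> = x \<circ> (y \<circ> y) \<circ> sw (ys @ [\<tau> v]) a b" unfolding cx cy by (simp add: comp_assoc)
  also have "\<dots> = x \<circ> sw (ys @ [\<tau> v]) a b" using Swaps_involution[OF S(2)] by simp
  finally show ?thesis unfolding x_def .
qed

text \<open>Swaps are involutions, so \<open>x \<circ> y \<in> N\<close> compares cosets of
  \<open>N\<close> and is an equivalence relation, as \<open>Swaps_connected\<close> requires. To
  conjugate \<open>x\<close> by a rigid \<open>g\<close> below the root, \<open>x\<close> is first
  traded modulo \<open>N\<close> for a swap \<open>x'\<close> in a main subtree that
  \<open>g\<close> leaves alone; conjugating \<open>x \<circ> x'\<close> by \<open>g\<close> then
  changes only \<open>x\<close>.\<close>

lemma Swaps_comp_N:
  assumes "x \<in> Swaps i" "y \<in> Swaps i"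
  shows "x \<circ> y \<in> N"
proof (cases "i = 0")
  case True
  then obtain a b c e where "x = sw [] a b" "y = sw [] c e" "a < k + 1" "b < k + 1" "c < k + 1" "e < k + 1"
    "a \<noteq> b" "c \<noteq> e"
    using assms by (auto simp: Swaps_def lim_def)
  moreover from this have "sw [] a b \<circ> sw [] c e = rig [] (transposition a b \<circ> transposition c e)"
    by (intro rig_comp[symmetric] swap_permutes) (auto simp: lim_Nil)
  ultimately show ?thesis
    using N_root[OF transpose_comp_alternating[of a "{..<k + 1}" b c e]] by simp
next
  case False
  show ?thesis
  proof (rule Swaps_connected[of i "\<lambda>x y. x \<circ> y \<in> N"])
    fix x y z assume S: "x \<in> Swaps i" "y \<in> Swaps i" "z \<in> Swaps i" and N: "x \<circ> y \<in> N" "y \<circ> z \<in> N"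
    have "(x \<circ> y) \<circ> (y \<circ> z) = x \<circ> (y \<circ> y) \<circ> z" by (simp add: comp_assoc)
    then show "x \<circ> z \<in> N" using N_comp[OF N] Swaps_involution[OF S(2)] by simp
  next
    fix x y assume "x \<in> Swaps i" "y \<in> Swaps i" "x \<circ> y \<in> N"
    then show "y \<circ> x \<in> N" using N_inv inv_Swaps_comp by metis
  next
    fix x assume "x \<in> Swaps i"
    then show "x \<circ> x \<in> N" using Swaps_involution N_id by metis
  next
    fix p q a b and \<tau> :: "nat \<Rightarrow> nat"
    assume p: "valid p" "length p = i" and ab: "a < lim p" "b < lim p" "a \<noteq> b"
      and q: "valid q" "length q \<le> i"
      and "\<exists>c e f. c < lim q \<and> e < lim q \<and> f < lim q \<and> distinct [c, e, f] \<and> \<tau> = cyc3 c e f"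
    then obtain c e f where \<tau>: "c < lim q" "e < lim q" "f < lim q" "distinct [c, e, f]" "\<tau> = cyc3 c e f"
      by blast
    have \<tau>_alt: "\<tau> \<in> alternating {..<lim q}" using \<tau> by (auto intro!: cyc3_alternating)
    have \<tau>_perm: "\<tau> permutes {..<lim q}" using alternating_permutes[OF \<tau>_alt] .
    obtain ys v where ys: "p = ys @ [v]" using p False by (metis length_0_conv rev_exhaust)
    have limp: "lim (ys @ [z]) = k" for z by (simp add: lim_def)
    show "sw p a b \<circ> (rig q \<tau> \<circ> sw p a b \<circ> rig q (inv_into UNIV \<tau>)) \<in> N"
    proof (cases "q = []")
      case True
      have "rig q \<tau> \<circ> sw p a b \<circ> rig q (inv_into UNIV \<tau>) = sw (ys @ [\<tau> v]) a b"
        using rig_conj[OF \<tau>_perm swap_permutes[OF ab(1,2)]] True ys act_middle[of "[]" \<tau> ys v]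
        by simp
      then show ?thesis
        using Swaps_conj_root[of ys v a b c e f \<tau>] p ab \<tau> True by (simp add: ys limp lim_Nil)
    next
      case qne: False
      \<comment> \<open>The last letter of a word names its main subtree. \<open>v'\<close> avoids
        the one of \<open>q\<close>, so that \<open>g\<close> fixes it pointwise, and differs from
        \<open>v\<close>; \<open>v''\<close> completes a 3-cycle leading from \<open>v\<close> to
        \<open>v'\<close>.\<close>
      define v' where "v' = (SOME z. z < k + 1 \<and> z \<noteq> v \<and> z \<noteq> last q)"
      define v'' where "v'' = (SOME z. z < k + 1 \<and> z \<noteq> v \<and> z \<noteq> v')"
      have ex: "\<exists>z. z < k + 1 \<and> z \<noteq> s \<and> z \<noteq> t" for s t
      proof -
        have "card ({..<k + 1} - {s, t}) \<ge> 1"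
          using diff_card_le_card_Diff[of "{s, t}" "{..<k + 1}"] k6 card_insert_le_m1[of 2 "{t}" s] by simp
        then show ?thesis by (metis DiffE card.empty ex_in_conv insertCI lessThan_iff not_one_le_zero)
      qed
      have v': "v' < k + 1" "v' \<noteq> v" "v' \<noteq> last q"
        using someI_ex[OF ex[of v "last q"]] by (auto simp: v'_def)
      have v'': "v'' < k + 1" "v'' \<noteq> v" "v'' \<noteq> v'"
        using someI_ex[OF ex[of v v']] by (auto simp: v''_def)
      have vk: "v < k + 1" using p ys by (simp add: valid_snoc)
      define x where "x = sw p a b"
      define x' where "x' = sw (ys @ [v']) a b"
      have val': "valid (ys @ [v'])" using p v' by (simp add: ys valid_snoc)
      have x'S: "x' \<in> Swaps i" using val' p ab by (auto simp: x'_def ys limp intro!: SwapsI)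
      have xS: "x \<in> Swaps i" using p ab by (auto simp: x_def intro!: SwapsI)
      have xx': "x \<circ> x' \<in> N"
        using Swaps_conj_root[of ys v a b v v' v'' "cyc3 v v' v''"] p ab v' v'' vk
        by (simp add: ys limp x_def x'_def cyc3_apply)
      define g where "g = rig q \<tau>"
      define g' where "g' = rig q (inv_into UNIV \<tau>)"
      have gP: "g \<in> Pos" using rig_positive[OF \<tau>_alt] by (simp add: g_def)
      have g': "inv_into UNIV g = g'" "g' \<circ> g = id"
        using inv_rig[OF \<tau>_perm] rig_inv[OF \<tau>_perm] by (simp_all add: g_def g'_def)
      have "ys @ [v'] \<noteq> zs @ z # q" for zs z
        using v'(3) qne by (metis append_is_Nil_conv last_ConsR last_append last_snoc list.discI)
      then have "act q \<tau> (ys @ [v']) = ys @ [v']" by (rule act_other)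
      moreover have "q \<noteq> ys @ [v']" using v'(3) by auto
      ultimately have gx': "g \<circ> x' \<circ> g' = x'"
        using rig_conj[OF \<tau>_perm swap_permutes, of a "ys @ [v']" b] ab q p
        by (simp add: g_def g'_def x'_def ys limp)
      have gxS: "g \<circ> x \<circ> g' \<in> Swaps i"
      proof (cases "q = p")
        case True
        have "g \<circ> x \<circ> g' = sw p (\<tau> a) (\<tau> b)"
          using sw_conj_same[of \<tau> p a b] \<tau>_perm ab True by (simp add: g_def g'_def x_def)
        moreover have "\<tau> a < lim p" "\<tau> b < lim p" "\<tau> a \<noteq> \<tau> b"
          using permutes_in_image[OF \<tau>_perm, of a] permutes_in_image[OF \<tau>_perm, of b]
            permutes_inj[OF \<tau>_perm] ab True by (auto simp: inj_eq)
        ultimately show ?thesis using SwapsI[OF p] by simp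
      next
        case ne: False
        then have "g \<circ> x \<circ> g' = sw (act q \<tau> p) a b"
          using rig_conj[OF \<tau>_perm swap_permutes[OF ab(1,2)]] q p by (simp add: g_def g'_def x_def)
        then show ?thesis
          using valid_act[OF \<tau>_perm p(1)] p ab by (auto intro!: SwapsI)
      qed
      have "g \<circ> (x \<circ> x') \<circ> g' \<in> N" using N_normal[OF gP xx'] g' by simp
      also have "g \<circ> (x \<circ> x') \<circ> g' = g \<circ> x \<circ> (g' \<circ> g) \<circ> x' \<circ> g'" by (simp add: g' comp_assoc)
      also have "\<dots> = (g \<circ> x \<circ> g') \<circ> (g \<circ> x' \<circ> g')" by (simp add: comp_assoc)
      finally have "(g \<circ> x \<circ> g') \<circ> x' \<in> N" unfolding gx' .
      then have "x' \<circ> (g \<circ> x \<circ> g') \<in> N" using N_inv inv_Swaps_comp[OF gxS x'S] by metis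
      then have "(x \<circ> x') \<circ> (x' \<circ> (g \<circ> x \<circ> g')) \<in> N" using xx' N_comp by blast
      moreover have "(x \<circ> x') \<circ> (x' \<circ> (g \<circ> x \<circ> g')) = x \<circ> (x' \<circ> x') \<circ> (g \<circ> x \<circ> g')"
        by (simp add: comp_assoc)
      ultimately show ?thesis
        using Swaps_involution[OF x'S] by (simp add: x_def g_def g'_def)
    qed
  qed (use assms in auto)
qed

lemma even_product_N:
  assumes "set ys \<subseteq> Swaps i" "even (length ys)"
  shows "compose_list ys \<in> N"
  using assms
proof (induction ys rule: induct_list012)
  case (3 x y zs)
  then have "x \<circ> y \<in> N" "compose_list zs \<in> N" by (auto intro: Swaps_comp_N)
  then have "(x \<circ> y) \<circ> compose_list zs \<in> N" by (rule N_comp)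
  then show ?case by (simp only: compose_list.simps comp_assoc)
qed (auto simp: N_id)

lemma sg_product:
  assumes "set ys \<subseteq> Swaps i"
  shows "compose_list ys \<in> Aut \<and> sg (Suc i) (compose_list ys) = (- 1) ^ length ys"
  using assms
proof (induction ys)
  case (Cons y ys)
  then have "y \<in> Swaps i" and IH: "compose_list ys \<in> Aut" "sg (Suc i) (compose_list ys) = (- 1) ^ length ys"
    by auto
  then have "sg (Suc i) y = - 1" "y \<in> Aut" using sg_Swaps_own_level Swaps_Aut by auto
  then show ?case
    using IH Aut_comp[of y "compose_list ys"] sg_comp[of y "compose_list ys" "Suc i"]
    unfolding compose_list.simps by (simp only: list.size power_Suc power_add) simp
qed (simp add: Aut_id sg_id)

text \<open>Descending induction on the depth to which an element is trivial. The product
  \<open>z\<close> of swaps that corrects the next level has the same sign there as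
  \<open>x\<close>, namely 1. Each swap has sign -1 at that level, so their number is even and
  \<open>z\<close> lies in \<open>N\<close>.\<close>

lemma Pos_Fix_subset_N: "j \<le> n \<Longrightarrow> Pos \<inter> Fix (n - j) \<subseteq> N"
proof (induction j)
  case 0
  then show ?case using N_Fix by simp
next
  case (Suc j)
  define i where "i = n - Suc j"
  have i: "n - j = Suc i" using Suc.prems by (simp add: i_def)
  show ?case
  proof
    fix x assume x: "x \<in> Pos \<inter> Fix (n - Suc j)"
    then obtain ys where ys: "set ys \<subseteq> Swaps i" "compose_list ys \<circ> x \<in> Fix (Suc i)"
      using Fix_decompose[of x i] by (auto simp: i_def)
    define z where "z = compose_list ys"
    have z: "z \<in> Aut" "sg (Suc i) z = (- 1) ^ length ys" using sg_product[OF ys(1)] by (auto simp: z_def)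
    have "level_perm E r (Suc i) (z \<circ> x) = id"
      using ys(2) by (auto simp: Fix_def level_perm_def perm_restrict_def level_eq fun_eq_iff z_def)
    then have "sg (Suc i) (z \<circ> x) = 1" by (simp add: sg_def)
    moreover have "sg (Suc i) (z \<circ> x) = sg (Suc i) z" using x z by (simp add: sg_comp Pos_def)
    ultimately have "even (length ys)" using z by (metis neg_one_odd_power one_neq_neg_one)
    then have zN: "z \<in> N" using even_product_N ys(1) by (simp add: z_def)
    then have "z \<circ> x \<in> Pos" using N_sub x Pos_comp by blast
    then have "z \<circ> x \<in> N" using ys(2) Suc i by (auto simp: z_def)
    then have "inv_into UNIV z \<circ> (z \<circ> x) \<in> N" using zN N_inv N_comp by blast
    moreover have "inv_into UNIV z \<circ> (z \<circ> x) = x"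
      using Aut_bij[OF z(1)] by (simp add: fun_eq_iff bij_is_inj)
    ultimately show "x \<in> N" by simp
  qed
qed

theorem Pos_subset_N: "Pos \<subseteq> N"
proof -
  have "Pos \<subseteq> Fix 0" by (auto simp: Fix_def Pos_def dist_eq_0 root_stabilizer_def)
  then show ?thesis using Pos_Fix_subset_N[of n] by auto
qed

end

end

section \<open>Finite quotients of the positive group\<close>

context rooted_tree
begin

text \<open>Extension by the identity outside the ball lets composition of functions serve as
  multiplication in the quotient.\<close>

definition res :: "nat \<Rightarrow> ('v \<Rightarrow> 'v) \<Rightarrow> 'v \<Rightarrow> 'v" where
  "res n x = perm_restrict x {v. d v \<le> n}"

lemma res_apply: "res n x v = (if d v \<le> n then x v else v)"
  by (simp add: res_def perm_restrict_def)

lemma res_comp: "y \<in> Aut \<Longrightarrow> res n (x \<circ> y) = res n x \<circ> res n y"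
  by (auto simp: res_apply fun_eq_iff Aut_dist)

lemma res_id: "res n id = id"
  by (auto simp: res_apply fun_eq_iff)

lemma res_eq_iff: "res n x = res n y \<longleftrightarrow> (\<forall>v. d v \<le> n \<longrightarrow> x v = y v)"
  by (auto simp: res_apply fun_eq_iff)

lemma finite_ball: "finite {v. d v \<le> n}"
proof -
  have "{v. d v \<le> n} = (\<Union>j\<le>n. level E r j)" by (auto simp: level_eq)
  then show ?thesis using finite_level by simp
qed

definition quot :: "nat \<Rightarrow> ('v \<Rightarrow> 'v) monoid" where
  "quot n = \<lparr>carrier = res n ` Pos, mult = (\<circ>), one = id\<rparr>"

lemma quot_simps [simp]:
  "carrier (quot n) = res n ` Pos" "x \<otimes>\<^bsub>quot n\<^esub> y = x \<circ> y" "\<one>\<^bsub>quot n\<^esub> = id"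
  by (simp_all add: quot_def)

lemma finite_quot: "finite (res n ` Pos)"
proof -
  let ?S = "{v. d v \<le> n}"
  have "(\<lambda>x. restrict x ?S) ` Pos \<subseteq> PiE ?S (\<lambda>_. ?S)"
    by (auto simp: Pos_Aut Aut_dist split: if_splits)
  then have "finite ((\<lambda>x. restrict x ?S) ` Pos)"
    using finite_PiE[of ?S "\<lambda>_. ?S"] finite_ball finite_subset by blast
  then have "finite ((\<lambda>f v. if d v \<le> n then f v else v) ` (\<lambda>x. restrict x ?S) ` Pos)" by simp
  moreover have "res n ` Pos = (\<lambda>f v. if d v \<le> n then f v else v) ` (\<lambda>x. restrict x ?S) ` Pos"
    unfolding image_image by (intro image_cong) (auto simp: res_apply fun_eq_iff)
  ultimately show ?thesis by simp
qed

lemma Pos_inv_comp: "x \<in> Pos \<Longrightarrow> inv_into UNIV x \<circ> x = id" "x \<in> Pos \<Longrightarrow> x \<circ> inv_into UNIV x = id"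
  using Aut_bij[OF Pos_Aut, of x] by (auto simp: bij_is_inj bij_is_surj surj_iff[symmetric])

lemma group_quot: "group (quot n)"
proof (rule groupI)
  fix g h assume "g \<in> carrier (quot n)" "h \<in> carrier (quot n)"
  then show "g \<otimes>\<^bsub>quot n\<^esub> h \<in> carrier (quot n)"
    using Pos_comp res_comp Pos_Aut by auto (metis imageI)
next
  show "\<one>\<^bsub>quot n\<^esub> \<in> carrier (quot n)" using Pos_id res_id by (metis imageI quot_simps(1,3))
next
  fix g assume "g \<in> carrier (quot n)"
  then obtain x where x: "x \<in> Pos" "g = res n x" by auto
  have "res n (inv_into UNIV x) \<circ> res n x = id"
    using x res_comp[of x n "inv_into UNIV x"] Pos_inv_comp res_id Pos_Aut by metis
  then show "\<exists>h\<in>carrier (quot n). h \<otimes>\<^bsub>quot n\<^esub> g = \<one>\<^bsub>quot n\<^esub>"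
    using x Pos_inv by (intro bexI[of _ "res n (inv_into UNIV x)"]) auto
qed (auto simp: comp_assoc)

text \<open>A subspace without invariant vectors on which the rigid even permutations of the \<open>k + 1\<close>
  main subtrees acted trivially would be fixed by all of \<open>Pos\<close>.\<close>

lemma quasirandom_quot: "group.quasirandom (quot n) (k - 1)"
proof -
  interpret H: group "quot n" by (rule group_quot)
  have "has_orthogonal (k - 1) V"
    if V: "subspace V" "V \<subseteq> H.mean_zero" "V \<noteq> {0}"
      and invar: "\<And>g v. g \<in> carrier (quot n) \<Longrightarrow> v \<in> V \<Longrightarrow> right_translate (quot n) g v \<in> V" for V
  proof -
    define T where "T x = right_translate (quot n) (res n x)" for x
    have T_comp: "T (x \<circ> y) v = T x (T y v)" if "x \<in> Pos" "y \<in> Pos" for x y v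
      using H.right_translate_mult[of "res n x" "res n y" v] that res_comp[OF Pos_Aut]
      by (simp add: T_def)
    have T_id: "T id v = v" for v
      using H.right_translate_one[of v] by (simp add: T_def res_id)
    have T_V: "T x v \<in> V" if "x \<in> Pos" "v \<in> V" for x v
      using invar[of "res n x" v] that by (simp add: T_def)
    have lim: "lim [] = k + 1" by (simp add: lim_def)
    have perm: "\<pi> permutes {..<lim []}" and pos: "rig [] \<pi> \<in> Pos" if "\<pi> \<in> alternating {..<k + 1}" for \<pi>
      using that rig_positive[of \<pi> "[]"] alternating_permutes[of \<pi>] by (simp_all only: lim)
    interpret A: alternating_action "{..<k + 1}" "\<lambda>\<pi>. T (rig [] \<pi>)" V
    proof
      show "T (rig [] id) = id" by (simp add: fun_eq_iff rig_id T_id)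
      show "orthogonal_transformation (T (rig [] \<pi>))" if "\<pi> \<in> alternating {..<k + 1}" for \<pi>
        unfolding T_def using pos[OF that] by (intro H.orthogonal_right_translate) simp
      show "T (rig [] (\<pi> \<circ> \<tau>)) = T (rig [] \<pi>) \<circ> T (rig [] \<tau>)"
        if "\<pi> \<in> alternating {..<k + 1}" "\<tau> \<in> alternating {..<k + 1}" for \<pi> \<tau>
        using T_comp[OF pos[OF that(1)] pos[OF that(2)]] rig_comp[OF perm[OF that(1)] perm[OF that(2)]]
        by (intro ext) simp
      show "T (rig [] \<pi>) v \<in> V" if "\<pi> \<in> alternating {..<k + 1}" "v \<in> V" for \<pi> v
        using T_V pos that by blast
    qed (use V in auto)
    have A.nontrivial
    proof (rule ccontr)
      assume "\<not> A.nontrivial"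
      then have triv: "T (rig [] \<pi>) v = v" if "\<pi> \<in> alternating {..<k + 1}" "v \<in> V" for \<pi> v
        using that unfolding A.nontrivial_def by blast
      define N where "N = {x \<in> Pos. \<forall>v\<in>V. T x v = v}"
      have "Pos \<subseteq> N"
      proof (rule Pos_subset_N[of N n])
        show "N \<subseteq> Pos" "id \<in> N" by (auto simp: N_def Pos_id T_id)
        show "x \<circ> y \<in> N" if "x \<in> N" "y \<in> N" for x y
          using that by (simp add: N_def Pos_comp T_comp)
        show "inv_into UNIV x \<in> N" if "x \<in> N" for x
        proof -
          have x: "x \<in> Pos" "\<And>v. v \<in> V \<Longrightarrow> T x v = v" using that by (auto simp: N_def)
          have "T (inv_into UNIV x) v = v" if "v \<in> V" for v
          proof -
            have "T (inv_into UNIV x) (T x v) = v"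
              using T_comp[OF Pos_inv[OF x(1)] x(1), of v] Pos_inv_comp(1)[OF x(1)] T_id by simp
            then show ?thesis using x(2)[OF that] by simp
          qed
          then show ?thesis using Pos_inv x by (simp add: N_def)
        qed
        show "g \<circ> x \<circ> inv_into UNIV g \<in> N" if g: "g \<in> Pos" and "x \<in> N" for g x
        proof -
          have x: "x \<in> Pos" "\<And>v. v \<in> V \<Longrightarrow> T x v = v" using \<open>x \<in> N\<close> by (auto simp: N_def)
          have "T (g \<circ> x \<circ> inv_into UNIV g) v = v" if "v \<in> V" for v
          proof -
            have "T (g \<circ> x \<circ> inv_into UNIV g) v = T g (T x (T (inv_into UNIV g) v))"
              using g x Pos_inv by (simp add: T_comp Pos_comp)
            also have "\<dots> = T (g \<circ> inv_into UNIV g) v"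
              using x(2) T_V Pos_inv g that by (simp add: T_comp)
            finally show ?thesis using Pos_inv_comp(2)[OF g] T_id by simp
          qed
          then show ?thesis using g x Pos_inv Pos_comp by (simp add: N_def)
        qed
        show "rig [] \<pi> \<in> N" if "\<pi> \<in> alternating {..<k + 1}" for \<pi>
          using triv pos that by (simp add: N_def)
        show "Pos \<inter> Fix n \<subseteq> N"
        proof
          fix x assume x: "x \<in> Pos \<inter> Fix n"
          then have "res n x = res n id" unfolding res_eq_iff by (simp add: Fix_def)
          then have "T x = T id" by (simp add: T_def)
          then show "x \<in> N" using x T_id by (simp add: N_def)
        qed
      qed
      then have fixed: "T x v = v" if "x \<in> Pos" "v \<in> V" for x v
        using that by (auto simp: N_def)
      \<comment> \<open>A function on the quotient fixed by all right translations is constant, and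
        a constant of mean zero vanishes.\<close>
      have "v = 0" if v: "v \<in> V" for v
      proof -
        have const: "coef v g = coef v id" if g: "g \<in> res n ` Pos" for g
        proof -
          obtain x where x: "x \<in> Pos" "g = res n x" using g by blast
          have "id \<in> carrier (quot n)" using H.one_closed by simp
          then have "coef (T x v) id = coef v g"
            using x by (simp add: T_def H.coef_right_translate)
          then show ?thesis using fixed[OF x(1) v] by simp
        qed
        have mz: "supp v \<subseteq> res n ` Pos" "(\<Sum>g\<in>res n ` Pos. coef v g) = 0"
          using v V(2) by (auto simp: H.mean_zero_def)
        have "(\<Sum>g\<in>res n ` Pos. coef v g) = (\<Sum>g\<in>res n ` Pos. coef v id)"
          by (intro sum.cong refl const)
        then have "(\<Sum>g\<in>res n ` Pos. coef v g) = real (card (res n ` Pos)) * coef v id"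
          by simp
        moreover have "card (res n ` Pos) \<noteq> 0" using finite_quot Pos_id by auto
        ultimately have "coef v id = 0" using mz by simp
        then have "coef v g = 0" for g using const[of g] mz(1) by (cases "g \<in> res n ` Pos") auto
        then show ?thesis by (intro finsupp_eqI) (simp add: coef_simps)
      qed
      then show False using V subspace_0[OF V(1)] by blast
    qed
    then have "has_orthogonal (card {..<k + 1} - 2) V"
      using k6 by (intro alternating_action_has_orthogonal[OF A.alternating_action_axioms]) auto
    then show ?thesis by simp
  qed
  then show ?thesis unfolding H.quasirandom_def by blast
qed

end

section \<open>The Haar measure\<close>

locale positive_haar = rooted_tree E r k
  for E :: "'v \<Rightarrow> 'v \<Rightarrow> bool" and r :: 'v and k :: nat +
  fixes \<mu> :: "('v \<Rightarrow> 'v) measure"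
  assumes haar: "normalized_haar_measure (positive_group E r)
    (pointwise_topology (carrier (positive_group E r))) \<mu>"
begin

abbreviation T where "T \<equiv> pointwise_topology Pos"

lemma space_mu: "space \<mu> = Pos"
  and sets_mu: "sets \<mu> = sigma_sets Pos {U. openin T U}"
  and emeasure_Pos: "emeasure \<mu> Pos = 1"
  and outer_regular: "A \<in> sets \<mu> \<Longrightarrow> emeasure \<mu> A = (INF U\<in>{U. openin T U \<and> A \<subseteq> U}. emeasure \<mu> U)"
  using haar by (auto simp: normalized_haar_measure_def carrier_positive_group)

sublocale finite_measure \<mu>
  by (rule finite_measureI) (simp add: space_mu emeasure_Pos)

lemma measure_Pos: "measure \<mu> Pos = 1"
  by (simp add: measure_def emeasure_Pos)

lemma open_sets: "openin T U \<Longrightarrow> U \<in> sets \<mu>"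
  unfolding sets_mu by (rule sigma_sets.Basic) simp

lemma l_coset_positive: "g <#\<^bsub>positive_group E r\<^esub> A = (\<lambda>x. g \<circ> x) ` A"
  by (auto simp: l_coset_def positive_group_def)

lemma measure_translate:
  assumes "g \<in> Pos" "A \<in> sets \<mu>"
  shows "measure \<mu> ((\<lambda>x. g \<circ> x) ` A) = measure \<mu> A"
proof -
  have "emeasure \<mu> (g <#\<^bsub>positive_group E r\<^esub> A) = emeasure \<mu> A"
    using haar assms by (auto simp: normalized_haar_measure_def carrier_positive_group)
  then show ?thesis by (simp add: l_coset_positive measure_def)
qed

lemma subset_Pos: "A \<in> sets \<mu> \<Longrightarrow> A \<subseteq> Pos"
  using sets.sets_into_space space_mu by blast

lemma open_coordinates:
  assumes "finite S"
  shows "openin T {x \<in> Pos. \<forall>v\<in>S. x v = g v}"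
proof -
  let ?B = "PiE UNIV (\<lambda>v. if v \<in> S then {g v} else UNIV)"
  have "{i. (if i \<in> S then {g i} else UNIV) \<noteq> (UNIV :: 'v set)} \<subseteq> S" by auto
  then have "finite {i. (if i \<in> S then {g i} else UNIV) \<noteq> topspace (discrete_topology (UNIV :: 'v set))}"
    using assms finite_subset by auto
  then have "openin (product_topology (\<lambda>_. discrete_topology UNIV) UNIV) ?B"
    by (intro product_topology_basis) auto
  moreover have "{x \<in> Pos. \<forall>v\<in>S. x v = g v} = ?B \<inter> Pos"
    by (auto simp: PiE_iff split: if_splits)
  ultimately show ?thesis
    unfolding pointwise_topology_def openin_subtopology by blast
qed

lemma open_res: "openin T {x \<in> Pos. res n x \<in> B}"
proof -
  have eq: "{x \<in> Pos. res n x \<in> B} = \<Union> ((\<lambda>g. {x \<in> Pos. \<forall>v\<in>{v. d v \<le> n}. x v = g v}) ` {g \<in> Pos. res n g \<in> B})"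
  proof (intro equalityI subsetI)
    fix x assume "x \<in> \<Union> ((\<lambda>g. {x \<in> Pos. \<forall>v\<in>{v. d v \<le> n}. x v = g v}) ` {g \<in> Pos. res n g \<in> B})"
    then obtain g where g: "res n g \<in> B" "x \<in> Pos" "\<forall>v\<in>{v. d v \<le> n}. x v = g v" by auto
    then have "res n x = res n g" unfolding res_eq_iff by simp
    then show "x \<in> {x \<in> Pos. res n x \<in> B}" using g by simp
  qed auto
  show ?thesis
    by (subst eq, rule openin_Union) (use open_coordinates[OF finite_ball] in blast)
qed

text \<open>A basic open set constrains finitely many vertices, and these lie in a common ball;
  openness can thus be tested on balls.\<close>

lemma open_iff:
  "openin T U \<longleftrightarrow> U \<subseteq> Pos \<and> (\<forall>x\<in>U. \<exists>n. \<forall>y\<in>Pos. res n y = res n x \<longrightarrow> y \<in> U)"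
proof (intro iffI conjI ballI)
  assume U: "openin T U"
  show "U \<subseteq> Pos" using subset_Pos open_sets U by blast
  fix x assume x: "x \<in> U"
  obtain W where W: "openin (product_topology (\<lambda>_. discrete_topology UNIV) UNIV) W" "U = W \<inter> Pos"
    using U unfolding pointwise_topology_def openin_subtopology by blast
  then obtain X where X: "x \<in> PiE UNIV X" "finite {i. X i \<noteq> topspace (discrete_topology (UNIV :: 'v set))}"
    "PiE UNIV X \<subseteq> W"
    using product_topology_open_contains_basis[OF W(1), of x] x by blast
  then have fin: "finite {i. X i \<noteq> UNIV}" by simp
  define n where "n = Max (insert 0 (d ` {i. X i \<noteq> UNIV}))"
  have n: "d i \<le> n" if "X i \<noteq> UNIV" for i
    unfolding n_def using fin that by (intro Max_ge) auto
  have "y \<in> U" if "y \<in> Pos" "res n y = res n x" for y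
  proof -
    have "y i \<in> X i" for i
    proof (cases "X i = UNIV")
      case False
      then have "y i = x i" using n that(2) unfolding res_eq_iff by blast
      then show ?thesis using X(1) by (auto simp: PiE_iff)
    qed simp
    then show ?thesis using X(3) W(2) that(1) by (auto simp: PiE_iff)
  qed
  then show "\<exists>n. \<forall>y\<in>Pos. res n y = res n x \<longrightarrow> y \<in> U" by blast
next
  assume U: "U \<subseteq> Pos \<and> (\<forall>x\<in>U. \<exists>n. \<forall>y\<in>Pos. res n y = res n x \<longrightarrow> y \<in> U)"
  show "openin T U"
  proof (subst openin_subopen, rule ballI)
    fix x assume x: "x \<in> U"
    then obtain n where "\<forall>y\<in>Pos. res n y = res n x \<longrightarrow> y \<in> U" using U by blast
    then show "\<exists>S. openin T S \<and> x \<in> S \<and> S \<subseteq> U"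
      using open_res[of n "{res n x}"] x U by (intro exI[of _ "{y \<in> Pos. res n y \<in> {res n x}}"]) auto
  qed
qed

lemma translate_image_iff:
  assumes "g \<in> Pos" "A \<subseteq> Pos" "x \<in> Pos"
  shows "x \<in> (\<lambda>x. g \<circ> x) ` A \<longleftrightarrow> inv_into UNIV g \<circ> x \<in> A"
proof
  assume "x \<in> (\<lambda>x. g \<circ> x) ` A"
  then show "inv_into UNIV g \<circ> x \<in> A"
    using Pos_inv_comp(1)[OF assms(1)] by (auto simp: comp_assoc[symmetric])
next
  assume "inv_into UNIV g \<circ> x \<in> A"
  moreover have "x = g \<circ> (inv_into UNIV g \<circ> x)"
    using Pos_inv_comp(2)[OF assms(1)] by (simp add: comp_assoc[symmetric])
  ultimately show "x \<in> (\<lambda>x. g \<circ> x) ` A" by blast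
qed

lemma translate_open:
  assumes g: "g \<in> Pos" and U: "openin T U"
  shows "openin T ((\<lambda>x. g \<circ> x) ` U)"
  unfolding open_iff
proof (intro conjI ballI)
  have UPos: "U \<subseteq> Pos" by (rule subset_Pos[OF open_sets[OF U]])
  then show "(\<lambda>x. g \<circ> x) ` U \<subseteq> Pos" using g Pos_comp by blast
  fix y assume "y \<in> (\<lambda>x. g \<circ> x) ` U"
  then obtain x where x: "x \<in> U" "y = g \<circ> x" by blast
  then obtain n where n: "\<And>z. z \<in> Pos \<Longrightarrow> res n z = res n x \<Longrightarrow> z \<in> U"
    using conjunct2[OF iffD1[OF open_iff U]] by meson
  have "z \<in> (\<lambda>x. g \<circ> x) ` U" if z: "z \<in> Pos" "res n z = res n y" for z
  proof -
    have "inv_into UNIV g \<circ> y = x"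
      using x Pos_inv_comp(1)[OF g] by (simp add: comp_assoc[symmetric])
    moreover have "res n (inv_into UNIV g \<circ> z) = res n (inv_into UNIV g \<circ> y)"
      using z(2) by (simp add: res_eq_iff)
    ultimately have "res n (inv_into UNIV g \<circ> z) = res n x" by (simp only:)
    then have "inv_into UNIV g \<circ> z \<in> U" by (rule n[OF Pos_comp[OF Pos_inv[OF g] z(1)]])
    then show ?thesis by (simp only: translate_image_iff[OF g UPos z(1)])
  qed
  then show "\<exists>n. \<forall>z\<in>Pos. res n z = res n y \<longrightarrow> z \<in> (\<lambda>x. g \<circ> x) ` U" by blast
qed

text \<open>Invariance of the measure equates two values without making the translate measurable,
  which the union bound in \<open>count_products_le\<close> requires.\<close>

lemma translate_sets:
  assumes g: "g \<in> Pos" and A: "A \<in> sets \<mu>"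
  shows "(\<lambda>x. g \<circ> x) ` A \<in> sets \<mu>"
  using A unfolding sets_mu
proof (induction rule: sigma_sets.induct)
  case (Basic U)
  then show ?case by (intro sigma_sets.Basic CollectI translate_open[OF g]) simp
next
  case Empty
  then show ?case by (simp add: sigma_sets.Empty)
next
  case (Compl A)
  have APos: "A \<subseteq> Pos" using Compl.hyps subset_Pos sets_mu by blast
  have eq: "(\<lambda>x. g \<circ> x) ` (Pos - A) = Pos - (\<lambda>x. g \<circ> x) ` A"
  proof (intro equalityI subsetI)
    fix y assume y: "y \<in> (\<lambda>x. g \<circ> x) ` (Pos - A)"
    then have yP: "y \<in> Pos" using g Pos_comp by auto
    then show "y \<in> Pos - (\<lambda>x. g \<circ> x) ` A"
      using y translate_image_iff[OF g _ yP, of "Pos - A"] translate_image_iff[OF g APos yP] by blast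
  next
    fix y assume y: "y \<in> Pos - (\<lambda>x. g \<circ> x) ` A"
    then have "inv_into UNIV g \<circ> y \<in> Pos - A"
      using translate_image_iff[OF g APos, of y] Pos_comp[OF Pos_inv[OF g], of y] by blast
    then show "y \<in> (\<lambda>x. g \<circ> x) ` (Pos - A)"
      using translate_image_iff[OF g, of "Pos - A" y] y by blast
  qed
  show ?case unfolding eq by (rule sigma_sets.Compl[OF Compl.IH])
next
  case (Union A)
  then show ?case unfolding image_UN by (intro sigma_sets.Union)
qed

text \<open>The fibres are translates of one of them, hence of equal measure, and they partition a
  space of measure 1. This serves both for the cosets of a ball stabilizer and for the possible
  images of a neighbour of the root.\<close>

lemma measure_fibre:
  assumes "finite I" "f ` Pos \<subseteq> I" "\<And>i. i \<in> I \<Longrightarrow> {x \<in> Pos. f x = i} \<in> sets \<mu>" "i0 \<in> I"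
    and "\<And>i. i \<in> I \<Longrightarrow> \<exists>g\<in>Pos. {x \<in> Pos. f x = i} = (\<lambda>x. g \<circ> x) ` {x \<in> Pos. f x = i0}"
    and "i \<in> I"
  shows "measure \<mu> {x \<in> Pos. f x = i} = 1 / card I"
proof -
  have eq: "measure \<mu> {x \<in> Pos. f x = j} = measure \<mu> {x \<in> Pos. f x = i0}" if j: "j \<in> I" for j
  proof -
    obtain g where "g \<in> Pos" "{x \<in> Pos. f x = j} = (\<lambda>x. g \<circ> x) ` {x \<in> Pos. f x = i0}"
      using assms(5)[OF j] by blast
    then show ?thesis using measure_translate[OF _ assms(3)[OF assms(4)]] by simp
  qed
  have "(\<Union>j\<in>I. {x \<in> Pos. f x = j}) = Pos" using assms(2) by auto
  then have "1 = (\<Sum>j\<in>I. measure \<mu> {x \<in> Pos. f x = j})"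
    using finite_measure_finite_Union[of I "\<lambda>j. {x \<in> Pos. f x = j}"] assms(1,3) measure_Pos
    by (auto simp: disjoint_family_on_def)
  also have "\<dots> = card I * measure \<mu> {x \<in> Pos. f x = i0}" using eq by simp
  finally show ?thesis using eq[OF assms(6)] assms(1,4) by (auto simp: divide_simps mult.commute)
qed

lemma fibre_translate:
  assumes "g \<in> Pos" "\<And>x. x \<in> Pos \<Longrightarrow> f (g \<circ> x) = j \<longleftrightarrow> f x = i"
  shows "{x \<in> Pos. f x = j} = (\<lambda>x. g \<circ> x) ` {x \<in> Pos. f x = i}"
proof (intro equalityI subsetI)
  fix x assume x: "x \<in> {x \<in> Pos. f x = j}"
  define y where "y = inv_into UNIV g \<circ> x"
  have "y \<in> Pos" using x assms(1) by (simp add: y_def Pos_comp Pos_inv)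
  moreover have "g \<circ> y = x" using Pos_inv_comp(2)[OF assms(1)] by (simp add: y_def comp_assoc[symmetric])
  ultimately show "x \<in> (\<lambda>x. g \<circ> x) ` {x \<in> Pos. f x = i}" using x assms(2)[of y] by auto
qed (use assms Pos_comp in auto)

lemma measure_res:
  assumes "B \<subseteq> res n ` Pos"
  shows "measure \<mu> {x \<in> Pos. res n x \<in> B} = card B / card (res n ` Pos)"
proof -
  have fib: "measure \<mu> {x \<in> Pos. res n x = h} = 1 / card (res n ` Pos)" if "h \<in> res n ` Pos" for h
  proof (rule measure_fibre[of _ "res n" id])
    show "{x \<in> Pos. res n x = i} \<in> sets \<mu>" for i using open_sets[OF open_res[of n "{i}"]] by simp
    show "id \<in> res n ` Pos" using Pos_id res_id by (metis imageI)
    fix h assume "h \<in> res n ` Pos"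
    then obtain g where g: "g \<in> Pos" "h = res n g" by blast
    have "res n (g \<circ> x) = h \<longleftrightarrow> res n x = id" if "x \<in> Pos" for x
    proof
      assume "res n (g \<circ> x) = h"
      then have "g (x v) = g v" if "d v \<le> n" for v using g that by (simp add: res_eq_iff)
      then have "x v = v" if "d v \<le> n" for v
        using Aut_bij[OF Pos_Aut[OF g(1)]] that by (metis bij_pointE)
      then show "res n x = id" using res_eq_iff[of n x id] by (simp add: res_id)
    next
      assume "res n x = id"
      then show "res n (g \<circ> x) = h" using g that by (simp add: res_comp Pos_Aut)
    qed
    then have "{x \<in> Pos. res n x = h} = (\<lambda>x. g \<circ> x) ` {x \<in> Pos. res n x = id}"
      by (rule fibre_translate[OF g(1)])
    then show "\<exists>g\<in>Pos. {x \<in> Pos. res n x = h} = (\<lambda>x. g \<circ> x) ` {x \<in> Pos. res n x = id}"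
      by (rule bexI[OF _ g(1)])
  qed (use finite_quot that in auto)
  have fin: "finite B" using assms finite_quot finite_subset by blast
  have "{x \<in> Pos. res n x \<in> B} = (\<Union>h\<in>B. {x \<in> Pos. res n x = h})" by auto
  also have "measure \<mu> \<dots> = (\<Sum>h\<in>B. measure \<mu> {x \<in> Pos. res n x = h})"
    using fin open_sets[OF open_res[of n "{h}" for h]]
    by (intro finite_measure_finite_Union) (auto simp: disjoint_family_on_def)
  also have "\<dots> = (\<Sum>h\<in>B. 1 / card (res n ` Pos))" using fib assms by (intro sum.cong) auto
  finally show ?thesis by simp
qed

lemma open_approximation:
  assumes U: "openin T U" and e: "e > 0"
  obtains n B where "B \<subseteq> res n ` Pos" "{x \<in> Pos. res n x \<in> B} \<subseteq> U"
    "measure \<mu> U < measure \<mu> {x \<in> Pos. res n x \<in> B} + e"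
proof -
  have UPos: "U \<subseteq> Pos" using subset_Pos open_sets U by blast
  \<comment> \<open>The union of the cylinders of depth \<open>n\<close> contained in
    \<open>U\<close>. It grows with \<open>n\<close> and exhausts \<open>U\<close>, so continuity
    from below applies.\<close>
  define C where "C n = {x \<in> Pos. \<forall>y\<in>Pos. res n y = res n x \<longrightarrow> y \<in> U}" for n
  have C_eq: "C n = {x \<in> Pos. res n x \<in> res n ` C n}" for n
    by (auto simp: C_def)
  have C_sets: "C n \<in> sets \<mu>" for n
    using open_sets[OF open_res[of n "res n ` C n"]] C_eq[of n] by simp
  have "C n \<subseteq> C (Suc n)" for n
    unfolding C_def res_eq_iff by auto
  then have "incseq C" by (rule incseq_SucI)
  have "(\<Union>n. C n) = U"
  proof (intro equalityI subsetI)
    fix x assume x: "x \<in> U"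
    then obtain n where n: "\<forall>y\<in>Pos. res n y = res n x \<longrightarrow> y \<in> U"
      using conjunct2[OF iffD1[OF open_iff U]] by meson
    then show "x \<in> (\<Union>n. C n)" using x UPos n by (auto simp: C_def)
  qed (auto simp: C_def)
  then have "(\<lambda>n. measure \<mu> (C n)) \<longlonglongrightarrow> measure \<mu> U"
    using finite_Lim_measure_incseq[of C] C_sets \<open>incseq C\<close> by auto
  then have "\<forall>\<^sub>F n in sequentially. measure \<mu> U - e < measure \<mu> (C n)"
    using e by (intro order_tendstoD) auto
  then obtain n where "measure \<mu> U - e < measure \<mu> (C n)"
    by (auto simp: eventually_sequentially)
  moreover have "C n \<subseteq> U" by (auto simp: C_def)
  ultimately show ?thesis
    using that[of "res n ` C n" n] C_eq[of n] by (auto simp: C_def)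
qed

text \<open>Outer regularity encloses \<open>A\<close> in an open set, which is then approximated
  from inside by a cylinder. Both lie in the open set and miss at most \<open>e\<close> of its
  measure, which bounds both differences.\<close>

lemma cylinder_approximation:
  assumes A: "A \<in> sets \<mu>" and e: "e > 0"
  obtains n B where "B \<subseteq> res n ` Pos" "measure \<mu> (A - {x \<in> Pos. res n x \<in> B}) \<le> e"
    "measure \<mu> ({x \<in> Pos. res n x \<in> B} - A) \<le> e"
proof -
  have "emeasure \<mu> A < emeasure \<mu> A + ennreal e"
    using e by (simp add: emeasure_eq_measure ennreal_less_iff flip: ennreal_plus)
  then have "(INF U\<in>{U. openin T U \<and> A \<subseteq> U}. emeasure \<mu> U) < emeasure \<mu> A + ennreal e"
    by (simp only: outer_regular[OF A, symmetric])
  then obtain U where U: "openin T U" "A \<subseteq> U" "emeasure \<mu> U < emeasure \<mu> A + ennreal e"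
    by (auto simp: INF_less_iff)
  then have lt: "measure \<mu> U < measure \<mu> A + e"
    using e by (simp add: emeasure_eq_measure ennreal_less_iff flip: ennreal_plus)
  obtain n B where B: "B \<subseteq> res n ` Pos" "{x \<in> Pos. res n x \<in> B} \<subseteq> U"
    "measure \<mu> U < measure \<mu> {x \<in> Pos. res n x \<in> B} + e"
    using open_approximation[OF U(1) e] .
  let ?C = "{x \<in> Pos. res n x \<in> B}"
  have sets: "U \<in> sets \<mu>" "?C \<in> sets \<mu>" using open_sets U open_res by auto
  have "measure \<mu> (A - ?C) \<le> measure \<mu> (U - ?C)" "measure \<mu> (?C - A) \<le> measure \<mu> (U - A)"
    using U(2) B(2) sets A by (auto intro!: finite_measure_mono)
  moreover have "measure \<mu> (U - ?C) = measure \<mu> U - measure \<mu> ?C" "measure \<mu> (U - A) = measure \<mu> U - measure \<mu> A"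
    using U(2) B(2) sets A by (auto intro!: finite_measure_Diff)
  ultimately show ?thesis using that[OF B(1)] lt B(3) by linarith
qed

section \<open>Product-free sets\<close>

definition product_free :: "('v \<Rightarrow> 'v) set \<Rightarrow> bool" where
  "product_free A \<longleftrightarrow> A \<inter> (A <#>\<^bsub>positive_group E r\<^esub> A) = {}"

lemma product_free_iff: "product_free A \<longleftrightarrow> (\<forall>x\<in>A. \<forall>y\<in>A. x \<circ> y \<notin> A)"
  by (auto simp: product_free_def set_mult_def positive_group_def)

text \<open>For \<open>h\<close> in the approximating set \<open>B\<close> that is the image of some \<open>a \<in> A\<close>, almost nothing of
  \<open>h B\<close> meets \<open>B\<close>, because \<open>a A\<close> and \<open>A\<close> are disjoint; all other \<open>h\<close> are few.\<close>

lemma count_products_le: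
  assumes A: "A \<in> sets \<mu>" "product_free A" and B: "B \<subseteq> res n ` Pos"
    and e: "measure \<mu> ({x \<in> Pos. res n x \<in> B} - A) \<le> e"
  shows "(\<Sum>g\<in>B. real (card {h \<in> B. g \<circ> h \<in> B})) \<le> 3 * e * (real (card (res n ` Pos)))\<^sup>2"
proof -
  define N where "N = real (card (res n ` Pos))"
  have Npos: "N > 0" using finite_quot Pos_id card_gt_0_iff[of "res n ` Pos"] by (auto simp: N_def)
  define C where "C = {x \<in> Pos. res n x \<in> B}"
  have C: "C \<in> sets \<mu>" "C \<subseteq> Pos" using open_sets open_res by (auto simp: C_def)
  have CA: "C - A \<in> sets \<mu>" "measure \<mu> (C - A) \<le> e" using C A e by (auto simp: C_def)
  have e0: "e \<ge> 0" using CA(2) measure_nonneg[of \<mu> "C - A"] by linarith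
  have finB: "finite B" using B finite_quot finite_subset by blast
  have B_le: "card B \<le> N" using B finite_quot card_mono by (auto simp: N_def)
  define B1 where "B1 = B \<inter> res n ` A"
  have good: "real (card {h \<in> B. g \<circ> h \<in> B}) \<le> 2 * e * N" if g: "g \<in> B1" for g
  proof -
    obtain a where a: "a \<in> A" "g = res n a" using g by (auto simp: B1_def)
    have aP: "a \<in> Pos" using a subset_Pos A by blast
    define D where "D = {x \<in> Pos. res n x \<in> {h \<in> B. g \<circ> h \<in> B}}"
    have "measure \<mu> D = card {h \<in> B. g \<circ> h \<in> B} / N"
      unfolding D_def N_def using B by (intro measure_res) auto
    moreover have "D \<subseteq> (C - A) \<union> (\<lambda>x. inv_into UNIV a \<circ> x) ` (C - A)"
    proof
      fix x assume x: "x \<in> D"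
      then have xP: "x \<in> Pos" and xC: "x \<in> C" and axC: "a \<circ> x \<in> C"
        using aP a by (auto simp: D_def C_def Pos_comp res_comp Pos_Aut)
      show "x \<in> (C - A) \<union> (\<lambda>x. inv_into UNIV a \<circ> x) ` (C - A)"
      \<comment> \<open>If \<open>x\<close> lies in \<open>A\<close>, then
        \<open>a \<circ> x\<close> does not, by product-freeness; so one of \<open>x\<close> and
        \<open>a \<circ> x\<close> falls into \<open>C - A\<close>.\<close>
      proof (cases "x \<in> A")
        case True
        then have "a \<circ> x \<in> C - A" using A(2) a axC by (simp add: product_free_iff)
        moreover have "x = inv_into UNIV a \<circ> (a \<circ> x)"
          using Pos_inv_comp(1)[OF aP] by (simp add: comp_assoc[symmetric])
        ultimately show ?thesis by blast
      qed (use xC in simp)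
    qed
    moreover have "(\<lambda>x. inv_into UNIV a \<circ> x) ` (C - A) \<in> sets \<mu>"
      by (rule translate_sets[OF Pos_inv[OF aP] CA(1)])
    ultimately have "card {h \<in> B. g \<circ> h \<in> B} / N \<le> measure \<mu> (C - A) + measure \<mu> ((\<lambda>x. inv_into UNIV a \<circ> x) ` (C - A))"
      using CA finite_measure_mono[of D "(C - A) \<union> (\<lambda>x. inv_into UNIV a \<circ> x) ` (C - A)"]
        measure_Un_le[of "C - A" \<mu> "(\<lambda>x. inv_into UNIV a \<circ> x) ` (C - A)"] by auto
    also have "\<dots> \<le> 2 * e"
      using measure_translate[OF Pos_inv[OF aP] CA(1)] CA by simp
    finally show ?thesis using Npos by (simp add: divide_simps)
  qed
  have bad: "real (card (B - B1)) \<le> e * N"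
  proof -
    have "card (B - B1) / N = measure \<mu> {x \<in> Pos. res n x \<in> B - B1}"
      unfolding N_def using B by (intro measure_res[symmetric]) auto
    also have "\<dots> \<le> measure \<mu> (C - A)"
      using CA by (intro finite_measure_mono) (auto simp: C_def B1_def)
    also have "\<dots> \<le> e" by (rule CA(2))
    finally show ?thesis using Npos by (simp only: pos_divide_le_eq)
  qed
  have "(\<Sum>g\<in>B. real (card {h \<in> B. g \<circ> h \<in> B}))
    = (\<Sum>g\<in>B1. real (card {h \<in> B. g \<circ> h \<in> B})) + (\<Sum>g\<in>B - B1. real (card {h \<in> B. g \<circ> h \<in> B}))"
    using sum.subset_diff[of B1 B "\<lambda>g. real (card {h \<in> B. g \<circ> h \<in> B})"] finB
    by (simp add: B1_def add.commute)
  \<comment> \<open>At most N good elements with at most 2eN products each, and at most eN bad ones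
    with at most N each, give 3eN^2.\<close>
  also have "\<dots> \<le> (\<Sum>g\<in>B1. 2 * e * N) + (\<Sum>g\<in>B - B1. N)"
  proof (intro add_mono sum_mono good)
    fix g
    have "card {h \<in> B. g \<circ> h \<in> B} \<le> card B" using finB by (intro card_mono) auto
    then show "real (card {h \<in> B. g \<circ> h \<in> B}) \<le> N" using B_le by linarith
  qed
  also have "\<dots> = card B1 * (2 * e * N) + card (B - B1) * N" by simp
  also have "\<dots> \<le> N * (2 * e * N) + (e * N) * N"
  proof (intro add_mono mult_right_mono)
    have "card B1 \<le> card B" using finB by (intro card_mono) (auto simp: B1_def)
    then show "real (card B1) \<le> N" using B_le by linarith
  qed (use bad e0 Npos in auto)
  also have "\<dots> = 3 * e * N\<^sup>2" by (simp add: power2_eq_square)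
  finally show ?thesis by (simp add: N_def)
qed

lemma product_free_measure_le:
  assumes A: "A \<in> sets \<mu>" "product_free A"
  shows "measure \<mu> A \<le> 1 / (real k - 1) powr (1 / 3)"
proof -
  define a where "a = measure \<mu> A"
  define m where "m = real k - 1"
  have m: "m > 0" "real (k - 1) = m" using k6 by (auto simp: m_def)
  have a0: "a \<ge> 0" by (simp add: a_def)
  have approx: "\<exists>b. \<bar>b - a\<bar> \<le> e \<and> b ^ 3 - b * sqrt (b / m) \<le> 3 * e" if e: "e > 0" for e
  proof -
    obtain n B where B: "B \<subseteq> res n ` Pos" "measure \<mu> (A - {x \<in> Pos. res n x \<in> B}) \<le> e"
      "measure \<mu> ({x \<in> Pos. res n x \<in> B} - A) \<le> e"
      using cylinder_approximation[OF A(1) e] .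
    define N where "N = real (card (res n ` Pos))"
    have Npos: "N > 0" using finite_quot Pos_id card_gt_0_iff[of "res n ` Pos"] by (auto simp: N_def)
    define b where "b = card B / N"
    let ?C = "{x \<in> Pos. res n x \<in> B}"
    have b: "measure \<mu> ?C = b" using measure_res[OF B(1)] by (simp add: b_def N_def)
    have C: "?C \<in> sets \<mu>" using open_sets open_res by auto
    have "a = measure \<mu> (A - ?C) + measure \<mu> (A \<inter> ?C)" "b = measure \<mu> (?C - A) + measure \<mu> (A \<inter> ?C)"
    proof -
      have disj: "measure \<mu> ((X - Y) \<union> (X \<inter> Y)) = measure \<mu> (X - Y) + measure \<mu> (X \<inter> Y)"
        if "X \<in> sets \<mu>" "Y \<in> sets \<mu>" for X Y
        using that by (intro finite_measure_Union) auto
      have split: "measure \<mu> X = measure \<mu> (X - Y) + measure \<mu> (X \<inter> Y)"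
        if "X \<in> sets \<mu>" "Y \<in> sets \<mu>" for X Y
        using disj[OF that] by (simp only: Un_Diff_Int)
      show "a = measure \<mu> (A - ?C) + measure \<mu> (A \<inter> ?C)"
        unfolding a_def by (rule split[OF A(1) C])
      have "?C \<inter> A = A \<inter> ?C" by blast
      then show "b = measure \<mu> (?C - A) + measure \<mu> (A \<inter> ?C)"
        using split[OF C A(1)] b by (simp only:)
    qed
    then have "\<bar>b - a\<bar> \<le> e"
      using B(2,3) measure_nonneg[of \<mu> "A - ?C"] measure_nonneg[of \<mu> "?C - A"] by linarith
    moreover have "b ^ 3 - b * sqrt (b / m) \<le> 3 * e"
    proof -
      interpret H: group "quot n" by (rule group_quot)
      have "real (card B) ^ 3 / N - card B * sqrt (N * card B / m)
          \<le> (\<Sum>g\<in>B. real (card {h \<in> B. g \<circ> h \<in> B}))"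
        using H.count_products_ge[OF _ _ _ quasirandom_quot, of B] finite_quot B(1) k6
        by (simp add: N_def m_def)
      also have "\<dots> \<le> 3 * e * N\<^sup>2"
        using count_products_le[OF A B(1,3)] by (simp add: N_def)
      finally have "real (card B) ^ 3 / N - card B * sqrt (N * card B / m) \<le> 3 * e * N\<^sup>2" .
      moreover have "real (card B) = b * N" using Npos by (simp add: b_def)
      moreover have "sqrt (N * (b * N) / m) = N * sqrt (b / m)"
      proof -
        have eq: "N * (b * N) / m = N\<^sup>2 * (b / m)" by (simp add: power2_eq_square)
        show ?thesis unfolding eq real_sqrt_mult using Npos by simp
      qed
      \<comment> \<open>Division by N^2 leaves an inequality for densities that no longer mentions
        the quotient, whose depth depends on \<open>e\<close>; this is what allows \<open>e\<close>
        to tend to 0.\<close>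
      ultimately have "(b ^ 3 - b * sqrt (b / m)) * N\<^sup>2 \<le> (3 * e) * N\<^sup>2"
        using Npos by (simp add: power_mult_distrib power3_eq_cube power2_eq_square algebra_simps)
      then show ?thesis using Npos by simp
    qed
    ultimately show ?thesis by blast
  qed
  have "\<forall>j. \<exists>b. \<bar>b - a\<bar> \<le> 1 / real (Suc j) \<and> b ^ 3 - b * sqrt (b / m) \<le> 3 * (1 / real (Suc j))"
    by (intro allI approx) simp
  then obtain b where b: "\<And>j. \<bar>b j - a\<bar> \<le> 1 / real (Suc j)"
    "\<And>j. b j ^ 3 - b j * sqrt (b j / m) \<le> 3 * (1 / real (Suc j))" by metis
  have lim0: "(\<lambda>j. 1 / real (Suc j)) \<longlonglongrightarrow> 0"
    using LIMSEQ_inverse_real_of_nat by (simp add: inverse_eq_divide)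
  have "(\<lambda>j. b j - a) \<longlonglongrightarrow> 0"
    by (rule Lim_null_comparison[OF _ lim0]) (use b in auto)
  then have lim: "b \<longlonglongrightarrow> a" by (simp add: LIM_zero_iff)
  have "a ^ 3 - a * sqrt (a / m) \<le> 3 * 0"
  proof (rule LIMSEQ_le)
    show "(\<lambda>j. b j ^ 3 - b j * sqrt (b j / m)) \<longlonglongrightarrow> a ^ 3 - a * sqrt (a / m)"
      using m by (intro tendsto_intros lim) auto
    show "(\<lambda>j. 3 * (1 / real (Suc j))) \<longlonglongrightarrow> 3 * 0" by (intro tendsto_intros lim0)
  qed (use b in auto)
  then have le: "a ^ 3 \<le> a * sqrt (a / m)" by simp
  \<comment> \<open>Squaring gives a^6 <= a^3 / m, and a^3 cancels unless a = 0.\<close>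
  have cube: "a ^ 3 \<le> 1 / m"
  proof (cases "a = 0")
    case False
    then have a: "a > 0" using a0 by simp
    have "(a ^ 3)\<^sup>2 \<le> (a * sqrt (a / m))\<^sup>2" using le a by (intro power_mono) auto
    also have "\<dots> = a\<^sup>2 * (a / m)" using a m by (simp add: power_mult_distrib)
    also have "\<dots> = a ^ 3 * (1 / m)" by (simp add: power2_eq_square power3_eq_cube)
    finally have "a ^ 3 * a ^ 3 \<le> a ^ 3 * (1 / m)" by (simp only: power2_eq_square)
    then show ?thesis by (rule mult_left_le_imp_le) (use a in simp)
  qed (use m in simp)
  have "a = (a ^ 3) powr (1 / 3)"
  proof (cases "a = 0")
    case False
    then have "a > 0" using a0 by simp
    then have "a ^ 3 = a powr 3" using powr_realpow[of a 3] by simp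
    then show ?thesis using \<open>a > 0\<close> by (simp only: powr_powr) simp
  qed simp
  also have "\<dots> \<le> (1 / m) powr (1 / 3)" using cube a0 by (intro powr_mono2) auto
  also have "\<dots> = 1 / m powr (1 / 3)" using m by (simp add: powr_divide)
  finally show ?thesis by (simp add: a_def m_def)
qed

text \<open>If x and y send u to v, then xy sends u to xv, which differs from xu = v as u and v
  differ. Even permutations of the main subtrees are transitive, so all k + 1 possible images of u
  are equally likely.\<close>

lemma ex_product_free:
  "\<exists>A\<in>sets \<mu>. product_free A \<and> measure \<mu> A = 1 / (real k + 1)"
proof -
  define u where "u = vertex [0]"
  define I where "I = (\<lambda>a. vertex [a]) ` {..<k + 1}"
  have val: "valid [a]" if "a < k + 1" for a using that by (simp add: lim_def)
  have inj: "vertex [a] = vertex [b] \<Longrightarrow> a = b" if "a < k + 1" "b < k + 1" for a b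
    using vertex_inj[OF val[OF that(1)] val[OF that(2)]] by blast
  then have card: "card I = k + 1" unfolding I_def by (subst card_image) (auto simp: inj_on_def)
  have fibre: "measure \<mu> {x \<in> Pos. x u = i} = 1 / card I" if "i \<in> I" for i
  proof (rule measure_fibre[of I "\<lambda>x. x u" u])
    show "(\<lambda>x. x u) ` Pos \<subseteq> I"
    proof safe
      fix x assume x: "x \<in> Pos"
      have "length (word (x u)) = 1"
        using Aut_dist[OF Pos_Aut[OF x], of u] dist_vertex[OF val[of 0]] length_word by (simp add: u_def)
      then obtain a where a: "word (x u) = [a]" by (auto simp: length_Suc_conv)
      then have "a < k + 1" using word(1)[of "x u"] by (simp add: lim_def)
      moreover have "x u = vertex [a]" using word(2)[of "x u"] a by simp
      ultimately show "x u \<in> I" by (simp add: I_def)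
    qed
    show "{x \<in> Pos. x u = i} \<in> sets \<mu>" for i
      using open_sets[OF open_coordinates[of "{u}" "\<lambda>_. i"]] by simp
    fix i assume "i \<in> I"
    then obtain a where a: "a < k + 1" "i = vertex [a]" by (auto simp: I_def)
    obtain \<pi> where \<pi>: "\<pi> \<in> alternating {..<k + 1}" "\<pi> 0 = a"
    proof (cases "a = 0")
      case True
      then show ?thesis using that[of id] by simp
    next
      case False
      show ?thesis
        by (rule alternating_2_transitive[of "{..<k + 1}" 0 a a 0])
          (use False a k6 that in auto)
    qed
    have g: "rig [] \<pi> \<in> Pos" using rig_positive[of \<pi> "[]"] \<pi> by (simp add: lim_def)
    have "rig [] \<pi> u = i"
      using \<pi> a word_vertex[OF val[of 0]] by (simp add: rig_def u_def)
    then have "rig [] \<pi> (x u) = i \<longleftrightarrow> x u = u" for x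
      using Aut_bij[OF Pos_Aut[OF g]] by (metis bij_pointE)
    then have "{x \<in> Pos. x u = i} = (\<lambda>x. rig [] \<pi> \<circ> x) ` {x \<in> Pos. x u = u}"
      by (intro fibre_translate[OF g]) simp
    then show "\<exists>g\<in>Pos. {x \<in> Pos. x u = i} = (\<lambda>x. g \<circ> x) ` {x \<in> Pos. x u = u}"
      by (rule bexI[OF _ g])
  qed (use that in \<open>auto simp: I_def u_def\<close>)
  define v where "v = vertex [1]"
  have "v \<in> I" using k6 by (auto simp: I_def v_def)
  have "u \<noteq> v" using inj[of 0 1] k6 by (auto simp: u_def v_def)
  define A where "A = {x \<in> Pos. x u = v}"
  have "A \<in> sets \<mu>"
    unfolding A_def using open_sets[OF open_coordinates[of "{u}" "\<lambda>_. v"]] by simp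
  moreover have "product_free A"
    unfolding product_free_iff
  proof (intro ballI notI)
    fix x y assume "x \<in> A" "y \<in> A" "x \<circ> y \<in> A"
    then have "x v = x u" "x \<in> Pos" by (auto simp: A_def)
    then show False using Aut_bij[OF Pos_Aut, of x] \<open>u \<noteq> v\<close> by (metis bij_pointE)
  qed
  moreover have "measure \<mu> A = 1 / (real k + 1)"
    unfolding A_def using fibre[OF \<open>v \<in> I\<close>] card by simp
  ultimately show ?thesis by blast
qed

lemma pf_bounds:
  "1 / (real k + 1) \<le> pf (positive_group E r) \<mu>"
  "pf (positive_group E r) \<mu> \<le> 1 / (real k - 1) powr (1 / 3)"
proof -
  let ?S = "{measure \<mu> A | A. A \<in> sets \<mu> \<and> product_free A}"
  have pf: "pf (positive_group E r) \<mu> = Sup ?S"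
    by (simp add: pf_def product_free_def)
  have le: "x \<le> 1 / (real k - 1) powr (1 / 3)" if "x \<in> ?S" for x
    using that product_free_measure_le by blast
  obtain A where A: "A \<in> sets \<mu>" "product_free A" "measure \<mu> A = 1 / (real k + 1)"
    using ex_product_free by blast
  then have mem: "1 / (real k + 1) \<in> ?S" by (intro CollectI exI[of _ A]) simp
  \<comment> \<open>The upper bound also provides the boundedness that a supremum of reals
    needs.\<close>
  show "1 / (real k + 1) \<le> pf (positive_group E r) \<mu>"
    unfolding pf by (rule cSup_upper[OF mem bdd_aboveI]) (rule le)
  show "pf (positive_group E r) \<mu> \<le> 1 / (real k - 1) powr (1 / 3)"
    unfolding pf by (rule cSup_least) (use mem le in blast)+
qed

end

theorem theorem6:
  fixes E :: "'v \<Rightarrow> 'v \<Rightarrow> bool" and r :: 'v and k :: nat and \<mu> :: "('v \<Rightarrow> 'v) measure"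
  assumes "k \<ge> 6"
    and "regular_tree (k + 1) E"
    and "normalized_haar_measure (positive_group E r)
           (pointwise_topology (carrier (positive_group E r))) \<mu>"
  shows "1 / (real k + 1) \<le> pf (positive_group E r) \<mu> \<and>
         pf (positive_group E r) \<mu> \<le> 1 / (real k - 1) powr (1 / 3)"
proof -
  interpret positive_haar E r k \<mu>
    using assms by unfold_locales
  show ?thesis using pf_bounds by simp
qed

end
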